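(* Let $p,q\in[1,\infty)$ and let $X$ be a finite-dimensional complex Banach space with $R_{p,q}(X)>0$. Then $$\lim_{n\to\infty}R^n_{p,q}(X)\sqrt{\frac{n}{\log n}}=1.$$
   Context: For a complex Banach space $X$ and a holomorphic $f:\mathbb D^n\to X$ ($\mathbb D^n$ the open unit polydisk), $f(z)=x_0+\sum_{|\alpha|\ge1}x_\alpha z^\alpha$ (multi-index notation), with $\sup_{z\in\mathbb D^n}\|f(z)\|\le1$, define $R^n_{p,q}(f,X)=\sup\{r\ge0: \|x_0\|^p+(\sum_{k\ge1}\sum_{|\alpha|=k}\|x_\alpha z^\alpha\|)^q\le1\ \forall z\in r\mathbb D^n\}$, $R^n_{p,q}(X)=\inf$ of $R^n_{p,q}(f,X)$ over all such $f$, and $R_{p,q}(X)=R^1_{p,q}(X)$. *)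

theory Defs
  imports "HOL-Analysis.Analysis"
begin

class complex_vector_space = real_vector +
  fixes cscale :: "complex \<Rightarrow> 'a \<Rightarrow> 'a"
  assumes cscale_add_right: "cscale a (x + y) = cscale a x + cscale a y"
    and cscale_add_left: "cscale (a + b) x = cscale a x + cscale b x"
    and cscale_cscale: "cscale a (cscale b x) = cscale (a * b) x"
    and cscale_one: "cscale 1 x = x"
    and scaleR_cscale: "scaleR r x = cscale (complex_of_real r) x"

class complex_normed_vector_space = complex_vector_space + real_normed_vector +
  assumes norm_cscale: "norm (cscale a x) = cmod a * norm x"

definition complex_fin_dim :: "'a::complex_vector_space itself \<Rightarrow> bool" where
  "complex_fin_dim _ \<longleftrightarrow>
     (\<exists>B::'a set. finite B \<and> (\<forall>x. \<exists>c. x = (\<Sum>b\<in>B. cscale (c b) b)))"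

definition multi_idx :: "nat \<Rightarrow> (nat \<Rightarrow> nat) set" where
  "multi_idx n = {\<alpha>. \<forall>i\<ge>n. \<alpha> i = 0}"

definition mi_deg :: "nat \<Rightarrow> (nat \<Rightarrow> nat) \<Rightarrow> nat" where
  "mi_deg n \<alpha> = (\<Sum>i<n. \<alpha> i)"

definition monom :: "nat \<Rightarrow> (nat \<Rightarrow> complex) \<Rightarrow> (nat \<Rightarrow> nat) \<Rightarrow> complex" where
  "monom n z \<alpha> = (\<Prod>i<n. z i ^ \<alpha> i)"

definition polydisk :: "nat \<Rightarrow> real \<Rightarrow> (nat \<Rightarrow> complex) set" where
  "polydisk n r = {z. \<forall>i<n. cmod (z i) < r}"

text \<open>The coefficient family x of a holomorphic f on D^n with sup norm at most 1:
  f(z) = sum over all multi-indices of x_alpha z^alpha converges at every z in D^n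
  and has norm at most 1.\<close>
definition bhol_coeffs :: "nat \<Rightarrow> ((nat \<Rightarrow> nat) \<Rightarrow> 'a::complex_normed_vector_space) \<Rightarrow> bool" where
  "bhol_coeffs n x \<longleftrightarrow>
     (\<forall>z\<in>polydisk n 1.
        (\<lambda>\<alpha>. cscale (monom n z \<alpha>) (x \<alpha>)) summable_on multi_idx n \<and>
        norm (\<Sum>\<^sub>\<infinity>\<alpha>\<in>multi_idx n. cscale (monom n z \<alpha>) (x \<alpha>)) \<le> 1)"

definition hom_norm :: "nat \<Rightarrow> ((nat \<Rightarrow> nat) \<Rightarrow> 'a::complex_normed_vector_space)
    \<Rightarrow> (nat \<Rightarrow> complex) \<Rightarrow> nat \<Rightarrow> real" where
  "hom_norm n x z k = (\<Sum>\<alpha>\<in>{\<alpha>\<in>multi_idx n. mi_deg n \<alpha> = k}. norm (cscale (monom n z \<alpha>) (x \<alpha>)))"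

text \<open>R^n_{p,q}(f,X), as an extended real (it is +infinity e.g. for constants).\<close>
definition Rf :: "real \<Rightarrow> real \<Rightarrow> nat \<Rightarrow> ((nat \<Rightarrow> nat) \<Rightarrow> 'a::complex_normed_vector_space) \<Rightarrow> ereal" where
  "Rf p q n x = Sup (ereal ` {r. r \<ge> 0 \<and>
      (\<forall>z\<in>polydisk n r.
         summable (\<lambda>k. hom_norm n x z (Suc k)) \<and>
         norm (x (\<lambda>_. 0)) powr p + (\<Sum>k. hom_norm n x z (Suc k)) powr q \<le> 1)})"

definition RX :: "real \<Rightarrow> real \<Rightarrow> nat \<Rightarrow> 'a::complex_normed_vector_space itself \<Rightarrow> ereal" where
  "RX p q n _ = Inf {Rf p q n (x :: (nat \<Rightarrow> nat) \<Rightarrow> 'a) | x. bhol_coeffs n x}"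

end

theory Submission
  imports Defs "HOL-Complex_Analysis.Cauchy_Integral_Formula" "HOL-Real_Asymp.Real_Asymp"
begin

text \<open>
  Lower bound.  Averaging over roots of unity turns the one-variable hypothesis into a bound
  \<open>\<parallel>P\<^sub>m(z)\<parallel> \<le> (1 - \<parallel>x\<^sub>0\<parallel>\<^sup>p)\<^bsup>1/q\<^esup> / r\<^sub>0\<close> for all homogeneous parts, with \<open>r\<^sub>0\<close> independent of \<open>m\<close> and \<open>n\<close>.
  Coordinate functionals reduce the estimate of \<open>\<Sum> \<parallel>x\<^sub>\<alpha>\<parallel>\<close> over \<open>\<bar>\<alpha>\<bar> = m\<close> to scalar polynomials.
  Differentiate such a polynomial in \<open>k\<close> fixed directions: the derivatives have degree \<open>d = m - k\<close>, and
  for fixed \<open>z\<close> they are the coefficients of a bounded \<open>k\<close>-linear form, so their \<open>s\<close>-th powers with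
  \<open>s = 2k/(k+1)\<close> have bounded sum (Bohnenblust--Hille).  The \<open>L\<^sub>2\<close> and \<open>L\<^sub>s\<close> norms of a polynomial of degree
  \<open>d\<close> differ by a factor of order \<open>2\<^bsup>d/k\<^esup>\<close>, which for large \<open>k\<close> is \<open>(1 + o(1))\<^sup>d\<close>, and Cauchy--Schwarz gives
  coefficient sums of size \<open>n\<^bsup>(m-1)/2\<^esup> (e/m)\<^bsup>m/2\<^esup> (1 + o(1))\<^sup>m\<close>; the critical degree is \<open>m \<approx> log n\<close>.

  Upper bound.  A polynomial of degree \<open>m = \<lceil>log n\<rceil>\<close> with random coefficients \<open>\<plusminus>1\<close> has \<open>N \<ge> n\<^sup>m/m!\<close>
  monomials and supremum \<open>O((N n log m)\<^bsup>1/2\<^esup>)\<close>.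
\<close>

section \<open>Homogeneous polynomials and their derivatives\<close>

text \<open>At radius (1 - \<epsilon>) sqrt(log n / n) the sum over degree m is about (1 -
  \<epsilon>)^m n^(-1/2) (e log n / m)^(m/2) (1 + o(1))^m. The power of e log n / m is largest at m
  = log n, where it equals n^(1/2) and cancels n^(-1/2) exactly: this is the origin of the constant
  1. A loss C^m with a fixed C > 1 would therefore spoil the result, whereas factors such as m^k or
  (log n)^k are harmless. All exponential losses must be paid out of the slack (1 - \<epsilon>)^m. A
  second demand comes from X: its constants (dimension, coordinate functionals, 1/r0) multiply the
  whole sum, so the sum must tend to 0 and not merely stay bounded. The exponents p and q leave no
  trace in the limit because the homogeneous parts are bounded by a multiple of the very amount that
  the sum is allowed to reach. Integrals over the torus are replaced by averages over roots of unity
  of high enough order, so every moment is a finite sum.\<close>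

definition hom_idx :: "nat \<Rightarrow> nat \<Rightarrow> (nat \<Rightarrow> nat) set" where
  "hom_idx n d = {\<alpha>\<in>multi_idx n. mi_deg n \<alpha> = d}"

definition hom_poly :: "nat \<Rightarrow> nat \<Rightarrow> ((nat \<Rightarrow> nat) \<Rightarrow> complex) \<Rightarrow> (nat \<Rightarrow> complex) \<Rightarrow> complex" where
  "hom_poly n d c z = (\<Sum>\<alpha>\<in>hom_idx n d. c \<alpha> * monom n z \<alpha>)"

text \<open>Closed rather than open, so that roots of unity and unimodular directions are admissible
  points. Coordinates from n on are unconstrained.\<close>

definition cpolydisk :: "nat \<Rightarrow> (nat \<Rightarrow> complex) set" where
  "cpolydisk n = {z. \<forall>i<n. cmod (z i) \<le> 1}"

text \<open>Functions vanishing from n on are lists of length n, which reduces counting monomials to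
  the known number of lists with a given sum.\<close>

lemma bij_betw_hom_idx_lists:
  "bij_betw (\<lambda>\<alpha>. map \<alpha> [0..<n]) (hom_idx n d) {l. length l = n \<and> sum_list l = d}"
proof (rule bij_betwI[where g = "\<lambda>l i. if i < n then l ! i else 0"])
  show "(\<lambda>\<alpha>. map \<alpha> [0..<n]) \<in> hom_idx n d \<rightarrow> {l. length l = n \<and> sum_list l = d}"
    by (auto simp: hom_idx_def mi_deg_def interv_sum_list_conv_sum_set_nat atLeast0LessThan)
  show "(\<lambda>l i. if i < n then l ! i else 0) \<in> {l. length l = n \<and> sum_list l = d} \<rightarrow> hom_idx n d"
    by (auto simp: hom_idx_def multi_idx_def mi_deg_def sum_list_sum_nth atLeast0LessThan)
  show "(\<lambda>i. if i < n then map \<alpha> [0..<n] ! i else 0) = \<alpha>" if "\<alpha> \<in> hom_idx n d" for \<alpha>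
    using that by (auto simp: hom_idx_def multi_idx_def)
  show "map (\<lambda>i. if i < n then l ! i else 0) [0..<n] = l"
    if "l \<in> {l. length l = n \<and> sum_list l = d}" for l
    using that by (auto intro!: nth_equalityI)
qed

lemma card_hom_idx: "card (hom_idx n d) = (d + n - 1) choose d"
  using bij_betw_same_card[OF bij_betw_hom_idx_lists[of n d]] card_length_sum_list[of n d] by simp

lemma finite_hom_idx [simp]: "finite (hom_idx n d)"
proof -
  have "finite {l::nat list. length l = n \<and> sum_list l = d}"
    by (rule finite_subset[OF _ finite_lists_length_eq[of "{..d}" n]])
      (auto dest: member_le_sum_list)
  then show ?thesis using bij_betw_finite[OF bij_betw_hom_idx_lists[of n d]] by simp
qed

lemma card_hom_idx_upper: "card (hom_idx n d) * fact d \<le> (n + d) ^ d"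
proof -
  have "((d + n - 1) choose d) * fact d \<le> (d + n - 1) ^ d" by (rule binomial_fact_pow)
  also have "\<dots> \<le> (n + d) ^ d" by (rule power_mono) auto
  finally show ?thesis by (simp add: card_hom_idx)
qed

text \<open>Passing from d to d + 1 multiplies the number of monomials times d! by d + n, hence by
  at least n.\<close>

lemma card_hom_idx_lower:
  assumes "n \<ge> 1" shows "n ^ d \<le> card (hom_idx n d) * fact d"
proof -
  have "n ^ d \<le> ((d + n - 1) choose d) * fact d"
  proof (induction d)
    case (Suc d)
    have "(Suc d + n - 1 choose Suc d) * Suc d = (d + n) * (d + n - 1 choose d)"
      using Suc_times_binomial_eq[of "d + n - 1" d] assms by (simp add: mult.commute)
    then have "(Suc d + n - 1 choose Suc d) * fact (Suc d) = (d + n) * ((d + n - 1 choose d) * fact d)"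
      by (metis fact_Suc mult.assoc of_nat_id)
    moreover have "n * n ^ d \<le> (d + n) * ((d + n - 1 choose d) * fact d)"
      by (rule mult_mono) (use Suc in auto)
    ultimately show ?case by simp
  qed simp
  then show ?thesis by (simp add: card_hom_idx)
qed

lemma hom_idx_0: "hom_idx n 0 = {\<lambda>_. 0}"
proof -
  have "\<alpha> = (\<lambda>_. 0)" if "\<forall>i\<ge>n. \<alpha> i = 0" "\<forall>i<n. \<alpha> i = 0" for \<alpha> :: "nat \<Rightarrow> nat"
    using that by (metis linorder_not_le)
  then show ?thesis by (auto simp: hom_idx_def multi_idx_def mi_deg_def)
qed

lemma norm_monom_le:
  assumes "\<And>i. i < n \<Longrightarrow> cmod (z i) \<le> r" "\<alpha> \<in> hom_idx n d"
  shows "cmod (monom n z \<alpha>) \<le> r ^ d"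
proof -
  have "cmod (monom n z \<alpha>) = (\<Prod>i<n. cmod (z i) ^ \<alpha> i)"
    by (simp add: monom_def prod_norm[symmetric] norm_power)
  also have "\<dots> \<le> (\<Prod>i<n. r ^ \<alpha> i)"
    by (intro prod_mono conjI power_mono) (auto simp: assms)
  also have "\<dots> = r ^ d"
    using assms(2) by (auto simp: power_sum hom_idx_def mi_deg_def)
  finally show ?thesis .
qed

lemma monom_scale:
  assumes "\<alpha> \<in> hom_idx n d" shows "monom n (\<lambda>i. a * z i) \<alpha> = a ^ d * monom n z \<alpha>"
  using assms by (auto simp: monom_def power_mult_distrib prod.distrib power_sum hom_idx_def mi_deg_def)

lemma hom_poly_scale: "hom_poly n d c (\<lambda>i. a * z i) = a ^ d * hom_poly n d c z"
  by (auto simp: hom_poly_def sum_distrib_left monom_scale intro!: sum.cong)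

section \<open>Partial derivatives and the multilinear forms they define\<close>

definition partial_coeffs :: "nat \<Rightarrow> ((nat \<Rightarrow> nat) \<Rightarrow> complex) \<Rightarrow> (nat \<Rightarrow> nat) \<Rightarrow> complex" where
  "partial_coeffs j c \<beta> = of_nat (Suc (\<beta> j)) * c (\<beta>(j := Suc (\<beta> j)))"

lemma mi_deg_upd_Suc: "j < n \<Longrightarrow> mi_deg n (\<beta>(j := Suc (\<beta> j))) = Suc (mi_deg n \<beta>)"
  by (simp add: mi_deg_def sum.remove[of "{..<n}" j])

lemma bij_betw_hom_idx_incr:
  assumes "j < n"
  shows "bij_betw (\<lambda>\<beta>. \<beta>(j := Suc (\<beta> j))) (hom_idx n d) {\<alpha>\<in>hom_idx n (Suc d). \<alpha> j \<noteq> 0}"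
proof (rule bij_betwI[where g = "\<lambda>\<alpha>. \<alpha>(j := \<alpha> j - 1)"])
  show "(\<lambda>\<beta>. \<beta>(j := Suc (\<beta> j))) \<in> hom_idx n d \<rightarrow> {\<alpha> \<in> hom_idx n (Suc d). \<alpha> j \<noteq> 0}"
    using assms by (auto simp: hom_idx_def mi_deg_upd_Suc) (auto simp: multi_idx_def)
  show "(\<lambda>\<alpha>. \<alpha>(j := \<alpha> j - 1)) \<in> {\<alpha> \<in> hom_idx n (Suc d). \<alpha> j \<noteq> 0} \<rightarrow> hom_idx n d"
  proof
    fix \<alpha> assume a: "\<alpha> \<in> {\<alpha> \<in> hom_idx n (Suc d). \<alpha> j \<noteq> 0}"
    then have "mi_deg n ((\<alpha>(j := \<alpha> j - 1))(j := Suc ((\<alpha>(j := \<alpha> j - 1)) j))) = Suc d"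
      by (simp add: hom_idx_def)
    then have "mi_deg n (\<alpha>(j := \<alpha> j - 1)) = d"
      using mi_deg_upd_Suc[OF assms, of "\<alpha>(j := \<alpha> j - 1)"] by simp
    then show "\<alpha>(j := \<alpha> j - 1) \<in> hom_idx n d"
      using a assms by (auto simp: hom_idx_def multi_idx_def)
  qed
qed (auto simp: fun_upd_idem)

lemma prod_pow_upd_Suc:
  assumes "j < n"
  shows "u j ^ \<beta> j * (\<Prod>i\<in>{..<n}-{j}. u i ^ (\<beta>(j := Suc (\<beta> j))) i) = monom n u \<beta>"
proof -
  have "(\<Prod>i\<in>{..<n}-{j}. u i ^ (\<beta>(j := Suc (\<beta> j))) i) = (\<Prod>i\<in>{..<n}-{j}. u i ^ \<beta> i)"
    by (intro prod.cong) auto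
  then show ?thesis using assms by (simp add: monom_def prod.remove[of "{..<n}" j])
qed

lemma hom_poly_has_field_derivative:
  "((\<lambda>t. hom_poly n (Suc d) c (\<lambda>i. z i + t * w i)) has_field_derivative
     (\<Sum>j<n. w j * hom_poly n d (partial_coeffs j c) (\<lambda>i. z i + t * w i))) (at t)"
proof -
  define u where "u = (\<lambda>i. z i + t * w i)"
  \<comment> \<open>For \<open>\<alpha> j = 0\<close> the truncated exponent
    \<open>\<alpha> j - 1\<close> does no harm: the factor \<open>of_nat (\<alpha> j)\<close>
    vanishes, and only indices with \<open>\<alpha> j \<noteq> 0\<close> survive below.\<close>
  define D where "D \<alpha> j = of_nat (\<alpha> j) * (w j * u j ^ (\<alpha> j - 1)) * (\<Prod>i\<in>{..<n}-{j}. u i ^ \<alpha> i)" for \<alpha> j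
  have "((\<lambda>t. hom_poly n (Suc d) c (\<lambda>i. z i + t * w i)) has_field_derivative
     (\<Sum>\<alpha>\<in>hom_idx n (Suc d). c \<alpha> * (\<Sum>j<n. D \<alpha> j))) (at t)"
    unfolding hom_poly_def monom_def D_def u_def
    by (intro DERIV_sum DERIV_cmult has_field_derivative_prod) (auto intro!: derivative_eq_intros)
  also have "(\<Sum>\<alpha>\<in>hom_idx n (Suc d). c \<alpha> * (\<Sum>j<n. D \<alpha> j)) = (\<Sum>j<n. \<Sum>\<alpha>\<in>hom_idx n (Suc d). c \<alpha> * D \<alpha> j)"
    unfolding sum_distrib_left by (rule sum.swap)
  also have "\<dots> = (\<Sum>j<n. w j * hom_poly n d (partial_coeffs j c) u)"
  proof (rule sum.cong[OF refl])
    fix j assume "j \<in> {..<n}"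
    then have j: "j < n" by simp
    have "(\<Sum>\<alpha>\<in>hom_idx n (Suc d). c \<alpha> * D \<alpha> j) = (\<Sum>\<alpha>\<in>{\<alpha>\<in>hom_idx n (Suc d). \<alpha> j \<noteq> 0}. c \<alpha> * D \<alpha> j)"
      by (rule sum.mono_neutral_right) (auto simp: D_def)
    also have "\<dots> = (\<Sum>\<beta>\<in>hom_idx n d. c (\<beta>(j := Suc (\<beta> j))) * D (\<beta>(j := Suc (\<beta> j))) j)"
      by (rule sum.reindex_bij_betw[OF bij_betw_hom_idx_incr[OF j], symmetric])
    also have "\<dots> = (\<Sum>\<beta>\<in>hom_idx n d. w j * (partial_coeffs j c \<beta> * monom n u \<beta>))"
      by (intro sum.cong refl) (simp add: D_def partial_coeffs_def prod_pow_upd_Suc[OF j, symmetric] del: of_nat_Suc)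
    finally show "(\<Sum>\<alpha>\<in>hom_idx n (Suc d). c \<alpha> * D \<alpha> j) = w j * hom_poly n d (partial_coeffs j c) u"
      by (simp add: hom_poly_def sum_distrib_left)
  qed
  finally show ?thesis by (simp add: u_def)
qed

text \<open>Cauchy's estimate for t -> P(z + t w) on the circle of radius 1/m, where m is the
  degree. There the point stays in the polydisk of radius 1 + 1/m, and homogeneity costs only (1 +
  1/m)^m \<le> e. The loss is linear in m, so k derivatives cost a power of m and no exponential
  factor.\<close>

lemma hom_poly_gradient_bound:
  assumes B: "\<And>z. z \<in> cpolydisk n \<Longrightarrow> cmod (hom_poly n (Suc d) c z) \<le> B"
    and z: "z \<in> cpolydisk n" and w: "w \<in> cpolydisk n"
  shows "cmod (\<Sum>j<n. w j * hom_poly n d (partial_coeffs j c) z) \<le> exp 1 * Suc d * B"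
proof -
  define m where "m = real (Suc d)"
  define h where "h t = hom_poly n (Suc d) c (\<lambda>i. z i + t * w i)" for t
  have m: "m > 0" by (simp add: m_def)
  have B0: "B \<ge> 0" using B[OF z] norm_ge_zero order_trans by blast
  have der: "(h has_field_derivative (\<Sum>j<n. w j * hom_poly n d (partial_coeffs j c) (\<lambda>i. z i + t * w i))) (at t)" for t
    unfolding h_def by (rule hom_poly_has_field_derivative)
  have hol: "h holomorphic_on A" for A
    unfolding holomorphic_on_def using der field_differentiable_at_within field_differentiable_def by blast
  have bd: "norm (h t) \<le> exp 1 * B" if t: "norm (0 - t) = 1 / m" for t
  proof -
    define s where "s = 1 + 1 / m"
    have s: "s > 0" using m by (simp add: s_def add_pos_pos)
    have "(\<lambda>i. (z i + t * w i) / of_real s) \<in> cpolydisk n"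
      unfolding cpolydisk_def
    proof safe
      fix i assume i: "i < n"
      have "cmod (z i + t * w i) \<le> cmod (z i) + cmod t * cmod (w i)"
        by (metis norm_mult norm_triangle_ineq)
      also have "\<dots> \<le> 1 + cmod t * 1"
        by (intro add_mono mult_left_mono) (use z w i in \<open>auto simp: cpolydisk_def\<close>)
      also have "\<dots> = s" using t by (simp add: s_def)
      finally show "cmod ((z i + t * w i) / of_real s) \<le> 1" using s by (simp add: norm_divide)
    qed
    from B[OF this] have 1: "cmod (hom_poly n (Suc d) c (\<lambda>i. (z i + t * w i) / of_real s)) \<le> B" .
    have "h t = hom_poly n (Suc d) c (\<lambda>i. of_real s * ((z i + t * w i) / of_real s))"
      using s by (simp add: h_def)
    also have "\<dots> = of_real s ^ Suc d * hom_poly n (Suc d) c (\<lambda>i. (z i + t * w i) / of_real s)"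
      by (rule hom_poly_scale)
    finally have "cmod (h t) \<le> s ^ Suc d * B"
      using 1 s by (simp add: norm_mult norm_power mult_left_mono del: power_Suc)
    also have "s ^ Suc d \<le> exp (1 / m) ^ Suc d"
      using s exp_ge_add_one_self[of "1/m"] by (intro power_mono) (auto simp: s_def)
    also have "exp (1 / m) ^ Suc d = exp 1"
      using exp_of_nat_mult[of "Suc d" "1/m"] m by (simp add: m_def)
    finally show ?thesis using B0 by (simp add: mult_right_mono)
  qed
  have "norm ((deriv ^^ 1) h 0) \<le> fact 1 * (exp 1 * B) / (1 / m) ^ 1"
    by (rule Cauchy_inequality) (use m hol bd in \<open>auto intro: holomorphic_on_imp_continuous_on\<close>)
  moreover have "deriv h 0 = (\<Sum>j<n. w j * hom_poly n d (partial_coeffs j c) z)"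
    using DERIV_imp_deriv[OF der[of 0]] by simp
  ultimately show ?thesis by (simp add: m_def mult_ac)
qed

fun partials_coeffs :: "nat list \<Rightarrow> ((nat \<Rightarrow> nat) \<Rightarrow> complex) \<Rightarrow> (nat \<Rightarrow> nat) \<Rightarrow> complex" where
  "partials_coeffs [] c = c"
| "partials_coeffs (j # js) c = partials_coeffs js (partial_coeffs j c)"

lemma partials_lincomb: "partials_coeffs js (\<lambda>\<beta>. \<Sum>j\<in>J. w j * c j \<beta>) = (\<lambda>\<beta>. \<Sum>j\<in>J. w j * partials_coeffs js (c j) \<beta>)"
proof (induction js arbitrary: c)
  case (Cons a js)
  have "partial_coeffs a (\<lambda>\<beta>. \<Sum>j\<in>J. w j * c j \<beta>) = (\<lambda>\<beta>. \<Sum>j\<in>J. w j * partial_coeffs a (c j) \<beta>)"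
    by (rule ext) (simp add: partial_coeffs_def sum_distrib_left mult_ac)
  then show ?case by (simp add: Cons.IH)
qed simp

lemma hom_poly_lincomb: "hom_poly n d (\<lambda>\<beta>. \<Sum>j\<in>J. w j * c j \<beta>) z = (\<Sum>j\<in>J. w j * hom_poly n d (c j) z)"
  unfolding hom_poly_def sum_distrib_left sum_distrib_right
  by (subst sum.swap) (simp add: mult_ac)

definition tuples :: "nat \<Rightarrow> nat \<Rightarrow> nat list set" where
  "tuples n k = {js. set js \<subseteq> {..<n} \<and> length js = k}"

lemma finite_tuples [simp]: "finite (tuples n k)"
  unfolding tuples_def by (rule finite_lists_length_eq) simp

lemma card_tuples: "card (tuples n k) = n ^ k"
  unfolding tuples_def using card_lists_length_eq[of "{..<n}" k] by simp

lemma tuples_0: "tuples n 0 = {[]}"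
  by (auto simp: tuples_def)

lemma sum_tuples_Suc: "(\<Sum>js\<in>tuples n (Suc k). f js) = (\<Sum>j<n. \<Sum>js\<in>tuples n k. f (j # js))"
proof -
  have "bij_betw (\<lambda>(j, js). j # js) ({..<n} \<times> tuples n k) (tuples n (Suc k))"
    by (rule bij_betwI[where g = "\<lambda>js. (hd js, tl js)"]) (auto simp: tuples_def length_Suc_conv)
  from sum.reindex_bij_betw[OF this, of f] show ?thesis
    by (simp add: sum.cartesian_product case_prod_beta)
qed

text \<open>Contracting the first slot with \<open>w 0\<close> gives the directional derivative
  \<open>c'\<close>, again a homogeneous polynomial, bounded by the gradient estimate; each of the k
  contractions costs at most e (k + d). The point z is a parameter: for fixed z the sum is a
  k-linear form in the vectors \<open>w s\<close>.\<close>

lemma partials_form_bound: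
  assumes "\<And>z. z \<in> cpolydisk n \<Longrightarrow> cmod (hom_poly n (k + d) c z) \<le> B"
    and z: "z \<in> cpolydisk n" and w: "\<And>s. w s \<in> cpolydisk n"
  shows "cmod (\<Sum>js\<in>tuples n k. (\<Prod>s<k. w s (js ! s)) * hom_poly n d (partials_coeffs js c) z)
     \<le> (exp 1 * real (k + d)) ^ k * B"
  using assms(1) w
proof (induction k arbitrary: c B w)
  case 0
  then show ?case using z by (simp add: tuples_0)
next
  case (Suc k)
  define c' where "c' = (\<lambda>\<beta>. \<Sum>j<n. w 0 j * partial_coeffs j c \<beta>)"
  define B' where "B' = exp 1 * Suc (k + d) * B"
  have B0: "B \<ge> 0" using Suc.prems(1)[OF z] norm_ge_zero order_trans by blast
  have b: "cmod (hom_poly n (k + d) c' y) \<le> B'" if "y \<in> cpolydisk n" for y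
    unfolding c'_def hom_poly_lincomb B'_def
    by (rule hom_poly_gradient_bound) (use Suc.prems that in auto)
  have "(\<Sum>js\<in>tuples n (Suc k). (\<Prod>s<Suc k. w s (js ! s)) * hom_poly n d (partials_coeffs js c) z)
      = (\<Sum>j<n. \<Sum>js\<in>tuples n k. (\<Prod>s<k. w (Suc s) (js ! s)) * (w 0 j * hom_poly n d (partials_coeffs js (partial_coeffs j c)) z))"
    unfolding sum_tuples_Suc by (simp add: prod.lessThan_Suc_shift mult_ac del: prod.lessThan_Suc)
  also have "\<dots> = (\<Sum>js\<in>tuples n k. (\<Prod>s<k. w (Suc s) (js ! s)) * hom_poly n d (partials_coeffs js c') z)"
    unfolding c'_def partials_lincomb hom_poly_lincomb sum_distrib_left by (rule sum.swap)
  finally have "cmod (\<Sum>js\<in>tuples n (Suc k). (\<Prod>s<Suc k. w s (js ! s)) * hom_poly n d (partials_coeffs js c) z)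
     \<le> (exp 1 * real (k + d)) ^ k * B'"
    using Suc.IH[of c' B' "\<lambda>s. w (Suc s)"] b Suc.prems(2) by simp
  also have "\<dots> \<le> (exp 1 * real (Suc k + d)) ^ k * B'"
    by (intro mult_right_mono power_mono) (auto simp: B'_def B0)
  also have "\<dots> = (exp 1 * real (Suc k + d)) ^ Suc k * B" by (simp add: B'_def)
  finally show ?case .
qed

text \<open>Every monomial of degree k + d is sent by some tuple of k differentiations to a nonzero
  integer multiple of a monomial of degree d. Multiplicities and overcounting only enlarge the
  right-hand side.\<close>

lemma sum_coeff_le_partials:
  "(\<Sum>\<alpha>\<in>hom_idx n (k + d). cmod (c \<alpha>)) \<le> (\<Sum>js\<in>tuples n k. \<Sum>\<beta>\<in>hom_idx n d. cmod (partials_coeffs js c \<beta>))"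
proof (induction k arbitrary: c)
  case 0
  then show ?case by (simp add: tuples_0)
next
  case (Suc k)
  have "(\<Sum>\<alpha>\<in>hom_idx n (Suc (k + d)). cmod (c \<alpha>))
      \<le> (\<Sum>(j, \<beta>)\<in>{..<n} \<times> hom_idx n (k + d). cmod (partial_coeffs j c \<beta>))"
  proof (rule sum_le_included[where i = "\<lambda>(j, \<beta>). \<beta>(j := Suc (\<beta> j))"], goal_cases)
    case 4
    show ?case
    proof
      fix \<alpha> assume a: "\<alpha> \<in> hom_idx n (Suc (k + d))"
      then obtain j where j: "j < n" "\<alpha> j \<noteq> 0"
        by (force simp: hom_idx_def mi_deg_def intro: ccontr)
      then obtain \<beta> where b: "\<beta> \<in> hom_idx n (k + d)" "\<alpha> = \<beta>(j := Suc (\<beta> j))"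
        using bij_betw_hom_idx_incr[of j n "k + d"] a unfolding bij_betw_def by blast
      have "1 * cmod (c \<alpha>) \<le> real (Suc (\<beta> j)) * cmod (c \<alpha>)"
        by (intro mult_right_mono) auto
      then have "cmod (c \<alpha>) \<le> cmod (partial_coeffs j c \<beta>)"
        using b by (simp add: partial_coeffs_def norm_mult del: of_nat_Suc)
      then show "\<exists>y\<in>{..<n} \<times> hom_idx n (k + d). (case y of (j, \<beta>) \<Rightarrow> \<beta>(j := Suc (\<beta> j))) = \<alpha> \<and>
          cmod (c \<alpha>) \<le> (case y of (j, \<beta>) \<Rightarrow> cmod (partial_coeffs j c \<beta>))"
        using j b by (intro bexI[of _ "(j, \<beta>)"]) auto
    qed
  qed auto
  also have "\<dots> = (\<Sum>j<n. \<Sum>\<beta>\<in>hom_idx n (k + d). cmod (partial_coeffs j c \<beta>))"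
    by (simp add: sum.cartesian_product)
  also have "\<dots> \<le> (\<Sum>j<n. \<Sum>js\<in>tuples n k. \<Sum>\<beta>\<in>hom_idx n d. cmod (partials_coeffs js (partial_coeffs j c) \<beta>))"
    by (intro sum_mono Suc.IH)
  finally show ?case by (simp add: sum_tuples_Suc)
qed

section \<open>Moments of trigonometric polynomials\<close>

definition unity_roots :: "nat \<Rightarrow> complex set" where
  "unity_roots N = {z. z ^ N = 1}"

lemma finite_unity_roots [simp]: "N > 0 \<Longrightarrow> finite (unity_roots N)"
  unfolding unity_roots_def by (rule finite_roots_unity) simp

lemma card_unity_roots [simp]: "N > 0 \<Longrightarrow> card (unity_roots N) = N"
  unfolding unity_roots_def by (rule card_roots_unity_eq)

lemma norm_unity_roots: "N > 0 \<Longrightarrow> \<omega> \<in> unity_roots N \<Longrightarrow> cmod \<omega> = 1"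
  using power_eq_1_iff by (auto simp: unity_roots_def)

text \<open>Multiplication by a primitive root \<eta> permutes the roots and multiplies the sum by
  q. Distinct exponents below N make q different from 1, so the sum vanishes.\<close>

lemma sum_unity_roots_orthogonal:
  assumes N: "N > 0" and ab: "a < N" "b < N"
  shows "(\<Sum>\<omega>\<in>unity_roots N. \<omega> ^ a * cnj \<omega> ^ b) = (if a = b then of_nat N else 0)"
proof (cases "a = b")
  case True
  have "\<omega> ^ a * cnj \<omega> ^ b = 1" if "\<omega> \<in> unity_roots N" for \<omega>
    using norm_unity_roots[OF N that] True complex_norm_square[of \<omega>]
    by (simp add: power_mult_distrib[symmetric])
  then show ?thesis using True N by simp
next
  case False
  define \<eta> where "\<eta> = cis (2 * pi / real N)"
  define q where "q = \<eta> ^ a * cnj \<eta> ^ b"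
  have eta_pow: "\<eta> ^ k = cis (2 * pi * real k / real N)" for k
    unfolding \<eta>_def Complex.DeMoivre by (simp add: mult_ac)
  have eta: "\<eta> ^ N = 1" "\<eta> \<noteq> 0" "cmod \<eta> = 1" using N eta_pow[of N] by (auto simp: \<eta>_def)
  have "q \<noteq> 1"
  proof
    assume "q = 1"
    moreover have "\<eta> ^ b * cnj \<eta> ^ b = 1"
      using eta(3) complex_norm_square[of \<eta>] by (simp add: power_mult_distrib[symmetric])
    ultimately have "\<eta> ^ a * cnj \<eta> ^ b = \<eta> ^ b * cnj \<eta> ^ b" by (simp add: q_def)
    then have "\<eta> ^ a = \<eta> ^ b" using eta by simp
    then have "cis (2 * pi * real a / real N) = cis (2 * pi * real b / real N)"
      by (simp add: eta_pow)
    then show False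
      using bij_betw_imp_inj_on[OF Complex.bij_betw_roots_unity[OF N]] ab False by (auto simp: inj_on_def)
  qed
  have bij: "bij_betw (\<lambda>\<omega>. \<eta> * \<omega>) (unity_roots N) (unity_roots N)"
    by (rule bij_betwI[where g = "\<lambda>\<omega>. \<omega> / \<eta>"])
      (use eta in \<open>auto simp: unity_roots_def power_mult_distrib power_divide\<close>)
  have "(\<Sum>\<omega>\<in>unity_roots N. \<omega> ^ a * cnj \<omega> ^ b) = (\<Sum>\<omega>\<in>unity_roots N. (\<eta> * \<omega>) ^ a * cnj (\<eta> * \<omega>) ^ b)"
    by (rule sum.reindex_bij_betw[OF bij, symmetric])
  also have "\<dots> = q * (\<Sum>\<omega>\<in>unity_roots N. \<omega> ^ a * cnj \<omega> ^ b)"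
    by (simp add: q_def sum_distrib_left power_mult_distrib mult_ac)
  finally have "(1 - q) * (\<Sum>\<omega>\<in>unity_roots N. \<omega> ^ a * cnj \<omega> ^ b) = 0" by (simp add: algebra_simps)
  with \<open>q \<noteq> 1\<close> False show ?thesis by simp
qed

section \<open>Averages over the discrete torus: Parseval and fourth moments\<close>

definition avg :: "'b set \<Rightarrow> ('b \<Rightarrow> real) \<Rightarrow> real" where
  "avg T f = (\<Sum>t\<in>T. f t) / real (card T)"

text \<open>Stands in for the torus with Haar measure: the mean square of a trigonometric polynomial
  is computed exactly once N exceeds all its exponents.\<close>

definition torus :: "nat \<Rightarrow> 'v set \<Rightarrow> ('v \<Rightarrow> complex) set" where
  "torus N I = PiE I (\<lambda>_. unity_roots N)"

lemma finite_torus [simp]: "finite I \<Longrightarrow> N > 0 \<Longrightarrow> finite (torus N I)"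
  unfolding torus_def by (rule finite_PiE) auto

lemma card_torus: "finite I \<Longrightarrow> N > 0 \<Longrightarrow> card (torus N I) = N ^ card I"
  by (simp add: torus_def card_PiE)

lemma torus_nonempty: "finite I \<Longrightarrow> N > 0 \<Longrightarrow> torus N I \<noteq> {}"
  using card_torus[of I N] by auto

text \<open>Variables and exponents are indexed abstractly because two kinds occur: the variables
  \<open>z i\<close> of a polynomial, and variables indexed by pairs (slot, value) for a multilinear
  form.\<close>

definition trig :: "'v set \<Rightarrow> 'x set \<Rightarrow> ('x \<Rightarrow> 'v \<Rightarrow> nat) \<Rightarrow> ('x \<Rightarrow> complex) \<Rightarrow> ('v \<Rightarrow> complex) \<Rightarrow> complex" where
  "trig I A e c z = (\<Sum>a\<in>A. c a * (\<Prod>i\<in>I. z i ^ e a i))"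

lemma parseval:
  assumes I: "finite I" and N: "N > 0" and A: "finite A"
    and lt: "\<And>a i. a \<in> A \<Longrightarrow> i \<in> I \<Longrightarrow> e a i < N"
    and inj: "\<And>a b. a \<in> A \<Longrightarrow> b \<in> A \<Longrightarrow> (\<And>i. i \<in> I \<Longrightarrow> e a i = e b i) \<Longrightarrow> a = b"
  shows "avg (torus N I) (\<lambda>z. cmod (trig I A e c z) ^ 2) = (\<Sum>a\<in>A. cmod (c a) ^ 2)"
proof -
  have orth: "(\<Sum>z\<in>torus N I. (\<Prod>i\<in>I. z i ^ e a i) * cnj (\<Prod>i\<in>I. z i ^ e b i))
      = (if a = b then of_nat (N ^ card I) else 0)" if ab: "a \<in> A" "b \<in> A" for a b
  proof -
    have "(\<Sum>z\<in>torus N I. (\<Prod>i\<in>I. z i ^ e a i) * cnj (\<Prod>i\<in>I. z i ^ e b i))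
       = (\<Sum>z\<in>torus N I. \<Prod>i\<in>I. z i ^ e a i * cnj (z i) ^ e b i)"
      by (simp add: prod.distrib)
    also have "\<dots> = (\<Prod>i\<in>I. \<Sum>\<omega>\<in>unity_roots N. \<omega> ^ e a i * cnj \<omega> ^ e b i)"
      unfolding torus_def by (rule prod_sum_PiE[symmetric]) (use I N in auto)
    also have "\<dots> = (\<Prod>i\<in>I. if e a i = e b i then of_nat N else 0)"
      by (intro prod.cong refl sum_unity_roots_orthogonal) (use N lt ab in auto)
    also have "\<dots> = (if a = b then of_nat (N ^ card I) else 0)"
    proof (cases "a = b")
      case False
      then obtain i where "i \<in> I" "e a i \<noteq> e b i" using inj ab by blast
      then show ?thesis using False I by (auto intro!: prod_zero)
    qed simp
    finally show ?thesis .
  qed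
  have "complex_of_real (\<Sum>z\<in>torus N I. cmod (trig I A e c z) ^ 2)
     = (\<Sum>z\<in>torus N I. trig I A e c z * cnj (trig I A e c z))"
    by (simp only: of_real_sum complex_norm_square)
  also have "\<dots> = (\<Sum>z\<in>torus N I. \<Sum>a\<in>A. \<Sum>b\<in>A. c a * cnj (c b) *
      ((\<Prod>i\<in>I. z i ^ e a i) * cnj (\<Prod>i\<in>I. z i ^ e b i)))"
    unfolding trig_def cnj_sum sum_product by (simp add: mult_ac)
  also have "\<dots> = (\<Sum>a\<in>A. \<Sum>b\<in>A. c a * cnj (c b) *
      (\<Sum>z\<in>torus N I. (\<Prod>i\<in>I. z i ^ e a i) * cnj (\<Prod>i\<in>I. z i ^ e b i)))"
    unfolding sum_distrib_left
    by (subst sum.swap, rule sum.cong[OF refl], rule sum.swap)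
  also have "\<dots> = (\<Sum>a\<in>A. \<Sum>b\<in>A. if a = b then c a * cnj (c b) * of_nat (N ^ card I) else 0)"
    by (intro sum.cong refl) (simp add: orth del: cnj_prod complex_cnj_power of_nat_power)
  also have "\<dots> = (\<Sum>a\<in>A. c a * cnj (c a) * of_nat (N ^ card I))"
    using A by simp
  also have "\<dots> = complex_of_real ((\<Sum>a\<in>A. cmod (c a) ^ 2) * real (N ^ card I))"
    unfolding of_real_mult of_real_sum complex_norm_square sum_distrib_right by simp
  finally have "(\<Sum>z\<in>torus N I. cmod (trig I A e c z) ^ 2) = (\<Sum>a\<in>A. cmod (c a) ^ 2) * real (N ^ card I)"
    by (simp only: of_real_eq_iff)
  then show ?thesis using N I by (simp add: avg_def card_torus)
qed

lemma norm_sum_squared_le: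
  fixes f :: "'x \<Rightarrow> complex"
  shows "cmod (\<Sum>x\<in>S. f x) ^ 2 \<le> real (card S) * (\<Sum>x\<in>S. cmod (f x) ^ 2)"
proof -
  have "cmod (\<Sum>x\<in>S. f x) ^ 2 \<le> (\<Sum>x\<in>S. 1 * cmod (f x)) ^ 2"
    by (intro power_mono) (auto simp: norm_sum)
  also have "\<dots> \<le> (\<Sum>x\<in>S. 1\<^sup>2) * (\<Sum>x\<in>S. cmod (f x) ^ 2)"
    by (rule Cauchy_Schwarz_ineq_sum)
  finally show ?thesis by simp
qed

text \<open>Parseval for the square of f. A coefficient of f^2 collects the pairs (a, b) with e a +
  e b = \<gamma>; there are at most \<Prod> (\<gamma> i + 1) \<le> 2^(2d) of them, and
  Cauchy-Schwarz turns this count into the constant. The order N > 2 d leaves room for the exponents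
  of f^2.\<close>

lemma fourth_moment:
  assumes I: "finite I" and A: "finite A" and N: "N > 2 * d"
    and deg: "\<And>a. a \<in> A \<Longrightarrow> (\<Sum>i\<in>I. e a i) \<le> d"
    and inj: "\<And>a b. a \<in> A \<Longrightarrow> b \<in> A \<Longrightarrow> (\<And>i. i \<in> I \<Longrightarrow> e a i = e b i) \<Longrightarrow> a = b"
  shows "avg (torus N I) (\<lambda>z. cmod (trig I A e c z) ^ 4) \<le> 4 ^ d * (\<Sum>a\<in>A. cmod (c a) ^ 2) ^ 2"
proof -
  have N0: "N > 0" using N by simp
  define h where "h = (\<lambda>(a, b). restrict (\<lambda>i. e a i + e b i) I)"
  define G where "G = h ` (A \<times> A)"
  define F where "F \<gamma> = {x\<in>A \<times> A. h x = \<gamma>}" for \<gamma>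
  define g where "g = (\<lambda>(a, b). c a * c b)"
  have le: "e a i \<le> d" if "a \<in> A" "i \<in> I" for a i
    using deg[OF that(1)] member_le_sum[of i I "e a"] that I by fastforce
  have sq: "trig I A e c z ^ 2 = trig I G (\<lambda>\<gamma>. \<gamma>) (\<lambda>\<gamma>. \<Sum>x\<in>F \<gamma>. g x) z" for z
  proof -
    have "trig I A e c z ^ 2 = (\<Sum>x\<in>A \<times> A. g x * (\<Prod>i\<in>I. z i ^ h x i))"
      unfolding power2_eq_square trig_def sum_product sum.cartesian_product
      by (intro sum.cong refl) (auto simp: g_def h_def power_add prod.distrib mult_ac)
    also have "\<dots> = (\<Sum>\<gamma>\<in>G. \<Sum>x\<in>F \<gamma>. g x * (\<Prod>i\<in>I. z i ^ h x i))"
      unfolding G_def F_def by (rule sum.image_gen) (use A in auto)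
    also have "\<dots> = (\<Sum>\<gamma>\<in>G. \<Sum>x\<in>F \<gamma>. g x * (\<Prod>i\<in>I. z i ^ \<gamma> i))"
      by (intro sum.cong refl) (auto simp: F_def)
    finally show ?thesis by (simp add: trig_def sum_distrib_right)
  qed
  have cardF: "card (F \<gamma>) \<le> 4 ^ d" if G: "\<gamma> \<in> G" for \<gamma>
  proof -
    have sub: "(\<lambda>x. restrict (e (fst x)) I) ` F \<gamma> \<subseteq> PiE I (\<lambda>i. {..\<gamma> i})"
      by (auto simp: F_def h_def)
    \<comment> \<open>Within a fibre the first exponent vector determines the second by subtraction
      from \<gamma>, and injectivity of \<open>e\<close> recovers the pair.\<close>
    have "inj_on (\<lambda>x. restrict (e (fst x)) I) (F \<gamma>)"
    proof (rule inj_onI)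
      fix x y assume x: "x \<in> F \<gamma>" and y: "y \<in> F \<gamma>"
        and eq: "restrict (e (fst x)) I = restrict (e (fst y)) I"
      obtain a b where ab: "x = (a, b)" by (cases x)
      obtain a' b' where ab': "y = (a', b')" by (cases y)
      have mem: "a \<in> A" "b \<in> A" "a' \<in> A" "b' \<in> A" using x y by (auto simp: F_def ab ab')
      have 1: "e a i = e a' i" if "i \<in> I" for i
        using fun_cong[OF eq, of i] that by (simp add: ab ab')
      have eq2: "restrict (\<lambda>i. e a i + e b i) I = restrict (\<lambda>i. e a' i + e b' i) I"
        using x y by (simp add: F_def h_def ab ab')
      have 2: "e b i = e b' i" if "i \<in> I" for i
        using fun_cong[OF eq2, of i] 1[OF that] that by simp
      show "x = y" using inj[OF mem(1,3)] inj[OF mem(2,4)] 1 2 by (simp add: ab ab')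
    qed
    then have "card (F \<gamma>) \<le> card (PiE I (\<lambda>i. {..\<gamma> i}))"
      by (rule card_inj_on_le[OF _ sub]) (use I in \<open>auto intro: finite_PiE\<close>)
    also have "\<dots> = (\<Prod>i\<in>I. \<gamma> i + 1)" using I by (simp add: card_PiE)
    also have "\<dots> \<le> (\<Prod>i\<in>I. 2 ^ \<gamma> i)"
      by (intro prod_mono) (auto simp: Suc_leI)
    also have "\<dots> = 2 ^ (\<Sum>i\<in>I. \<gamma> i)" by (simp add: power_sum)
    also have "\<dots> \<le> 2 ^ (2 * d)"
    proof (rule power_increasing)
      obtain a b where ab: "a \<in> A" "b \<in> A" "\<gamma> = h (a, b)" using G by (auto simp: G_def)
      then have "(\<Sum>i\<in>I. \<gamma> i) = (\<Sum>i\<in>I. e a i) + (\<Sum>i\<in>I. e b i)"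
        by (simp add: h_def sum.distrib)
      then show "(\<Sum>i\<in>I. \<gamma> i) \<le> 2 * d" using deg[OF ab(1)] deg[OF ab(2)] by simp
    qed simp
    finally show ?thesis by (simp add: power_mult)
  qed
  have "avg (torus N I) (\<lambda>z. cmod (trig I A e c z) ^ 4) = avg (torus N I) (\<lambda>z. cmod (trig I A e c z ^ 2) ^ 2)"
    by (simp add: avg_def norm_power flip: power_mult)
  also have "\<dots> = (\<Sum>\<gamma>\<in>G. cmod (\<Sum>x\<in>F \<gamma>. g x) ^ 2)"
    unfolding sq
  proof (rule parseval[OF I N0])
    show "finite G" using A by (simp add: G_def)
    show "\<gamma> i < N" if G: "\<gamma> \<in> G" "i \<in> I" for \<gamma> i
    proof -
      obtain a b where ab: "a \<in> A" "b \<in> A" "\<gamma> = h (a, b)" using G by (auto simp: G_def)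
      then show ?thesis using le[of a i] le[of b i] G N by (simp add: h_def)
    qed
    show "\<gamma> = \<gamma>'" if "\<gamma> \<in> G" "\<gamma>' \<in> G" "\<And>i. i \<in> I \<Longrightarrow> \<gamma> i = \<gamma>' i" for \<gamma> \<gamma>'
      by (rule extensionalityI[of _ I]) (use that in \<open>auto simp: G_def h_def\<close>)
  qed
  also have "\<dots> \<le> (\<Sum>\<gamma>\<in>G. 4 ^ d * (\<Sum>x\<in>F \<gamma>. cmod (g x) ^ 2))"
  proof (rule sum_mono)
    fix \<gamma> assume "\<gamma> \<in> G"
    from cardF[OF this] have "real (card (F \<gamma>)) \<le> 4 ^ d"
      by (metis of_nat_le_iff of_nat_numeral of_nat_power)
    then show "cmod (\<Sum>x\<in>F \<gamma>. g x) ^ 2 \<le> 4 ^ d * (\<Sum>x\<in>F \<gamma>. cmod (g x) ^ 2)"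
      using norm_sum_squared_le[of g "F \<gamma>"] mult_right_mono[of "real (card (F \<gamma>))" "4 ^ d" "\<Sum>x\<in>F \<gamma>. cmod (g x) ^ 2"]
      by (simp add: sum_nonneg)
  qed
  also have "\<dots> = 4 ^ d * (\<Sum>x\<in>A \<times> A. cmod (g x) ^ 2)"
    unfolding G_def F_def sum_distrib_left by (rule sum.image_gen[symmetric]) (use A in auto)
  also have "(\<Sum>x\<in>A \<times> A. cmod (g x) ^ 2) = (\<Sum>a\<in>A. cmod (c a) ^ 2) ^ 2"
    unfolding power2_eq_square[of "sum _ A"] sum_product sum.cartesian_product
    by (intro sum.cong) (auto simp: g_def norm_mult power_mult_distrib)
  finally show ?thesis .
qed

section \<open>Comparison of second and p-th moments\<close>

lemma avg_mono: "(\<And>t. t \<in> T \<Longrightarrow> f t \<le> g t) \<Longrightarrow> avg T f \<le> avg T g"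
  unfolding avg_def by (intro divide_right_mono sum_mono) auto

lemma avg_add: "avg T (\<lambda>t. f t + g t) = avg T f + avg T g"
  by (simp add: avg_def sum.distrib add_divide_distrib)

lemma avg_cmult: "avg T (\<lambda>t. c * f t) = c * avg T f"
  by (simp add: avg_def sum_distrib_left)

lemma avg_sum: "avg T (\<lambda>t. \<Sum>j\<in>J. f j t) = (\<Sum>j\<in>J. avg T (f j))"
  by (simp add: avg_def sum_divide_distrib[symmetric] sum.swap[of _ T J])

lemma avg_nonneg: "(\<And>t. t \<in> T \<Longrightarrow> f t \<ge> 0) \<Longrightarrow> avg T f \<ge> 0"
  by (simp add: avg_def sum_nonneg)

lemma avg_le_const:
  assumes "finite T" "T \<noteq> {}" "\<And>t. t \<in> T \<Longrightarrow> f t \<le> b"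
  shows "avg T f \<le> b"
proof -
  have "(\<Sum>t\<in>T. f t) \<le> real (card T) * b" using assms(3) by (intro sum_bounded_above) auto
  moreover have "card T > 0" using assms by (simp add: card_gt_0_iff)
  ultimately show ?thesis by (simp add: avg_def divide_simps mult.commute)
qed

text \<open>Interpolation between the p-th and the fourth power at a level l: below l the factor
  F^(2-p) is at most l^(2-p), above l the factor F^2 / l^2 is at least 1. The level stays free so
  that it can be adapted to the moments.\<close>

lemma sq_le_powr_plus_fourth:
  assumes "F \<ge> 0" "l > 0" "1 \<le> p" "p \<le> (2::real)"
  shows "F ^ 2 \<le> l powr (2 - p) * F powr p + (1 / l ^ 2) * F ^ 4"
proof (cases "F \<le> l")
  case True
  have "F ^ 2 \<le> l powr (2 - p) * F powr p"
  proof (cases "F = 0")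
    case False
    then have F: "F > 0" using assms by simp
    then have "F ^ 2 = F powr (2 - p) * F powr p"
      by (simp add: powr_add[symmetric] powr_numeral)
    also have "\<dots> \<le> l powr (2 - p) * F powr p"
      by (intro mult_right_mono powr_mono2) (use True assms in auto)
    finally show ?thesis .
  qed simp
  moreover have "(1 / l ^ 2) * F ^ 4 \<ge> 0" by simp
  ultimately show ?thesis by linarith
next
  case False
  then have "l ^ 2 \<le> F ^ 2" using assms by (intro power_mono) auto
  then have "F ^ 2 * l ^ 2 \<le> F ^ 2 * F ^ 2" by (intro mult_left_mono) auto
  then have "F ^ 2 \<le> (1 / l ^ 2) * F ^ 4"
    using assms by (simp add: field_simps flip: power_add)
  moreover have "l powr (2 - p) * F powr p \<ge> 0" by simp
  ultimately show ?thesis by linarith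
qed

text \<open>For \<open>Q = 4\<^sup>d\<close> the constant grows like \<open>(4\<^bsup>1 - p/2\<^esup>)\<^sup>d\<close>, a rate that tends to 1 as \<open>p\<close> tends to 2.
  This replaces the sharp hypercontractive inequality.\<close>
lemma second_moment_le_p_moment:
  assumes T: "finite T" "T \<noteq> {}" and F: "\<And>t. t \<in> T \<Longrightarrow> F t \<ge> 0" and p: "1 \<le> p" "p \<le> 2"
    and Q: "Q \<ge> 1" and m4: "avg T (\<lambda>t. F t ^ 4) \<le> Q * avg T (\<lambda>t. F t ^ 2) ^ 2"
  shows "avg T (\<lambda>t. F t ^ 2) powr (p / 2) \<le> 4 * Q powr (1 - p / 2) * avg T (\<lambda>t. F t powr p)"
proof -
  define V where "V = avg T (\<lambda>t. F t ^ 2)"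
  define M where "M = avg T (\<lambda>t. F t powr p)"
  have M0: "M \<ge> 0" unfolding M_def by (rule avg_nonneg) simp
  have V0: "V \<ge> 0" unfolding V_def by (rule avg_nonneg) simp
  show ?thesis
  proof (cases "V = 0")
    case True
    then show ?thesis using M0 by (simp add: V_def M_def)
  next
    case False
    then have V: "V > 0" using V0 by simp
    \<comment> \<open>With l^2 = 2 Q V the bound on the fourth-moment term is V / 2, which the
      left-hand side absorbs.\<close>
    define l where "l = sqrt (2 * Q * V)"
    have l: "l > 0" "l ^ 2 = 2 * Q * V" using V Q by (auto simp: l_def)
    have "V \<le> avg T (\<lambda>t. l powr (2 - p) * F t powr p + (1 / l ^ 2) * F t ^ 4)"
      unfolding V_def by (intro avg_mono sq_le_powr_plus_fourth F l(1) p)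
    also have "\<dots> = l powr (2 - p) * M + (1 / l ^ 2) * avg T (\<lambda>t. F t ^ 4)"
      by (simp only: avg_add avg_cmult M_def)
    also have "\<dots> \<le> l powr (2 - p) * M + (1 / l ^ 2) * (Q * V ^ 2)"
      using m4 by (intro add_left_mono mult_left_mono) (auto simp: V_def)
    also have "(1 / l ^ 2) * (Q * V ^ 2) = V / 2"
      using V Q unfolding l(2) by (simp add: power2_eq_square)
    finally have 1: "V \<le> 2 * l powr (2 - p) * M" by simp
    have "l powr (2 - p) = (2 * Q * V) powr (1 - p / 2)"
    proof -
      have "l = (2 * Q * V) powr (1 / 2)" using V Q by (simp add: l_def powr_half_sqrt)
      then have "l powr (2 - p) = (2 * Q * V) powr (1 / 2 * (2 - p))" by (simp only: powr_powr)
      moreover have "1 / 2 * (2 - p) = 1 - p / 2" by simp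
      ultimately show ?thesis by (simp only:)
    qed
    also have "\<dots> = (2 * Q) powr (1 - p / 2) * V powr (1 - p / 2)"
      using V Q by (simp add: powr_mult)
    finally have "V powr (p / 2) * V powr (1 - p / 2) \<le> 2 * (2 * Q) powr (1 - p / 2) * M * V powr (1 - p / 2)"
      using 1 V by (simp add: powr_add[symmetric] mult_ac)
    then have "V powr (p / 2) \<le> 2 * (2 * Q) powr (1 - p / 2) * M"
      using V by (simp add: mult_le_cancel_right)
    also have "(2 * Q) powr (1 - p / 2) = 2 powr (1 - p / 2) * Q powr (1 - p / 2)"
      using Q by (simp add: powr_mult)
    also have "2 * (2 powr (1 - p / 2) * Q powr (1 - p / 2)) * M \<le> 2 * (2 * Q powr (1 - p / 2)) * M"
    proof -
      have "(2::real) powr (1 - p / 2) \<le> 2 powr 1" using p by (intro powr_mono) auto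
      then show ?thesis using M0 by (intro mult_right_mono mult_left_mono) auto
    qed
    finally show ?thesis by (simp add: V_def M_def)
  qed
qed

section \<open>The Bohnenblust--Hille inequality and coefficient sums\<close>

lemma sum_tuples_prod: "(\<Sum>js\<in>tuples n k. \<Prod>s<k. A s (js ! s)) = (\<Prod>s<k. \<Sum>j<n. A s j :: real)"
proof (induction k arbitrary: A)
  case 0
  then show ?case by (simp add: tuples_0)
next
  case (Suc k)
  have "(\<Sum>js\<in>tuples n (Suc k). \<Prod>s<Suc k. A s (js ! s)) = (\<Sum>j<n. \<Sum>js\<in>tuples n k. A 0 j * (\<Prod>s<k. A (Suc s) (js ! s)))"
    unfolding sum_tuples_Suc by (simp add: prod.lessThan_Suc_shift del: prod.lessThan_Suc)
  also have "\<dots> = (\<Sum>j<n. A 0 j) * (\<Prod>s<k. \<Sum>j<n. A (Suc s) j)"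
    unfolding sum_distrib_left[symmetric] Suc.IH[of "\<lambda>s. A (Suc s)"] by (simp add: sum_distrib_right)
  finally show ?case by (simp add: prod.lessThan_Suc_shift del: prod.lessThan_Suc)
qed

lemma sum_tuples_slices:
  assumes "s < k"
  shows "(\<Sum>js\<in>tuples n k. f js) = (\<Sum>j<n. \<Sum>js\<in>{js\<in>tuples n k. js ! s = j}. f js)"
proof -
  have "(\<lambda>js. js ! s) ` tuples n k \<subseteq> {..<n}"
    using assms by (auto simp: tuples_def) (metis lessThan_iff nth_mem subsetD)
  from sum.group[OF finite_tuples finite_lessThan this, of f] show ?thesis by simp
qed

text \<open>The l2 norm of the coefficients with slot s frozen at j. Summed over j it is the mixed
  (l1, l2) norm of Bohnenblust and Hille.\<close>

definition slice_norm :: "nat \<Rightarrow> nat \<Rightarrow> (nat list \<Rightarrow> complex) \<Rightarrow> nat \<Rightarrow> nat \<Rightarrow> real" where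
  "slice_norm n k a s j = sqrt (\<Sum>js\<in>{js\<in>tuples n k. js ! s = j}. cmod (a js) ^ 2)"

text \<open>With slot s frozen at j the form becomes a trigonometric polynomial f_j in unimodular
  variables for the other slots. Its l2 coefficient norm is at most 4 * 2^k times its mean modulus,
  by the moment comparison with exponent 1 and Q = 4^k. The sum over j of the moduli of f_j(z) is a
  value of the form itself, with conjugate phases in slot s.\<close>

lemma sum_slice_norm_le:
  assumes s: "s < k"
    and B: "\<And>w. (\<And>t l. cmod (w t l) \<le> 1) \<Longrightarrow> cmod (\<Sum>js\<in>tuples n k. (\<Prod>t<k. w t (js ! t)) * a js) \<le> 1"
  shows "(\<Sum>j<n. slice_norm n k a s j) \<le> 4 * 2 ^ k"
proof -
  define I where "I = {..<k} \<times> {..<n}"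
  define S where "S j = {js\<in>tuples n k. js ! s = j}" for j
  define e where "e js = (\<lambda>(t, l). if t \<noteq> s \<and> js ! t = l then 1 else 0 :: nat)" for js :: "nat list"
  define T where "T = torus (2 * k + 1) I"
  define f where "f j z = trig I (S j) e a z" for j z
  have I: "finite I" by (simp add: I_def)
  have S: "finite (S j)" for j by (simp add: S_def)
  have T: "finite T" "T \<noteq> {}" using I torus_nonempty[of I "2 * k + 1"] by (auto simp: T_def)
  have lt: "js ! t < n" if "js \<in> tuples n k" "t < k" for js t
    using that by (auto simp: tuples_def) (metis lessThan_iff nth_mem subsetD)
  have prod_e: "(\<Prod>i\<in>I. z i ^ e js i) = (\<Prod>t\<in>{..<k} - {s}. z (t, js ! t))"
    if "js \<in> tuples n k" for z :: "nat \<times> nat \<Rightarrow> complex" and js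
  proof -
    have "(\<Prod>i\<in>I. z i ^ e js i) = (\<Prod>t<k. \<Prod>l<n. z (t, l) ^ e js (t, l))"
      unfolding I_def by (simp add: prod.cartesian_product)
    also have "\<dots> = (\<Prod>t<k. if t = s then 1 else z (t, js ! t))"
    proof (intro prod.cong refl)
      fix t assume "t \<in> {..<k}"
      then have "js ! t < n" using lt that by simp
      have "(\<Prod>l<n. z (t, l) ^ e js (t, l)) = (\<Prod>l<n. if js ! t = l then (if t = s then 1 else z (t, l)) else 1)"
        by (intro prod.cong) (auto simp: e_def)
      also have "\<dots> = (if t = s then 1 else z (t, js ! t))"
        using \<open>js ! t < n\<close> by simp
      finally show "(\<Prod>l<n. z (t, l) ^ e js (t, l)) = (if t = s then 1 else z (t, js ! t))" .
    qed
    also have "\<dots> = (\<Prod>t\<in>{..<k} - {s}. z (t, js ! t))"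
      by (intro prod.mono_neutral_cong_right) auto
    finally show ?thesis .
  qed
  have deg: "(\<Sum>i\<in>I. e js i) \<le> k" if "js \<in> S j" for js j
  proof -
    have "(\<Sum>i\<in>I. e js i) = (\<Sum>t<k. \<Sum>l<n. e js (t, l))"
      unfolding I_def by (simp add: sum.cartesian_product)
    also have "\<dots> \<le> (\<Sum>t<k. \<Sum>l<n. if js ! t = l then 1 else 0)"
      by (intro sum_mono) (auto simp: e_def)
    also have "\<dots> \<le> (\<Sum>t<k. 1)"
      by (intro sum_mono) simp
    finally show ?thesis by simp
  qed
  have inj: "js = js'" if "js \<in> S j" "js' \<in> S j" "\<And>i. i \<in> I \<Longrightarrow> e js i = e js' i" for js js' j
  proof (rule nth_equalityI)
    show "length js = length js'" using that by (simp add: S_def tuples_def)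
    fix t assume "t < length js"
    then have t: "t < k" using that by (simp add: S_def tuples_def)
    show "js ! t = js' ! t"
    proof (cases "t = s")
      case True
      then show ?thesis using that by (simp add: S_def)
    next
      case False
      have "(t, js ! t) \<in> I" using t lt that by (simp add: I_def S_def)
      from that(3)[OF this] show ?thesis using False by (auto simp: e_def split: if_splits)
    qed
  qed
  have slice: "slice_norm n k a s j \<le> 4 * 2 ^ k * avg T (\<lambda>z. cmod (f j z))" for j
  proof -
    define V where "V = (\<Sum>js\<in>S j. cmod (a js) ^ 2)"
    have e_le: "e js i < 2 * k + 1" for js i using s by (auto simp: e_def split: prod.splits)
    have pars: "avg T (\<lambda>z. cmod (f j z) ^ 2) = V"
      unfolding T_def f_def V_def by (rule parseval) (use I S e_le inj in auto)
    have "avg T (\<lambda>z. cmod (f j z) ^ 4) \<le> 4 ^ k * V ^ 2"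
      unfolding T_def f_def V_def by (rule fourth_moment) (use I S deg inj in auto)
    then have "avg T (\<lambda>z. cmod (f j z) ^ 2) powr (1 / 2)
        \<le> 4 * (4 ^ k) powr (1 - 1 / 2) * avg T (\<lambda>z. cmod (f j z) powr 1)"
      by (intro second_moment_le_p_moment) (use T pars in auto)
    moreover have "(4 ^ k :: real) powr (1 - 1 / 2) = 2 ^ k"
    proof -
      have "(4 ^ k :: real) = (2 ^ k) ^ 2" by (simp add: power2_eq_square flip: power_mult_distrib)
      then show ?thesis by (simp add: powr_half_sqrt)
    qed
    moreover have "V \<ge> 0" by (simp add: V_def sum_nonneg)
    ultimately show ?thesis
      by (simp add: pars powr_half_sqrt slice_norm_def V_def S_def)
  qed
  have bound: "(\<Sum>j<n. cmod (f j z)) \<le> 1" if z: "z \<in> T" for z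
  proof -
    \<comment> \<open>Slot s receives the phases that turn each f_l(z) into its modulus. The value 0
      off the range of \<open>I\<close> keeps the bound 1, because \<open>z\<close> is
      \<open>undefined\<close> there.\<close>
    define w where "w t l = (if t = s then cnj (sgn (f l z)) else if t < k \<and> l < n then z (t, l) else 0)" for t l
    have w1: "cmod (w t l) \<le> 1" for t l
    proof -
      have "cmod (z (t, l)) = 1" if "t < k" "l < n"
        using z that norm_unity_roots[of "2*k+1" "z (t, l)"] by (auto simp: T_def torus_def I_def PiE_def Pi_def)
      then show ?thesis by (auto simp: w_def norm_sgn)
    qed
    have "(\<Sum>js\<in>tuples n k. (\<Prod>t<k. w t (js ! t)) * a js)
       = (\<Sum>j<n. \<Sum>js\<in>S j. (\<Prod>t<k. w t (js ! t)) * a js)"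
      unfolding S_def by (rule sum_tuples_slices[OF s])
    also have "\<dots> = (\<Sum>j<n. cnj (sgn (f j z)) * f j z)"
    proof (intro sum.cong refl)
      fix j
      have "(\<Prod>t<k. w t (js ! t)) * a js = cnj (sgn (f j z)) * (a js * (\<Prod>i\<in>I. z i ^ e js i))"
        if js: "js \<in> S j" for js
      proof -
        have js': "js \<in> tuples n k" "js ! s = j" using js by (auto simp: S_def)
        have "(\<Prod>t<k. w t (js ! t)) = w s j * (\<Prod>t\<in>{..<k} - {s}. w t (js ! t))"
          using s js' by (simp add: prod.remove[of "{..<k}" s])
        also have "(\<Prod>t\<in>{..<k} - {s}. w t (js ! t)) = (\<Prod>t\<in>{..<k} - {s}. z (t, js ! t))"
          using lt[OF js'(1)] by (intro prod.cong) (auto simp: w_def)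
        finally show ?thesis using prod_e[OF js'(1), of z] by (simp add: w_def)
      qed
      then have "(\<Sum>js\<in>S j. (\<Prod>t<k. w t (js ! t)) * a js)
          = cnj (sgn (f j z)) * (\<Sum>js\<in>S j. a js * (\<Prod>i\<in>I. z i ^ e js i))"
        unfolding sum_distrib_left by (intro sum.cong refl)
      then show "(\<Sum>js\<in>S j. (\<Prod>t<k. w t (js ! t)) * a js) = cnj (sgn (f j z)) * f j z"
        by (simp only: f_def trig_def)
    qed
    also have "\<dots> = of_real (\<Sum>j<n. cmod (f j z))"
    proof -
      have "cnj (sgn u) * u = of_real (cmod u)" for u :: complex
      proof (cases "u = 0")
        case False
        have "cnj (sgn u) * u = (u * cnj u) / of_real (cmod u)"
          by (simp add: sgn_eq mult.commute)
        also have "\<dots> = of_real (cmod u)"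
          using False complex_norm_square[of u] by (simp add: power2_eq_square divide_simps)
        finally show ?thesis .
      qed simp
      then show ?thesis by simp
    qed
    finally have "cmod (of_real (\<Sum>j<n. cmod (f j z))) \<le> 1" using B[of w] w1 by simp
    then show ?thesis unfolding norm_of_real by simp
  qed
  have "(\<Sum>j<n. slice_norm n k a s j) \<le> (\<Sum>j<n. 4 * 2 ^ k * avg T (\<lambda>z. cmod (f j z)))"
    by (intro sum_mono slice)
  also have "\<dots> = 4 * 2 ^ k * avg T (\<lambda>z. \<Sum>j<n. cmod (f j z))"
    by (simp add: avg_sum sum_distrib_left)
  also have "\<dots> \<le> 4 * 2 ^ k * 1"
    by (intro mult_left_mono avg_le_const) (use T bound in auto)
  finally show ?thesis by simp
qed

text \<open>The interpolation step is a single
  application of the AM-GM inequality to the \<open>k + 1\<close> numbers \<open>\<bar>a\<bar>\<^sup>2 / A\<^sub>s\<close> and \<open>\<Prod> A\<^sub>s\<close>.\<close>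
lemma multilinear_Bohnenblust_Hille:
  assumes k: "k \<ge> 1"
    and B: "\<And>w. (\<And>t l. cmod (w t l) \<le> 1) \<Longrightarrow> cmod (\<Sum>js\<in>tuples n k. (\<Prod>t<k. w t (js ! t)) * a js) \<le> 1"
  shows "(\<Sum>js\<in>tuples n k. cmod (a js) powr (2 * k / (k + 1))) \<le> (4 * 2 ^ k) ^ k"
proof -
  define A where "A = slice_norm n k a"
  define C where "C = (4 * 2 ^ k :: real)"
  have C1: "C \<ge> 1" using one_le_power[of "2::real" k] unfolding C_def by linarith
  have A0: "A s j \<ge> 0" for s j by (simp add: A_def slice_norm_def sum_nonneg)
  have AC: "(\<Sum>j<n. A s j) \<le> C" if "s < k" for s
    unfolding A_def C_def by (rule sum_slice_norm_le[OF that B])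
  have A_sq: "A s j ^ 2 = (\<Sum>js\<in>{js\<in>tuples n k. js ! s = j}. cmod (a js) ^ 2)" for s j
    by (simp add: A_def slice_norm_def sum_nonneg)
  have pw: "cmod (a js) powr (2 * k / (k + 1))
      \<le> ((\<Sum>s<k. cmod (a js) ^ 2 / A s (js ! s)) + (\<Prod>s<k. A s (js ! s))) / (k + 1)"
    if js: "js \<in> tuples n k" for js
  proof (cases "a js = 0")
    case True
    then show ?thesis using A0 by (auto intro!: divide_nonneg_nonneg prod_nonneg)
  next
    case False
    \<comment> \<open>A slice containing a nonzero coefficient has positive norm, so the quotients
      below are genuine and cancel against the product.\<close>
    have Apos: "A s (js ! s) > 0" for s
    proof -
      have "cmod (a js) ^ 2 \<le> A s (js ! s) ^ 2"
        unfolding A_sq by (rule member_le_sum) (use js in auto)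
      moreover have "cmod (a js) ^ 2 > 0" using False by simp
      ultimately show ?thesis using A0[of s "js ! s"] by (metis less_le_trans not_less power_zero_numeral zero_less_power2 order.not_eq_order_implies_strict)
    qed
    define x where "x s = (if s < k then cmod (a js) ^ 2 / A s (js ! s) else (\<Prod>s<k. A s (js ! s)))" for s
    have x0: "x s \<ge> 0" for s using A0 by (auto simp: x_def intro: prod_nonneg)
    have set: "{..k} = insert k {..<k}" by auto
    \<comment> \<open>The slice norms cancel, leaving the modulus of the coefficient to the power
      2k; its (k+1)-st root has the exponent 2k/(k+1).\<close>
    have "(\<Prod>s\<le>k. x s) = (\<Prod>s<k. A s (js ! s)) * (\<Prod>s<k. cmod (a js) ^ 2 / A s (js ! s))"
      unfolding set by (simp add: x_def)
    also have "\<dots> = (\<Prod>s<k. cmod (a js) ^ 2)"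
      unfolding prod.distrib[symmetric] by (intro prod.cong refl) (use Apos in \<open>auto simp: less_imp_neq[symmetric]\<close>)
    also have "\<dots> = cmod (a js) ^ (2 * k)" by (simp add: power_mult)
    finally have "(\<Prod>s\<le>k. x s) powr (1 / card {..k}) = (cmod (a js) powr (2 * k)) powr (1 / (k + 1))"
      using False powr_realpow[of "cmod (a js)" "2 * k"] by simp
    also have "\<dots> = cmod (a js) powr (2 * k / (k + 1))" by (simp add: powr_powr)
    finally have "cmod (a js) powr (2 * k / (k + 1)) \<le> (\<Sum>s\<le>k. x s / card {..k})"
      using arith_geom_mean[of "{..k}" x] x0 by simp
    also have "\<dots> = (\<Sum>s\<le>k. x s) / (k + 1)" by (simp add: sum_divide_distrib)
    also have "(\<Sum>s\<le>k. x s) = (\<Sum>s<k. cmod (a js) ^ 2 / A s (js ! s)) + (\<Prod>s<k. A s (js ! s))"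
      unfolding set by (simp add: x_def)
    finally show ?thesis .
  qed
  \<comment> \<open>The squared moduli over one slice add up to \<open>A s j ^ 2\<close>, so
    division by \<open>A s j\<close> leaves \<open>A s j\<close> itself.\<close>
  have s1: "(\<Sum>js\<in>tuples n k. cmod (a js) ^ 2 / A s (js ! s)) \<le> C" if s: "s < k" for s
  proof -
    have "(\<Sum>js\<in>tuples n k. cmod (a js) ^ 2 / A s (js ! s))
       = (\<Sum>j<n. \<Sum>js\<in>{js\<in>tuples n k. js ! s = j}. cmod (a js) ^ 2 / A s (js ! s))"
      by (rule sum_tuples_slices[OF s])
    also have "\<dots> = (\<Sum>j<n. (\<Sum>js\<in>{js\<in>tuples n k. js ! s = j}. cmod (a js) ^ 2) / A s j)"
      unfolding sum_divide_distrib by (intro sum.cong refl) auto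
    also have "\<dots> = (\<Sum>j<n. A s j)"
      unfolding A_sq[symmetric] by (intro sum.cong refl) (simp add: power2_eq_square)
    finally show ?thesis using AC[OF s] by simp
  qed
  have "(\<Sum>js\<in>tuples n k. cmod (a js) powr (2 * k / (k + 1)))
     \<le> (\<Sum>js\<in>tuples n k. ((\<Sum>s<k. cmod (a js) ^ 2 / A s (js ! s)) + (\<Prod>s<k. A s (js ! s))) / (k + 1))"
    by (intro sum_mono pw)
  also have "\<dots> = ((\<Sum>s<k. \<Sum>js\<in>tuples n k. cmod (a js) ^ 2 / A s (js ! s)) + (\<Prod>s<k. \<Sum>j<n. A s j)) / (k + 1)"
    by (simp add: sum_divide_distrib[symmetric] sum.distrib sum_tuples_prod sum.swap[of _ "tuples n k" "{..<k}"])
  also have "\<dots> \<le> ((\<Sum>s<k. C) + (\<Prod>s<k. C)) / (k + 1)"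
    by (intro divide_right_mono add_mono sum_mono prod_mono conjI) (use s1 AC A0 in \<open>auto intro: sum_nonneg\<close>)
  also have "\<dots> = (k * C + C ^ k) / (k + 1)" by simp
  also have "\<dots> \<le> (k * C ^ k + C ^ k) / (k + 1)"
    using C1 k power_increasing[of 1 k C] by (intro divide_right_mono add_right_mono mult_left_mono) auto
  also have "\<dots> = C ^ k" by (simp add: field_simps)
  finally show ?thesis by (simp add: C_def add.commute)
qed

section \<open>From Bohnenblust-Hille to coefficient sums\<close>

lemma le_add_powr:
  assumes "u \<ge> 0" "l > 0" "p \<ge> (1::real)"
  shows "u \<le> l + l powr (1 - p) * u powr p"
proof (cases "u \<le> l")
  case True
  moreover have "l powr (1 - p) * u powr p \<ge> 0" by simp
  ultimately show ?thesis by linarith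
next
  case False
  then have u: "u > 0" using assms by linarith
  have "u = l powr (1 - p) * l powr (p - 1) * u"
    using assms by (simp add: powr_add[symmetric])
  also have "\<dots> \<le> l powr (1 - p) * u powr (p - 1) * u"
    by (intro mult_right_mono mult_left_mono powr_mono2) (use False assms in auto)
  also have "\<dots> = l powr (1 - p) * u powr p"
    using u by (simp add: powr_diff)
  finally show ?thesis using assms by linarith
qed

lemma trig_hom_idx: "trig {..<n} (hom_idx n d) (\<lambda>\<alpha>. \<alpha>) c z = hom_poly n d c z"
  by (simp add: trig_def hom_poly_def monom_def)

text \<open>Compared with Cauchy-Schwarz over all monomials this gains n^(-1/2): the n^k tuples
  contribute n^((k-1)/2) instead of n^(k/2), because the p-th powers of the norms
  \<open>v js\<close> have a sum bounded independently of n. Only the remaining degree d pays the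
  square root of a number of monomials. The cost 4^(d/(k+1)) of the moment comparison has a rate
  close to 1 for large k.\<close>

lemma coeff_sum_bound:
  assumes k: "k \<ge> 1" and n: "n \<ge> 1"
    and B: "\<And>z. z \<in> cpolydisk n \<Longrightarrow> cmod (hom_poly n (k + d) c z) \<le> 1"
  shows "(\<Sum>\<alpha>\<in>hom_idx n (k + d). cmod (c \<alpha>))
    \<le> (exp 1 * real (k + d)) ^ k * sqrt (card (hom_idx n d)) * sqrt n ^ (k - 1)
        * (1 + 4 * 4 powr (d / (k + 1)) * (4 * 2 ^ k) ^ k)"
proof -
  define M where "M = (exp 1 * real (k + d)) ^ k"
  have M: "M > 0" using k by (simp add: M_def)
  define g where "g js \<beta> = partials_coeffs js c \<beta> / of_real M" for js \<beta>
  define v where "v js = sqrt (\<Sum>\<beta>\<in>hom_idx n d. cmod (g js \<beta>) ^ 2)" for js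
  define p where "p = 2 * real k / (real k + 1)"
  define T where "T = torus (2 * d + 1) {..<n}"
  have hg: "hom_poly n d (g js) z = hom_poly n d (partials_coeffs js c) z / of_real M" for js z
    by (simp add: hom_poly_def g_def sum_divide_distrib)
  have p: "1 \<le> p" "p \<le> 2" "1 - p / 2 = 1 / (k + 1)" "1 - p = - ((k - 1) / (k + 1))"
    using k by (auto simp: p_def field_simps of_nat_diff)
  have T: "finite T" "T \<noteq> {}" using torus_nonempty[of "{..<n}" "2 * d + 1"] by (auto simp: T_def)
  have BH: "(\<Sum>js\<in>tuples n k. cmod (hom_poly n d (g js) z) powr p) \<le> (4 * 2 ^ k) ^ k"
    if z: "z \<in> cpolydisk n" for z
    unfolding p_def
  proof (rule multilinear_Bohnenblust_Hille[OF k])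
    fix w :: "nat \<Rightarrow> nat \<Rightarrow> complex" assume w: "\<And>t l. cmod (w t l) \<le> 1"
    have "cmod (\<Sum>js\<in>tuples n k. (\<Prod>s<k. w s (js ! s)) * hom_poly n d (partials_coeffs js c) z) \<le> M * 1"
      unfolding M_def by (rule partials_form_bound) (use B z w in \<open>auto simp: cpolydisk_def\<close>)
    moreover have "(\<Sum>js\<in>tuples n k. (\<Prod>s<k. w s (js ! s)) * hom_poly n d (g js) z)
        = (\<Sum>js\<in>tuples n k. (\<Prod>s<k. w s (js ! s)) * hom_poly n d (partials_coeffs js c) z) / of_real M"
      by (simp add: hg sum_divide_distrib)
    ultimately show "cmod (\<Sum>js\<in>tuples n k. (\<Prod>s<k. w s (js ! s)) * hom_poly n d (g js) z) \<le> 1"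
      using M by (simp add: norm_divide)
  qed
  have vp: "v js powr p \<le> 4 * 4 powr (d / (k + 1)) * avg T (\<lambda>z. cmod (hom_poly n d (g js) z) powr p)" for js
  proof -
    define V where "V = (\<Sum>\<beta>\<in>hom_idx n d. cmod (g js \<beta>) ^ 2)"
    have V0: "V \<ge> 0" by (simp add: V_def sum_nonneg)
    have deg: "(\<Sum>i<n. \<alpha> i) = d" if "\<alpha> \<in> hom_idx n d" for \<alpha> using that by (simp add: hom_idx_def mi_deg_def)
    have lt: "\<alpha> i < 2 * d + 1" if "\<alpha> \<in> hom_idx n d" "i < n" for \<alpha> i
      using deg[OF that(1)] member_le_sum[of i "{..<n}" \<alpha>] that by simp
    have inj: "\<alpha> = \<beta>" if "\<alpha> \<in> hom_idx n d" "\<beta> \<in> hom_idx n d" "\<And>i. i \<in> {..<n} \<Longrightarrow> \<alpha> i = \<beta> i" for \<alpha> \<beta>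
    proof
      show "\<alpha> i = \<beta> i" for i using that by (cases "i < n") (auto simp: hom_idx_def multi_idx_def)
    qed
    have pars: "avg T (\<lambda>z. cmod (hom_poly n d (g js) z) ^ 2) = V"
      unfolding T_def trig_hom_idx[symmetric] V_def by (rule parseval) (use lt inj in auto)
    have "avg T (\<lambda>z. cmod (hom_poly n d (g js) z) ^ 4) \<le> 4 ^ d * V ^ 2"
      unfolding T_def trig_hom_idx[symmetric] V_def by (rule fourth_moment) (use deg inj in auto)
    then have "avg T (\<lambda>z. cmod (hom_poly n d (g js) z) ^ 2) powr (p / 2)
        \<le> 4 * (4 ^ d) powr (1 - p / 2) * avg T (\<lambda>z. cmod (hom_poly n d (g js) z) powr p)"
      by (intro second_moment_le_p_moment) (use T p pars in auto)
    moreover have "(4 ^ d :: real) powr (1 - p / 2) = 4 powr (d / (k + 1))"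
      unfolding p(3) by (simp add: powr_realpow[symmetric] powr_powr)
    moreover have "V powr (p / 2) = v js powr p"
    proof -
      have "v js = V powr (1 / 2)" using V0 by (simp add: v_def V_def powr_half_sqrt)
      then show ?thesis by (simp add: powr_powr)
    qed
    ultimately show ?thesis by (simp add: pars)
  qed
  define K where "K = 4 * 4 powr (d / (k + 1)) * (4 * 2 ^ k) ^ k"
  have "(\<Sum>js\<in>tuples n k. v js powr p)
     \<le> (\<Sum>js\<in>tuples n k. 4 * 4 powr (d / (k + 1)) * avg T (\<lambda>z. cmod (hom_poly n d (g js) z) powr p))"
    by (intro sum_mono vp)
  also have "\<dots> = 4 * 4 powr (d / (k + 1)) * avg T (\<lambda>z. \<Sum>js\<in>tuples n k. cmod (hom_poly n d (g js) z) powr p)"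
    by (simp add: avg_sum sum_distrib_left)
  also have "\<dots> \<le> K"
    unfolding K_def
  proof (intro mult_left_mono avg_le_const BH T)
    fix z assume z: "z \<in> T"
    show "z \<in> cpolydisk n"
      unfolding cpolydisk_def
    proof safe
      fix i assume "i < n"
      then have "z i \<in> unity_roots (2 * d + 1)" using z by (auto simp: T_def torus_def PiE_def Pi_def)
      then show "cmod (z i) \<le> 1" using norm_unity_roots[of "2 * d + 1" "z i"] by simp
    qed
  qed simp
  finally have vK: "(\<Sum>js\<in>tuples n k. v js powr p) \<le> K" .
  define q where "q = sqrt (real n)"
  have q: "q > 0" "real n = q ^ 2" using n by (auto simp: q_def)
  \<comment> \<open>As p - 1 = (k-1)/(k+1), this level gives both terms of
    \<open>le_add_powr\<close>, summed over the n^k tuples, the same power n^((k-1)/2). This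
    replaces Hoelder's inequality.\<close>
  define l where "l = 1 / q ^ (k + 1)"
  have l: "l > 0" using q by (simp add: l_def)
  have lp: "l powr (1 - p) = q ^ (k - 1)"
  proof -
    have "l = q powr (- real (k + 1))" using q powr_realpow[of q "k+1"] by (simp only: l_def powr_minus_divide)
    then have "l powr (1 - p) = q powr (- real (k + 1) * (1 - p))" by (simp only: powr_powr)
    also have "- real (k + 1) * (1 - p) = real (k - 1)" unfolding p(4) by (simp add: field_simps)
    finally show ?thesis using q by (simp add: powr_realpow)
  qed
  have "(\<Sum>js\<in>tuples n k. v js) \<le> (\<Sum>js\<in>tuples n k. l + l powr (1 - p) * v js powr p)"
    by (intro sum_mono le_add_powr) (use l p in \<open>auto simp: v_def sum_nonneg\<close>)
  also have "\<dots> = real n ^ k * l + q ^ (k - 1) * (\<Sum>js\<in>tuples n k. v js powr p)"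
    by (simp add: sum.distrib card_tuples lp sum_distrib_left)
  also have "\<dots> \<le> real n ^ k * l + q ^ (k - 1) * K"
    using vK q by (intro add_left_mono mult_left_mono) auto
  also have "real n ^ k * l = q ^ (k - 1)"
  proof -
    have "2 * k = (k - 1) + (k + 1)" using k by simp
    then have "q ^ (2 * k) = q ^ (k - 1) * q ^ (k + 1)" by (metis power_add)
    then show ?thesis using q by (simp add: l_def power_mult[symmetric])
  qed
  finally have sv: "(\<Sum>js\<in>tuples n k. v js) \<le> q ^ (k - 1) * (1 + K)" by (simp add: algebra_simps)
  have cs: "(\<Sum>\<beta>\<in>hom_idx n d. cmod (partials_coeffs js c \<beta>)) \<le> M * sqrt (card (hom_idx n d)) * v js" for js
  proof -
    have "(\<Sum>\<beta>\<in>hom_idx n d. cmod (g js \<beta>))\<^sup>2 \<le> (\<Sum>\<beta>\<in>hom_idx n d. cmod (g js \<beta>) ^ 2) * card (hom_idx n d)"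
      by (rule sum_squared_le_sum_of_squares)
    then have "(\<Sum>\<beta>\<in>hom_idx n d. cmod (g js \<beta>)) \<le> sqrt (card (hom_idx n d)) * v js"
      by (simp add: v_def real_le_rsqrt mult.commute flip: real_sqrt_mult)
    moreover have "cmod (partials_coeffs js c \<beta>) = M * cmod (g js \<beta>)" for \<beta>
      using M by (simp add: g_def norm_divide)
    ultimately show ?thesis using M by (simp add: sum_distrib_left[symmetric])
  qed
  have "(\<Sum>\<alpha>\<in>hom_idx n (k + d). cmod (c \<alpha>)) \<le> (\<Sum>js\<in>tuples n k. \<Sum>\<beta>\<in>hom_idx n d. cmod (partials_coeffs js c \<beta>))"
    by (rule sum_coeff_le_partials)
  also have "\<dots> \<le> (\<Sum>js\<in>tuples n k. M * sqrt (card (hom_idx n d)) * v js)"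
    by (intro sum_mono cs)
  also have "\<dots> = M * sqrt (card (hom_idx n d)) * (\<Sum>js\<in>tuples n k. v js)" by (simp add: sum_distrib_left)
  also have "\<dots> \<le> M * sqrt (card (hom_idx n d)) * (q ^ (k - 1) * (1 + K))"
    using M sv by (intro mult_left_mono) auto
  finally show ?thesis by (simp add: M_def q_def K_def mult_ac add.commute)
qed

section \<open>Summing the coefficient bounds\<close>

lemma exp_mult_le: "exp 1 * t \<le> exp (t::real)"
proof -
  have "t \<le> exp (t - 1)" using exp_ge_add_one_self[of "t - 1"] by simp
  then show ?thesis by (simp add: exp_diff field_simps)
qed

text \<open>As a function of d, (e y / d)^d never exceeds e^y; here y = x / a. A factor a slightly
  above 1 per degree thus lowers the exponent from x to x / a, and with x about log n this saves a
  power of n.\<close>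

lemma power_exp_div_le:
  assumes "d \<ge> 1" "x \<ge> 0" "a > (0::real)"
  shows "(exp 1 * x / real d) ^ d \<le> a ^ d * exp (x / a)"
proof -
  have "exp 1 * (x / (real d * a)) \<le> exp (x / (real d * a))" by (rule exp_mult_le)
  then have "exp 1 * x / real d \<le> a * exp (x / (real d * a))"
    using assms by (simp add: field_simps)
  then have "(exp 1 * x / real d) ^ d \<le> (a * exp (x / (real d * a))) ^ d"
    using assms by (intro power_mono) auto
  also have "\<dots> = a ^ d * exp (x / a)"
    using assms by (simp add: power_mult_distrib flip: exp_of_nat_mult)
  finally show ?thesis .
qed

text \<open>d^d / d! is a single term of the exponential series at d.\<close>

lemma power_le_exp_fact: "real d ^ d \<le> exp (real d) * fact d"
proof -
  have "(\<lambda>k. real d ^ k / fact k) sums exp (real d)"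
    using exp_converges[of "real d"] by (simp add: divide_inverse mult.commute)
  then have "(\<Sum>k\<in>{d}. real d ^ k / fact k) \<le> exp (real d)"
    using sum_le_suminf[of "\<lambda>k. real d ^ k / fact k" "{d}"] by (simp add: sums_iff)
  then show ?thesis by (simp add: field_simps)
qed

lemma card_hom_idx_le_exp:
  assumes "d \<ge> 1" shows "real (card (hom_idx n d)) \<le> (exp 1 * real (n + d) / real d) ^ d"
proof -
  have "real (card (hom_idx n d)) * fact d \<le> real (n + d) ^ d"
    using card_hom_idx_upper[of n d] by (metis of_nat_fact of_nat_le_iff of_nat_mult of_nat_power)
  then have "real (card (hom_idx n d)) * fact d * exp (real d) \<le> real (n + d) ^ d * exp (real d)"
    by (intro mult_right_mono) auto
  moreover have "real (card (hom_idx n d)) * real d ^ d \<le> real (card (hom_idx n d)) * (exp (real d) * fact d)"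
    by (intro mult_left_mono power_le_exp_fact) auto
  ultimately have "real (card (hom_idx n d)) * real d ^ d \<le> real (n + d) ^ d * exp (real d)"
    by (simp only: mult_ac)
  moreover have "exp (real d) = exp 1 ^ d" using exp_of_nat_mult[of d 1] by simp
  moreover have "(exp 1 * real (n + d) / real d) ^ d = real (n + d) ^ d * exp 1 ^ d / real d ^ d"
    by (simp only: power_divide power_mult_distrib mult.commute)
  ultimately show ?thesis using assms by (simp add: pos_le_divide_eq)
qed

text \<open>The constants depend on \<epsilon> alone. The slack is (1 - \<epsilon>)^m =
  \<sigma>^(4m). Three shares of size \<theta> = 1/\<sigma> per degree pay for the moment
  comparison, for lowering the exponent log n to (log n)/a, and for n + d in place of n in the count
  of monomials. The fourth share makes the series over m converge.\<close>

lemma weighted_coeff_sum_bound: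
  fixes \<epsilon> :: real
  assumes eps: "0 < \<epsilon>" "\<epsilon> < 1"
  obtains k :: nat and K \<tau> \<sigma> :: real where "\<tau> > 0" "0 < \<sigma>" "\<sigma> < 1" "K \<ge> 0"
    "\<forall>\<^sub>F n in sequentially. \<forall>m\<ge>1. \<forall>c. (\<forall>z\<in>cpolydisk n. cmod (hom_poly n m c z) \<le> 1) \<longrightarrow>
       ((1 - \<epsilon>) * sqrt (ln n / n)) ^ m * (\<Sum>\<alpha>\<in>hom_idx n m. cmod (c \<alpha>))
         \<le> K * (sqrt (ln n) ^ k * real n powr (- \<tau>)) * (real m ^ k * \<sigma> ^ m)"
proof -
  define \<sigma> where "\<sigma> = (1 - \<epsilon>) powr (1 / 4)"
  have sig: "0 < \<sigma>" "\<sigma> < 1" "\<sigma> ^ 4 = 1 - \<epsilon>"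
    using eps powr_less_mono2[of "1/4" "1 - \<epsilon>" 1] by (auto simp: \<sigma>_def powr_powr simp flip: powr_numeral)
  define \<theta> where "\<theta> = 1 / \<sigma>"
  have th: "\<theta> > 1" "\<theta> > 0" using sig(1,2) by (auto simp: \<theta>_def)
  have ths: "\<theta> ^ j * \<sigma> ^ j = 1" for j using sig(1,2) by (simp add: \<theta>_def power_divide)
  have "(\<lambda>k. 4 powr (1 / (real k + 1))) \<longlonglongrightarrow> 1" by real_asymp
  from order_tendstoD(2)[OF this th(1)] obtain k0 where
    k0: "\<And>k. k \<ge> k0 \<Longrightarrow> 4 powr (1 / (real k + 1)) < \<theta>"
    by (auto simp: eventually_sequentially)
  \<comment> \<open>The number of derivatives is fixed once 4^(1/(k+1)) is below \<theta>, before n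
    and m are chosen.\<close>
  define k where "k = max 1 k0"
  have k: "k \<ge> 1" "4 powr (1 / (real k + 1)) < \<theta>" using k0[of k] by (auto simp: k_def)
  define C where "C = ((4 * 2 ^ k) ^ k :: real)"
  define K where "K = 5 * C * (exp 1 * real k) ^ k"
  define a where "a = \<theta> ^ 2"
  have a: "a > 1" "sqrt a = \<theta>" using th by (auto simp: a_def)
  \<comment> \<open>The degrees near log n produce n^(1/(2a)), the multilinear estimate gains
    n^(-1/2), and a > 1 makes the net power negative.\<close>
  define \<tau> where "\<tau> = 1 / 2 - 1 / (2 * a)"
  have tau: "\<tau> > 0" "\<tau> \<le> 1 / 2" using a by (auto simp: \<tau>_def field_simps)
  have C1: "C \<ge> 1"
  proof -
    have "(4 * 2 ^ k :: real) \<ge> 1" using one_le_power[of "2::real" k] by linarith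
    then show ?thesis unfolding C_def by (rule one_le_power)
  qed
  have ek: "exp 1 * real k \<ge> 1"
    using k mult_mono[of 1 "exp 1" 1 "real k"] by simp
  have K0: "K \<ge> 0" using C1 k by (simp add: K_def)
  have ev: "\<forall>\<^sub>F n in sequentially. exp (ln (real n) / real n / 2) < \<theta>"
  proof -
    have "(\<lambda>n. exp (ln (real n) / real n / 2)) \<longlonglongrightarrow> 1" by real_asymp
    then show ?thesis using th(1) by (rule order_tendstoD(2))
  qed
  have "\<forall>\<^sub>F n in sequentially. \<forall>m\<ge>1. \<forall>c. (\<forall>z\<in>cpolydisk n. cmod (hom_poly n m c z) \<le> 1) \<longrightarrow>
       ((1 - \<epsilon>) * sqrt (ln n / n)) ^ m * (\<Sum>\<alpha>\<in>hom_idx n m. cmod (c \<alpha>))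
         \<le> K * (sqrt (ln n) ^ k * real n powr (- \<tau>)) * (real m ^ k * \<sigma> ^ m)"
    using ev eventually_ge_at_top[of 3]
  proof eventually_elim
    case (elim n)
    define L where "L = ln (real n)"
    define q where "q = sqrt (real n)"
    define P where "P = sqrt (L / real n)"
    define \<eta> where "\<eta> = L / real n"
    have L: "L \<ge> 1"
    proof -
      have "exp 1 \<le> (3::real)" using exp_le by simp
      also have "3 \<le> real n" using elim by simp
      finally show ?thesis using elim by (simp add: L_def ln_ge_iff)
    qed
    have n: "real n > 0" "n \<ge> 1" using elim by auto
    have q: "q > 0" "real n = q ^ 2" "1 / q = real n powr (- (1 / 2))"
      using n by (auto simp: q_def powr_minus_divide powr_half_sqrt)
    have eta: "\<eta> \<ge> 0" "exp (\<eta> / 2) \<le> \<theta>" using L n elim by (auto simp: \<eta>_def L_def)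
    have P0: "P \<ge> 0" by (simp add: P_def L_def) (use L L_def in auto)
    have Pq: "P ^ j * q ^ (j - 1) = sqrt L ^ j / q" if "j \<ge> 1" for j
    proof -
      have "P = sqrt L / q" by (simp add: P_def q_def real_sqrt_divide)
      moreover have "q ^ j = q * q ^ (j - 1)" using that by (cases j) auto
      ultimately show ?thesis using q(1) by (simp only: power_divide) (simp add: field_simps)
    qed
    show ?case
    proof (intro allI impI)
      fix m :: nat and c assume m: "m \<ge> 1" and B: "\<forall>z\<in>cpolydisk n. cmod (hom_poly n m c z) \<le> 1"
      define S where "S = (\<Sum>\<alpha>\<in>hom_idx n m. cmod (c \<alpha>))"
      have "(\<sigma> ^ 4 * P) ^ m * S \<le> K * (sqrt L ^ k * real n powr (- \<tau>)) * (real m ^ k * \<sigma> ^ m)"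
      proof (cases "m \<le> k")
        \<comment> \<open>Low degrees: all m derivatives are taken, so d = 0 and the factor n^(-1/2)
          appears at once.\<close>
        case True
        have "S \<le> (exp 1 * real (m + 0)) ^ m * sqrt (card (hom_idx n 0)) * sqrt n ^ (m - 1)
            * (1 + 4 * 4 powr (real 0 / (m + 1)) * (4 * 2 ^ m) ^ m)"
          using coeff_sum_bound[OF m n(2), of 0 c] B by (simp add: S_def)
        also have "\<dots> = (exp 1 * real m) ^ m * q ^ (m - 1) * (1 + 4 * (4 * 2 ^ m) ^ m)"
          by (simp add: hom_idx_0 q_def)
        also have "\<dots> \<le> (exp 1 * real k) ^ k * q ^ (m - 1) * (5 * C)"
        proof (intro mult_mono)
          have "(exp 1 * real m) ^ m \<le> (exp 1 * real k) ^ m"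
            using True by (intro power_mono) auto
          also have "\<dots> \<le> (exp 1 * real k) ^ k" using True ek by (rule power_increasing)
          finally show "(exp 1 * real m) ^ m \<le> (exp 1 * real k) ^ k" .
          have "(4 * 2 ^ m) ^ m \<le> (4 * 2 ^ k :: real) ^ m"
            using True by (intro power_mono) (auto intro: power_increasing)
          also have "\<dots> \<le> (4 * 2 ^ k :: real) ^ k"
            using True by (intro power_increasing) (auto intro: order_trans[OF one_le_power[of "2::real" k]])
          finally show "1 + 4 * (4 * 2 ^ m) ^ m \<le> 5 * C" using C1 by (simp add: C_def)
        qed (use q in auto)
        finally have S: "S \<le> K * q ^ (m - 1)" by (simp add: K_def mult_ac)
        have "(\<sigma> ^ 4 * P) ^ m * S \<le> (\<sigma> ^ 4 * P) ^ m * (K * q ^ (m - 1))"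
          using sig(1,2) P0 by (intro mult_left_mono S) auto
        also have "\<dots> = K * ((\<sigma> ^ 4) ^ m * (P ^ m * q ^ (m - 1)))"
          by (simp add: power_mult_distrib mult_ac)
        also have "\<dots> = K * ((\<sigma> ^ 4) ^ m * (sqrt L ^ m * real n powr (- (1 / 2))))"
          unfolding Pq[OF m] q(3)[symmetric] by simp
        also have "\<dots> \<le> K * (\<sigma> ^ m * (sqrt L ^ k * real n powr (- \<tau>)))"
        proof (intro mult_left_mono mult_mono K0)
          show "(\<sigma> ^ 4) ^ m \<le> \<sigma> ^ m" using sig(1,2) power_decreasing[of 1 4 \<sigma>] by (intro power_mono) auto
          show "sqrt L ^ m \<le> sqrt L ^ k" using L True by (intro power_increasing) auto
          show "real n powr (- (1 / 2)) \<le> real n powr (- \<tau>)" using n tau by (intro powr_mono) auto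
        qed (use sig(1,2) L in auto)
        also have "\<dots> = K * (sqrt L ^ k * real n powr (- \<tau>)) * (1 * \<sigma> ^ m)" by (simp add: mult_ac)
        also have "\<dots> \<le> K * (sqrt L ^ k * real n powr (- \<tau>)) * (real m ^ k * \<sigma> ^ m)"
          using K0 L m sig by (intro mult_left_mono mult_right_mono one_le_power) auto
        finally show ?thesis .
      next
        case False
        define d where "d = m - k"
        have d: "d \<ge> 1" "m = k + d" using False by (auto simp: d_def)
        \<comment> \<open>This is (L/n)(n + d). The surplus \<eta> d is paid for by exp(\<eta>/2)
          \<le> \<theta>.\<close>
        define x where "x = L + \<eta> * real d"
        have x: "x \<ge> 0" using L eta by (simp add: x_def)
        have S: "S \<le> (exp 1 * real m) ^ k * sqrt (card (hom_idx n d)) * q ^ (k - 1)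
            * (1 + 4 * 4 powr (real d / (real k + 1)) * C)"
          using coeff_sum_bound[OF k(1) n(2), of d c] B by (simp add: S_def q_def C_def d(2) del: power_mult_distrib)
        have e1: "P ^ d * sqrt (card (hom_idx n d)) \<le> \<theta> ^ d * \<theta> ^ d * real n powr (1 / (2 * a))"
        proof -
          have "P ^ d * sqrt (card (hom_idx n d)) = sqrt ((L / n) ^ d * card (hom_idx n d))"
            by (simp add: P_def real_sqrt_mult real_sqrt_power)
          also have "\<dots> \<le> sqrt ((L / n) ^ d * (exp 1 * real (n + d) / real d) ^ d)"
            using card_hom_idx_le_exp[OF d(1), of n] L n by (intro real_sqrt_le_mono mult_left_mono) auto
          also have "(L / n) ^ d * (exp 1 * real (n + d) / real d) ^ d = (exp 1 * x / real d) ^ d"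
            unfolding power_mult_distrib[symmetric] x_def \<eta>_def using n d by (simp add: field_simps)
          also have "sqrt \<dots> \<le> sqrt (a ^ d * exp (x / a))"
            using power_exp_div_le[OF d(1) x, of a] a by (intro real_sqrt_le_mono) auto
          also have "\<dots> = \<theta> ^ d * sqrt (exp (x / a))" using a by (simp add: real_sqrt_mult real_sqrt_power)
          also have "sqrt (exp (x / a)) = exp (x / (2 * a))"
          proof -
            have "exp (x / a) = exp (x / (2 * a)) ^ 2" by (simp flip: exp_of_nat_mult)
            then show ?thesis by simp
          qed
          also have "exp (x / (2 * a)) = exp (\<eta> * real d / (2 * a)) * real n powr (1 / (2 * a))"
            using n a by (simp add: x_def powr_def L_def exp_add[symmetric] add_divide_distrib add.commute)
          also have "\<theta> ^ d * (exp (\<eta> * real d / (2 * a)) * real n powr (1 / (2 * a)))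
              \<le> \<theta> ^ d * (\<theta> ^ d * real n powr (1 / (2 * a)))"
          proof (intro mult_left_mono mult_right_mono)
            have "\<eta> * real d / (2 * a) \<le> \<eta> * real d / (2 * 1)"
              using eta a by (intro divide_left_mono) auto
            then have "exp (\<eta> * real d / (2 * a)) \<le> exp (real d * (\<eta> / 2))" by (simp add: mult.commute)
            also have "\<dots> = exp (\<eta> / 2) ^ d" by (rule exp_of_nat_mult)
            also have "\<dots> \<le> \<theta> ^ d" using eta by (intro power_mono) auto
            finally show "exp (\<eta> * real d / (2 * a)) \<le> \<theta> ^ d" .
          qed (use th in auto)
          finally show ?thesis by (simp add: mult.assoc)
        qed
        have e2: "1 + 4 * 4 powr (real d / (real k + 1)) * C \<le> 5 * C * \<theta> ^ d"
        proof -
          have "4 powr (real d / (real k + 1)) = (4 powr (1 / (real k + 1))) ^ d"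
            by (simp add: powr_powr flip: powr_realpow)
          also have "\<dots> \<le> \<theta> ^ d" using k by (intro power_mono) auto
          finally have "4 * 4 powr (real d / (real k + 1)) * C \<le> 4 * \<theta> ^ d * C"
            using C1 by (intro mult_right_mono mult_left_mono) auto
          moreover have "1 * 1 \<le> C * \<theta> ^ d" using C1 th by (intro mult_mono) auto
          ultimately show ?thesis by (simp add: mult.assoc mult.commute[of C])
        qed
        have "(\<sigma> ^ 4 * P) ^ m * S \<le> (\<sigma> ^ 4 * P) ^ m * ((exp 1 * real m) ^ k * sqrt (card (hom_idx n d)) * q ^ (k - 1)
            * (1 + 4 * 4 powr (real d / (real k + 1)) * C))"
          using sig(1,2) P0 by (intro mult_left_mono S) auto
        also have "\<dots> = (\<sigma> ^ 4) ^ m * (exp 1 * real m) ^ k * (P ^ k * q ^ (k - 1)) *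
             (P ^ d * sqrt (card (hom_idx n d))) * (1 + 4 * 4 powr (real d / (real k + 1)) * C)"
          by (simp add: d(2) power_add power_mult_distrib)
        also have "\<dots> \<le> (\<sigma> ^ 4) ^ m * (exp 1 * real m) ^ k * (sqrt L ^ k / q) *
             (\<theta> ^ d * \<theta> ^ d * real n powr (1 / (2 * a))) * (5 * C * \<theta> ^ d)"
          unfolding Pq[OF k(1)] using sig(1,2) q(1) L th P0 C1
          by (intro mult_mono e1 e2 order_refl mult_nonneg_nonneg add_nonneg_nonneg) auto
        also have "\<dots> = 5 * C * exp 1 ^ k * (sqrt L ^ k * (real n powr (1 / (2 * a)) / q)) * (real m ^ k * (\<sigma> ^ m * ((\<sigma> ^ 3) ^ m * (\<theta> ^ 3) ^ d)))"
        proof -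
          have "(\<sigma> ^ 4) ^ m = \<sigma> ^ m * (\<sigma> ^ 3) ^ m" by (simp flip: power_mult_distrib power_Suc)
          moreover have "(\<theta> ^ 3) ^ d = \<theta> ^ d * \<theta> ^ d * \<theta> ^ d" by (simp add: power3_eq_cube power_mult_distrib)
          ultimately show ?thesis by (simp add: power_mult_distrib mult_ac)
        qed
        also have "real n powr (1 / (2 * a)) / q = real n powr (- \<tau>)"
        proof -
          have "real n powr (1 / (2 * a)) / q = real n powr (1 / (2 * a)) * real n powr (- (1 / 2))"
            by (simp add: q(3)[symmetric])
          then show ?thesis using n by (simp add: powr_add[symmetric] \<tau>_def)
        qed
        also have "5 * C * exp 1 ^ k * (sqrt L ^ k * real n powr (- \<tau>)) * (real m ^ k * (\<sigma> ^ m * ((\<sigma> ^ 3) ^ m * (\<theta> ^ 3) ^ d)))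
            \<le> K * (sqrt L ^ k * real n powr (- \<tau>)) * (real m ^ k * (\<sigma> ^ m * 1))"
        proof (intro mult_mono mult_left_mono mult_right_mono)
          have "exp 1 ^ k \<le> (exp 1 * real k) ^ k" using k by (intro power_mono) auto
          then show "5 * C * exp 1 ^ k \<le> K" using C1 by (simp add: K_def)
          have "(\<sigma> ^ 3) ^ m * (\<theta> ^ 3) ^ d \<le> (\<sigma> ^ 3) ^ m * (\<theta> ^ 3) ^ m"
            using sig(1,2) th d by (intro mult_left_mono power_increasing one_le_power) auto
          also have "\<dots> = 1" using ths by (simp add: mult.commute flip: power_mult)
          finally show "(\<sigma> ^ 3) ^ m * (\<theta> ^ 3) ^ d \<le> 1" .
        qed (use sig(1,2) th L K0 in auto)
        finally show ?thesis by simp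
      qed
      then show "((1 - \<epsilon>) * sqrt (ln n / n)) ^ m * (\<Sum>\<alpha>\<in>hom_idx n m. cmod (c \<alpha>))
         \<le> K * (sqrt (ln n) ^ k * real n powr (- \<tau>)) * (real m ^ k * \<sigma> ^ m)"
        by (simp add: S_def P_def L_def sig(3))
    qed
  qed
  then show thesis using that tau(1) sig(1,2) K0 by blast
qed

text \<open>One summable majorant serves all normalised polynomials of all degrees. Its sum can be
  made as small as desired for large n, which is what beats the constants of the space X.\<close>

lemma weighted_coeff_sums_small:
  fixes \<epsilon> \<delta> :: real
  assumes eps: "0 < \<epsilon>" "\<epsilon> < 1" and del: "\<delta> > 0"
  shows "\<forall>\<^sub>F n in sequentially. \<exists>b. summable b \<and> suminf b \<le> \<delta> \<and>
     (\<forall>m. \<forall>c. (\<forall>z\<in>cpolydisk n. cmod (hom_poly n (Suc m) c z) \<le> 1) \<longrightarrow>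
       ((1 - \<epsilon>) * sqrt (ln n / n)) ^ Suc m * (\<Sum>\<alpha>\<in>hom_idx n (Suc m). cmod (c \<alpha>)) \<le> b m)"
proof -
  obtain k :: nat and K \<tau> \<sigma> :: real where *: "\<tau> > 0" "0 < \<sigma>" "\<sigma> < 1" "K \<ge> 0"
    "\<forall>\<^sub>F n in sequentially. \<forall>m\<ge>1. \<forall>c. (\<forall>z\<in>cpolydisk n. cmod (hom_poly n m c z) \<le> 1) \<longrightarrow>
       ((1 - \<epsilon>) * sqrt (ln n / n)) ^ m * (\<Sum>\<alpha>\<in>hom_idx n m. cmod (c \<alpha>))
         \<le> K * (sqrt (ln n) ^ k * real n powr (- \<tau>)) * (real m ^ k * \<sigma> ^ m)"
    by (rule weighted_coeff_sum_bound[OF eps])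
  define g where "g m = real (Suc m) ^ k * \<sigma> ^ Suc m" for m
  have g: "summable g"
  proof (rule summable_comparison_test_bigo)
    \<comment> \<open>With \<sigma> = e^(-2c), half of the decay absorbs the factor m^k and the
      other half remains as a geometric majorant.\<close>
    define c where "c = - ln \<sigma> / 2"
    have c: "c > 0" "\<sigma> = exp (- 2 * c)"
      using * by (auto simp: c_def)
    have "norm (exp (- c)) < 1" using c(1) by simp
    then show "summable (\<lambda>m. norm (exp (- c) ^ m))" by (simp add: summable_geometric)
    have "(\<lambda>m. (real m + 1) powr real k * exp (- 2 * c * (real m + 1))) \<in> O(\<lambda>m. exp (- c * real m))"
      using c(1) by real_asymp
    moreover have "(real m + 1) powr real k * exp (- 2 * c * (real m + 1)) = g m" for m
    proof -
      have "exp (- 2 * c * (real m + 1)) = \<sigma> ^ Suc m"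
        unfolding c(2) by (subst exp_of_nat_mult[symmetric]) (simp add: algebra_simps)
      moreover have "(real m + 1) powr real k = real (Suc m) ^ k"
        using powr_realpow[of "real m + 1" k] by (simp add: add.commute)
      ultimately show ?thesis by (simp add: g_def)
    qed
    moreover have "exp (- c * real m) = exp (- c) ^ m" for m
      by (subst exp_of_nat_mult[symmetric]) (simp add: mult.commute)
    ultimately show "g \<in> O(\<lambda>m. exp (- c) ^ m)" by simp
  qed
  have "(\<lambda>n. K * (sqrt (ln (real n)) ^ k * real n powr (- \<tau>)) * suminf g) \<longlonglongrightarrow> 0"
  proof -
    have "(\<lambda>n. sqrt (ln (real n)) powr real k * real n powr (- \<tau>)) \<longlonglongrightarrow> 0"
      using *(1) by real_asymp
    moreover have "\<forall>\<^sub>F n in sequentially. sqrt (ln (real n)) powr real k * real n powr (- \<tau>)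
        = sqrt (ln (real n)) ^ k * real n powr (- \<tau>)"
      using eventually_ge_at_top[of 2] by eventually_elim (simp add: powr_realpow)
    ultimately have "(\<lambda>n. sqrt (ln (real n)) ^ k * real n powr (- \<tau>)) \<longlonglongrightarrow> 0"
      by (rule Lim_transform_eventually)
    then show ?thesis using tendsto_mult_left_zero tendsto_mult_right_zero by blast
  qed
  then have "\<forall>\<^sub>F n in sequentially. K * (sqrt (ln (real n)) ^ k * real n powr (- \<tau>)) * suminf g < \<delta>"
    using del by (rule order_tendstoD(2))
  with *(5) show ?thesis
  proof eventually_elim
    case (elim n)
    show ?case
    proof (intro exI[of _ "\<lambda>m. K * (sqrt (ln (real n)) ^ k * real n powr (- \<tau>)) * g m"] conjI allI impI)
      show "summable (\<lambda>m. K * (sqrt (ln (real n)) ^ k * real n powr (- \<tau>)) * g m)"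
        using g by (rule summable_mult)
      show "(\<Sum>m. K * (sqrt (ln (real n)) ^ k * real n powr (- \<tau>)) * g m) \<le> \<delta>"
        unfolding suminf_mult[OF g] using elim(2) by simp
    qed (use elim(1) in \<open>unfold g_def, auto simp del: of_nat_Suc power_Suc\<close>)
  qed
qed

section \<open>Homogeneous parts of vector-valued functions\<close>

lemma cscale_zero_left [simp]: "cscale 0 (x::'a::complex_normed_vector_space) = 0"
  using norm_cscale[of 0 x] by simp

lemma cscale_zero_right [simp]: "cscale a (0::'a::complex_normed_vector_space) = 0"
  using norm_cscale[of a 0] by simp

lemma bounded_linear_cscale_left: "bounded_linear (\<lambda>a. cscale a (x::'a::complex_normed_vector_space))"
  by (rule bounded_linear_intro[of _ "norm x"])
    (simp_all add: cscale_add_left norm_cscale scaleR_conv_of_real scaleR_cscale cscale_cscale)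

lemma bounded_linear_cscale_right: "bounded_linear (cscale a :: 'a \<Rightarrow> 'a::complex_normed_vector_space)"
  by (rule bounded_linear_intro[of _ "cmod a"])
    (simp_all add: cscale_add_right norm_cscale scaleR_cscale cscale_cscale mult.commute)

lemmas cscale_sum_left = bounded_linear.linear[OF bounded_linear_cscale_left, THEN linear_sum]
lemmas cscale_sum_right = bounded_linear.linear[OF bounded_linear_cscale_right, THEN linear_sum]
lemmas cscale_diff_left = bounded_linear.linear[OF bounded_linear_cscale_left, THEN linear_diff]

text \<open>A spanning set of least cardinality is independent: a relation with nonzero coefficient
  at \<open>b0\<close> expresses \<open>b0\<close> by the others and lets it be removed.\<close>

lemma finite_dim_basis:
  assumes "complex_fin_dim TYPE('a::complex_normed_vector_space)"
  obtains B :: "'a::complex_normed_vector_space set" where "finite B"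
    "\<forall>x. \<exists>c. x = (\<Sum>b\<in>B. cscale (c b) b)"
    "\<forall>c. (\<Sum>b\<in>B. cscale (c b) b) = 0 \<longrightarrow> (\<forall>b\<in>B. c b = 0)"
proof -
  define Q where "Q B \<longleftrightarrow> finite B \<and> (\<forall>x::'a. \<exists>c. x = (\<Sum>b\<in>B. cscale (c b) b))" for B
  have "\<exists>B. Q B" using assms by (auto simp: complex_fin_dim_def Q_def)
  then obtain B where B: "Q B" and min: "\<And>B'. Q B' \<Longrightarrow> card B \<le> card B'"
    using ex_has_least_nat[of Q _ card] by blast
  have fin: "finite B" using B by (simp add: Q_def)
  have "c b0 = 0" if c: "(\<Sum>b\<in>B. cscale (c b) b) = 0" and b0: "b0 \<in> B" for c b0
  proof (rule ccontr)
    assume nz: "c b0 \<noteq> 0"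
    have "Q (B - {b0})"
      unfolding Q_def
    proof (intro conjI allI)
      fix x :: 'a
      obtain e where e: "x = (\<Sum>b\<in>B. cscale (e b) b)" using B by (auto simp: Q_def)
      define f where "f b = e b - e b0 / c b0 * c b" for b
      have "(\<Sum>b\<in>B. cscale (f b) b) = (\<Sum>b\<in>B. cscale (e b) b) - (\<Sum>b\<in>B. cscale (e b0 / c b0) (cscale (c b) b))"
        by (simp add: f_def cscale_diff_left cscale_cscale sum_subtractf)
      also have "\<dots> = x" by (simp add: e c flip: cscale_sum_right)
      finally have "x = (\<Sum>b\<in>B - {b0}. cscale (f b) b)"
        using b0 fin nz by (simp add: sum.remove[of B b0] f_def)
      then show "\<exists>c. x = (\<Sum>b\<in>B - {b0}. cscale (c b) b)" by blast
    qed (use fin in auto)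
    then show False using min[of "B - {b0}"] b0 fin by (metis card_Diff1_less not_less)
  qed
  then show thesis using that[of B] B by (auto simp: Q_def)
qed

text \<open>On the compact \<open>\<ell>\<^sub>1\<close>-sphere of coefficient vectors the norm of a linear combination of
  independent vectors is bounded below.\<close>
lemma finite_dim_functionals:
  assumes "complex_fin_dim TYPE('a::complex_normed_vector_space)"
  obtains B :: "'a::complex_normed_vector_space set" and \<phi> :: "'a \<Rightarrow> 'a \<Rightarrow> complex" and C :: real where
    "finite B" "C > 0"
    "\<forall>b x y. \<phi> b (x + y) = \<phi> b x + \<phi> b y" "\<forall>b a x. \<phi> b (cscale a x) = a * \<phi> b x"
    "\<forall>b x. cmod (\<phi> b x) \<le> C * norm x"
    "\<forall>x. norm x \<le> C * (\<Sum>b\<in>B. cmod (\<phi> b x))"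
proof -
  obtain B :: "'a set" where B: "finite B"
    and span: "\<forall>x. \<exists>c. x = (\<Sum>b\<in>B. cscale (c b) b)"
    and ind': "\<forall>c. (\<Sum>b\<in>B. cscale (c b) b) = 0 \<longrightarrow> (\<forall>b\<in>B. c b = 0)"
    by (rule finite_dim_basis[OF assms])
  have ind: "c b = 0" if "(\<Sum>b\<in>B. cscale (c b) b) = 0" "b \<in> B" for c b
    using ind' that by blast
  define lc where "lc c = (\<Sum>b\<in>B. cscale (c b) b)" for c
  have ex1: "\<exists>!c. (\<forall>b. b \<notin> B \<longrightarrow> c b = 0) \<and> x = lc c" for x
  proof (rule ex_ex1I)
    obtain c where "x = lc c" using span unfolding lc_def by blast
    then show "\<exists>c. (\<forall>b. b \<notin> B \<longrightarrow> c b = 0) \<and> x = lc c"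
      by (intro exI[of _ "\<lambda>b. if b \<in> B then c b else 0"]) (auto simp: lc_def intro: sum.cong)
  next
    fix c c' assume c: "(\<forall>b. b \<notin> B \<longrightarrow> c b = 0) \<and> x = lc c" and c': "(\<forall>b. b \<notin> B \<longrightarrow> c' b = 0) \<and> x = lc c'"
    then have "(\<Sum>b\<in>B. cscale (c b - c' b) b) = 0"
      by (simp add: lc_def cscale_diff_left sum_subtractf)
    from ind[OF this] have "c b = c' b" if "b \<in> B" for b using that by simp
    then show "c = c'" using c c' by fastforce
  qed
  define \<psi> where "\<psi> x = (THE c. (\<forall>b. b \<notin> B \<longrightarrow> c b = 0) \<and> x = lc c)" for x
  have psi: "b \<notin> B \<Longrightarrow> \<psi> x b = 0" "x = lc (\<psi> x)" for x b
    using theI'[OF ex1[of x]] unfolding \<psi>_def by blast+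
  have psi_eq: "\<psi> x = c" if "\<forall>b. b \<notin> B \<longrightarrow> c b = 0" "x = lc c" for x c
    using that unfolding \<psi>_def by (intro the1_equality[OF ex1]) auto
  have add: "\<psi> (x + y) = (\<lambda>b. \<psi> x b + \<psi> y b)" for x y
  proof (rule psi_eq)
    have "x + y = lc (\<psi> x) + lc (\<psi> y)" using psi(2) by metis
    then show "x + y = lc (\<lambda>b. \<psi> x b + \<psi> y b)" by (simp add: lc_def cscale_add_left sum.distrib)
  qed (use psi in auto)
  have scale: "\<psi> (cscale a x) = (\<lambda>b. a * \<psi> x b)" for a x
  proof (rule psi_eq)
    have "cscale a x = cscale a (lc (\<psi> x))" using psi(2) by metis
    then show "cscale a x = lc (\<lambda>b. a * \<psi> x b)" by (simp add: lc_def cscale_sum_right cscale_cscale)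
  qed (use psi in auto)
  define S where "S = {c :: 'a \<Rightarrow> complex. (\<Sum>b\<in>B. cmod (c b)) = 1}"
  \<comment> \<open>Coordinates outside \<open>B\<close> are pinned to 0, so the coefficient vectors
    lie in a product of compact sets and Tychonoff's theorem applies in the function space.\<close>
  define D where "D = PiE UNIV (\<lambda>b. if b \<in> B then cball 0 1 else {0::complex})"
  have cont_coord: "continuous_on UNIV (\<lambda>c::'a \<Rightarrow> complex. c b)" for b
    by (rule continuous_on_product_coordinates)
  have "compactin (product_topology (\<lambda>i::'a. euclidean) UNIV) D"
    unfolding D_def compactin_PiE by auto
  then have "compact D" by (simp add: euclidean_product_topology)
  moreover have "closed S"
    unfolding S_def by (intro closed_Collect_eq continuous_intros cont_coord)
  ultimately have K: "compact (D \<inter> S)" by (rule compact_Int_closed)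
  have cont_lc: "continuous_on A (\<lambda>c. norm (lc c))" for A
    unfolding lc_def
    by (intro continuous_intros bounded_linear.continuous_on[OF bounded_linear_cscale_left]
        continuous_on_subset[OF cont_coord]) auto
  obtain \<mu> where mu: "\<mu> > 0" "\<And>c. c \<in> D \<inter> S \<Longrightarrow> norm (lc c) \<ge> \<mu>"
  proof (cases "D \<inter> S = {}")
    \<comment> \<open>This happens when \<open>B\<close> is empty, and then any positive bound
      serves.\<close>
    case True
    then show ?thesis using that[of 1] by auto
  next
    case False
    from continuous_attains_inf[OF K False cont_lc] obtain c0 where
      c0: "c0 \<in> D \<inter> S" "\<And>c. c \<in> D \<inter> S \<Longrightarrow> norm (lc c0) \<le> norm (lc c)" by blast
    have "norm (lc c0) \<noteq> 0"
    proof
      assume "norm (lc c0) = 0"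
      then have "(\<Sum>b\<in>B. cscale (c0 b) b) = 0" by (simp add: lc_def)
      from ind[OF this] have "(\<Sum>b\<in>B. cmod (c0 b)) = 0" by simp
      then show False using c0(1) by (simp add: S_def)
    qed
    then show ?thesis using that[of "norm (lc c0)"] c0 by auto
  qed
  have l1: "\<mu> * (\<Sum>b\<in>B. cmod (\<psi> x b)) \<le> norm x" for x
  proof (cases "(\<Sum>b\<in>B. cmod (\<psi> x b)) = 0")
    case False
    define s where "s = (\<Sum>b\<in>B. cmod (\<psi> x b))"
    have s: "s > 0" using False by (simp add: s_def sum_nonneg less_le)
    define c where "c = \<psi> (cscale (1 / of_real s) x)"
    have c: "c b = \<psi> x b / of_real s" for b by (simp add: c_def scale)
    have S: "(\<Sum>b\<in>B. cmod (c b)) = 1"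
      using s by (simp add: c norm_divide sum_divide_distrib[symmetric] s_def[symmetric])
    have "cmod (c b) \<le> 1" if "b \<in> B" for b
      using member_le_sum[of b B "\<lambda>b. cmod (c b)"] that B S by simp
    then have "c \<in> D \<inter> S" using S psi(1) by (auto simp: D_def S_def c)
    from mu(2)[OF this] have "\<mu> \<le> norm (cscale (1 / of_real s) x)"
      unfolding c_def psi(2)[symmetric] .
    then have "\<mu> \<le> norm x / s" using s by (simp add: norm_cscale norm_divide)
    then show ?thesis using s by (simp add: field_simps s_def)
  qed simp
  \<comment> \<open>One constant for both directions: 1/\<mu> bounds the functionals, and the sum of
    norms dominates each basis vector in the reconstruction.\<close>
  define C where "C = max (1 / \<mu>) (1 + (\<Sum>b\<in>B. norm b))"
  have C: "C > 0" "1 / \<mu> \<le> C" using mu by (auto simp: C_def less_max_iff_disj)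
  have Cb: "norm b \<le> C" if "b \<in> B" for b
    using member_le_sum[of b B norm] that B by (simp add: C_def le_max_iff_disj)
  show thesis
  proof (rule that[of B C "\<lambda>b x. \<psi> x b"])
    have "cmod (\<psi> x b) \<le> C * norm x" for b x
    proof (cases "b \<in> B")
      case True
      then have "cmod (\<psi> x b) \<le> (\<Sum>b\<in>B. cmod (\<psi> x b))" using B by (intro member_le_sum) auto
      also have "\<dots> \<le> 1 / \<mu> * norm x" using l1[of x] mu by (simp add: field_simps)
      also have "\<dots> \<le> C * norm x" using C by (intro mult_right_mono) auto
      finally show ?thesis .
    qed (use C psi in auto)
    then show "\<forall>b x. cmod (\<psi> x b) \<le> C * norm x" by blast
    have "norm x \<le> C * (\<Sum>b\<in>B. cmod (\<psi> x b))" for x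
    proof -
      have "norm x = norm (lc (\<psi> x))" using psi(2) by metis
      also have "\<dots> \<le> (\<Sum>b\<in>B. cmod (\<psi> x b) * norm b)"
        unfolding lc_def by (rule order_trans[OF norm_sum]) (simp add: norm_cscale)
      also have "\<dots> \<le> (\<Sum>b\<in>B. cmod (\<psi> x b) * C)"
        by (intro sum_mono mult_left_mono Cb) auto
      finally show ?thesis by (simp add: sum_distrib_left mult.commute)
    qed
    then show "\<forall>x. norm x \<le> C * (\<Sum>b\<in>B. cmod (\<psi> x b))" by blast
  qed (use B C add scale in auto)
qed

section \<open>Homogeneous parts under the one-variable hypothesis\<close>

definition hom_part :: "nat \<Rightarrow> ((nat \<Rightarrow> nat) \<Rightarrow> 'a::complex_normed_vector_space) \<Rightarrow> (nat \<Rightarrow> complex) \<Rightarrow> nat \<Rightarrow> 'a" where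
  "hom_part n x z m = (\<Sum>\<alpha>\<in>hom_idx n m. cscale (monom n z \<alpha>) (x \<alpha>))"

text \<open>Only the linear term of the Bohr sum is kept. The strict inequality at \<open>r0\<close>
  leaves a larger admissible radius, whose open disk contains the point \<open>r0\<close>
  itself.\<close>

lemma one_var_bound:
  fixes y :: "nat \<Rightarrow> 'a::complex_normed_vector_space"
  assumes r0: "r0 > 0" "ereal r0 < RX p q 1 TYPE('a)" and q: "q \<ge> 1"
    and y: "\<And>w. cmod w < 1 \<Longrightarrow> (\<lambda>l. cscale (w ^ l) (y l)) summable_on UNIV \<and>
      norm (\<Sum>\<^sub>\<infinity>l. cscale (w ^ l) (y l)) \<le> 1"
  shows "norm (y 0) powr p + (r0 * norm (y 1)) powr q \<le> 1"
proof -
  define x where "x \<alpha> = y (\<alpha> 0)" for \<alpha> :: "nat \<Rightarrow> nat"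
  define s where "s l = (\<lambda>i::nat. if i = 0 then l else 0 :: nat)" for l
  have bij: "bij_betw s UNIV (multi_idx 1)"
    by (rule bij_betwI[where g = "\<lambda>\<alpha>. \<alpha> 0"]) (auto simp: s_def multi_idx_def fun_eq_iff)
  have monom1: "monom 1 z \<alpha> = z 0 ^ \<alpha> 0" for z \<alpha> by (simp add: monom_def)
  have "bhol_coeffs 1 x"
    unfolding bhol_coeffs_def
  proof
    fix z assume "z \<in> polydisk 1 1"
    then have "cmod (z 0) < 1" by (simp add: polydisk_def)
    from y[OF this] show "(\<lambda>\<alpha>. cscale (monom 1 z \<alpha>) (x \<alpha>)) summable_on multi_idx 1 \<and>
        norm (\<Sum>\<^sub>\<infinity>\<alpha>\<in>multi_idx 1. cscale (monom 1 z \<alpha>) (x \<alpha>)) \<le> 1"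
      unfolding summable_on_reindex_bij_betw[OF bij, symmetric] infsum_reindex_bij_betw[OF bij, symmetric]
      unfolding monom1 x_def s_def by simp
  qed
  then have "RX p q 1 TYPE('a) \<le> Rf p q 1 x"
    unfolding RX_def by (intro Inf_lower) auto
  with r0(2) have "ereal r0 < Rf p q 1 x" by (rule less_le_trans)
  then obtain r where r: "r0 < r" and bd: "\<forall>z\<in>polydisk 1 r. summable (\<lambda>k. hom_norm 1 x z (Suc k)) \<and>
         norm (x (\<lambda>_. 0)) powr p + (\<Sum>k. hom_norm 1 x z (Suc k)) powr q \<le> 1"
    unfolding Rf_def less_Sup_iff by auto
  define z where "z = (\<lambda>_::nat. complex_of_real r0)"
  have "z \<in> polydisk 1 r" using r r0 by (simp add: polydisk_def z_def)
  with bd have sm: "summable (\<lambda>k. hom_norm 1 x z (Suc k))"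
    and le: "norm (x (\<lambda>_. 0)) powr p + (\<Sum>k. hom_norm 1 x z (Suc k)) powr q \<le> 1" by auto
  have nn: "hom_norm 1 x z k \<ge> 0" for k by (simp add: hom_norm_def sum_nonneg)
  have "{\<alpha> \<in> multi_idx 1. mi_deg 1 \<alpha> = Suc 0} = {s 1}"
    by (auto simp: multi_idx_def mi_deg_def s_def fun_eq_iff)
  then have "hom_norm 1 x z (Suc 0) = r0 * norm (y 1)"
    using r0 by (simp add: hom_norm_def monom_def x_def s_def z_def norm_cscale)
  moreover have "(\<Sum>k\<in>{0}. hom_norm 1 x z (Suc k)) \<le> (\<Sum>k. hom_norm 1 x z (Suc k))"
    by (rule sum_le_suminf[OF sm]) (use nn in auto)
  ultimately have "(r0 * norm (y 1)) powr q \<le> (\<Sum>k. hom_norm 1 x z (Suc k)) powr q"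
    using r0 q by (intro powr_mono2) auto
  with le show ?thesis by (simp add: x_def)
qed

lemma has_sum_sum_finite:
  fixes f :: "'b \<Rightarrow> 'c \<Rightarrow> 'a::real_normed_vector"
  assumes "finite I" "\<And>i. i \<in> I \<Longrightarrow> (f i has_sum s i) A"
  shows "((\<lambda>a. \<Sum>i\<in>I. f i a) has_sum (\<Sum>i\<in>I. s i)) A"
  using assms by (induction I rule: finite_induct) (auto intro!: has_sum_add has_sum_0)

lemma sum_unity_roots_power:
  assumes "m > 0" shows "(\<Sum>\<zeta>\<in>unity_roots m. \<zeta> ^ j) = (if m dvd j then of_nat m else 0)"
proof -
  have "(\<Sum>\<zeta>\<in>unity_roots m. \<zeta> ^ j) = (\<Sum>\<zeta>\<in>unity_roots m. \<zeta> ^ (j mod m) * cnj \<zeta> ^ 0)"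
  proof (intro sum.cong refl)
    fix \<zeta> assume "\<zeta> \<in> unity_roots m"
    then have "\<zeta> ^ (m * (j div m)) * \<zeta> ^ (j mod m) = \<zeta> ^ (j mod m)"
      by (simp add: unity_roots_def power_mult)
    then have "\<zeta> ^ j = \<zeta> ^ (j mod m)" by (simp flip: power_add)
    then show "\<zeta> ^ j = \<zeta> ^ (j mod m) * cnj \<zeta> ^ 0" by simp
  qed
  also have "\<dots> = (if j mod m = 0 then of_nat m else 0)"
    using assms by (intro sum_unity_roots_orthogonal) auto
  finally show ?thesis by (simp add: dvd_eq_mod_eq_0)
qed

text \<open>The multi-index series converges unconditionally and may be grouped by degree; the
  dilation by u contributes u^j in degree j.\<close>

lemma hom_part_expansion:
  assumes x: "bhol_coeffs n (x :: _ \<Rightarrow> 'a::complex_normed_vector_space)" and z: "z \<in> polydisk n 1" and u: "cmod u \<le> 1"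
  obtains s where "norm s \<le> 1" "((\<lambda>j. cscale (u ^ j) (hom_part n x z j)) has_sum s) UNIV"
proof -
  define g where "g \<alpha> = cscale (monom n (\<lambda>i. u * z i) \<alpha>) (x \<alpha>)" for \<alpha>
  define s where "s = infsum g (multi_idx n)"
  have "(\<lambda>i. u * z i) \<in> polydisk n 1"
    unfolding polydisk_def
  proof safe
    fix i assume "i < n"
    then have "cmod (z i) < 1" using z by (simp add: polydisk_def)
    moreover have "cmod u * cmod (z i) \<le> 1 * cmod (z i)" using u by (intro mult_right_mono) auto
    ultimately show "cmod (u * z i) < 1" by (simp add: norm_mult)
  qed
  with x have sum: "g summable_on multi_idx n" and s1: "norm s \<le> 1"
    unfolding bhol_coeffs_def g_def s_def by auto
  have bij: "bij_betw snd (Sigma UNIV (hom_idx n)) (multi_idx n)"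
    by (rule bij_betwI[where g = "\<lambda>\<alpha>. (mi_deg n \<alpha>, \<alpha>)"]) (auto simp: hom_idx_def)
  have "((\<lambda>a. g (snd a)) has_sum s) (Sigma UNIV (hom_idx n))"
    unfolding has_sum_reindex_bij_betw[OF bij] s_def using sum by (rule has_sum_infsum)
  moreover have "((\<lambda>\<alpha>. g (snd (j, \<alpha>))) has_sum cscale (u ^ j) (hom_part n x z j)) (hom_idx n j)" for j
  proof -
    have "(\<Sum>\<alpha>\<in>hom_idx n j. g \<alpha>) = cscale (u ^ j) (hom_part n x z j)"
      unfolding g_def hom_part_def cscale_sum_right cscale_cscale by (intro sum.cong) (auto simp: monom_scale)
    then show ?thesis using has_sum_finite[of "hom_idx n j" g] by simp
  qed
  ultimately have "((\<lambda>j. cscale (u ^ j) (hom_part n x z j)) has_sum s) UNIV"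
    by (rule has_sum_SigmaD)
  with s1 show thesis using that by blast
qed

text \<open>Averaging \<open>f(\<zeta> u z)\<close> over \<open>\<zeta>\<^sup>m = 1\<close> leaves a bounded function of \<open>w = u\<^sup>m\<close> with linear
  coefficient \<open>hom_part n x z m\<close>, so the one-variable hypothesis bounds every homogeneous part
  without a loss growing with \<open>m\<close>.\<close>
lemma hom_part_bound:
  fixes x :: "(nat \<Rightarrow> nat) \<Rightarrow> 'a::complex_normed_vector_space"
  assumes r0: "r0 > 0" "ereal r0 < RX p q 1 TYPE('a)" and q: "q \<ge> 1"
    and x: "bhol_coeffs n x" and z: "z \<in> polydisk n 1" and m: "m \<ge> 1"
  shows "norm (x (\<lambda>_. 0)) powr p + (r0 * norm (hom_part n x z m)) powr q \<le> 1"
proof -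
  define y where "y l = hom_part n x z (l * m)" for l
  have "norm (y 0) powr p + (r0 * norm (y 1)) powr q \<le> 1"
  proof (rule one_var_bound[OF r0 q])
    fix w :: complex assume w: "cmod w < 1"
    obtain u where u: "u ^ m = w"
    proof (cases "w = 0")
      case True
      then show ?thesis using that[of 0] m by simp
    next
      case False
      have "card {u. u ^ m = w} \<noteq> 0" using card_nth_roots[OF False] m by simp
      then show ?thesis using that by (metis (mono_tags) Collect_empty_eq card.empty)
    qed
    have u1: "cmod u < 1"
    proof (rule ccontr)
      assume "\<not> cmod u < 1"
      then have "1 \<le> cmod u ^ m" by (intro one_le_power) auto
      then show False using w by (simp add: u[symmetric] norm_power)
    qed
    have m0: "m > 0" using m by simp
    have "\<exists>s. norm s \<le> 1 \<and> ((\<lambda>j. cscale ((\<zeta> * u) ^ j) (hom_part n x z j)) has_sum s) UNIV"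
      if "\<zeta> \<in> unity_roots m" for \<zeta>
    proof -
      have "cmod (\<zeta> * u) \<le> 1" using norm_unity_roots[OF m0 that] u1 by (simp add: norm_mult)
      from hom_part_expansion[OF x z this] show ?thesis by blast
    qed
    then obtain s where s: "\<And>\<zeta>. \<zeta> \<in> unity_roots m \<Longrightarrow> norm (s \<zeta>) \<le> 1"
      "\<And>\<zeta>. \<zeta> \<in> unity_roots m \<Longrightarrow> ((\<lambda>j. cscale ((\<zeta> * u) ^ j) (hom_part n x z j)) has_sum s \<zeta>) UNIV"
      by metis
    define t where "t = cscale (1 / of_nat m) (\<Sum>\<zeta>\<in>unity_roots m. s \<zeta>)"
    have "((\<lambda>j. \<Sum>\<zeta>\<in>unity_roots m. cscale ((\<zeta> * u) ^ j) (hom_part n x z j)) has_sum (\<Sum>\<zeta>\<in>unity_roots m. s \<zeta>)) UNIV"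
      using m0 s by (intro has_sum_sum_finite) auto
    then have "((\<lambda>j. cscale (1 / of_nat m) (\<Sum>\<zeta>\<in>unity_roots m. cscale ((\<zeta> * u) ^ j) (hom_part n x z j))) has_sum t) UNIV"
      unfolding t_def by (rule has_sum_bounded_linear[OF bounded_linear_cscale_right])
    moreover have "cscale (1 / of_nat m) (\<Sum>\<zeta>\<in>unity_roots m. cscale ((\<zeta> * u) ^ j) (hom_part n x z j))
       = (if m dvd j then cscale (u ^ j) (hom_part n x z j) else 0)" for j
    proof -
      have "(\<Sum>\<zeta>\<in>unity_roots m. cscale ((\<zeta> * u) ^ j) (hom_part n x z j)) = cscale ((\<Sum>\<zeta>\<in>unity_roots m. \<zeta> ^ j) * u ^ j) (hom_part n x z j)"
        by (simp add: power_mult_distrib sum_distrib_right flip: cscale_sum_left)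
      then show ?thesis using m0 by (simp add: sum_unity_roots_power cscale_cscale)
    qed
    ultimately have "((\<lambda>j. if m dvd j then cscale (u ^ j) (hom_part n x z j) else 0) has_sum t) UNIV" by simp
    then have "((\<lambda>j. cscale (u ^ j) (hom_part n x z j)) has_sum t) {j. m dvd j}"
      by (subst has_sum_cong_neutral[where S = "{j. m dvd j}" and T = UNIV
            and g = "\<lambda>j. if m dvd j then cscale (u ^ j) (hom_part n x z j) else 0"]) auto
    moreover have "bij_betw (\<lambda>l. l * m) UNIV {j. m dvd j}"
      by (rule bij_betwI[where g = "\<lambda>j. j div m"]) (use m0 in auto)
    ultimately have "((\<lambda>l. cscale (u ^ (l * m)) (hom_part n x z (l * m))) has_sum t) UNIV"
      by (subst has_sum_reindex_bij_betw[of "\<lambda>l. l * m" UNIV "{j. m dvd j}" "\<lambda>j. cscale (u ^ j) (hom_part n x z j)"])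
    moreover have "u ^ (l * m) = w ^ l" for l
      unfolding u[symmetric] power_mult[symmetric] by (simp add: mult.commute)
    ultimately have hs: "((\<lambda>l. cscale (w ^ l) (y l)) has_sum t) UNIV" by (simp add: y_def)
    have "norm t \<le> 1 / real m * (\<Sum>\<zeta>\<in>unity_roots m. norm (s \<zeta>))"
      unfolding t_def norm_cscale by (intro mult_mono) (auto simp: norm_divide norm_sum)
    also have "\<dots> \<le> 1 / real m * (\<Sum>\<zeta>\<in>unity_roots m. 1)"
      by (intro mult_left_mono sum_mono s) auto
    also have "\<dots> = 1" using m0 by simp
    finally have "norm t \<le> 1" .
    then show "(\<lambda>l. cscale (w ^ l) (y l)) summable_on UNIV \<and> norm (\<Sum>\<^sub>\<infinity>l. cscale (w ^ l) (y l)) \<le> 1"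
      using hs has_sum_imp_summable infsumI by fastforce
  qed
  moreover have "y 0 = x (\<lambda>_. 0)" by (simp add: y_def hom_part_def hom_idx_0 monom_def cscale_one)
  ultimately show ?thesis by (simp add: y_def)
qed

section \<open>The lower bound for the Bohr radius\<close>

lemma hom_poly_bound_closure:
  assumes "\<And>z. z \<in> polydisk n 1 \<Longrightarrow> cmod (hom_poly n m c z) \<le> D" and z: "z \<in> cpolydisk n"
  shows "cmod (hom_poly n m c z) \<le> D"
proof -
  \<comment> \<open>The points t z with t < 1 lie in the open polydisk, and homogeneity gives P(t z)
    = t^m P(z). The limit t -> 1 therefore needs no continuity of P.\<close>
  define t where "t = (\<lambda>k. 1 - 1 / real (Suc k))"
  have t: "0 \<le> t k" "t k < 1" for k by (auto simp: t_def)
  have le: "t k ^ m * cmod (hom_poly n m c z) \<le> D" for k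
  proof -
    have "(\<lambda>i. of_real (t k) * z i) \<in> polydisk n 1"
      unfolding polydisk_def
    proof safe
      fix i assume "i < n"
      then have "t k * cmod (z i) \<le> t k * 1" using z t by (intro mult_left_mono) (auto simp: cpolydisk_def)
      then show "cmod (of_real (t k) * z i) < 1" using t[of k] by (simp add: norm_mult)
    qed
    from assms(1)[OF this] show ?thesis using t by (simp add: hom_poly_scale norm_mult norm_power)
  qed
  have "t \<longlonglongrightarrow> 1" unfolding t_def by real_asymp
  then have "(\<lambda>k. t k ^ m * cmod (hom_poly n m c z)) \<longlonglongrightarrow> 1 ^ m * cmod (hom_poly n m c z)"
    by (intro tendsto_intros)
  from LIMSEQ_le_const2[OF this] le show ?thesis by auto
qed

text \<open>Let s be the q-th root of 1 - \<open>N\<close>, the amount that the Bohr sum may reach.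
  The homogeneous parts are at most s / r0. As both scale with s, it is enough that the coefficient
  sums of normalised polynomials fall below a constant of the space.\<close>

lemma RX_lower_bound:
  fixes p q \<epsilon> :: real
  assumes q: "q \<ge> 1"
    and fd: "complex_fin_dim TYPE('a::complex_normed_vector_space)"
    and R: "RX p q 1 TYPE('a) > 0" and eps: "0 < \<epsilon>" "\<epsilon> < 1"
  shows "\<forall>\<^sub>F n in sequentially. ereal ((1 - \<epsilon>) * sqrt (ln n / n)) \<le> RX p q n TYPE('a)"
proof -
  obtain r0 where r0: "r0 > 0" "ereal r0 < RX p q 1 TYPE('a)"
    using ereal_dense2[OF R] by (auto simp: zero_ereal_def)
  obtain B :: "'a set" and \<phi> :: "'a \<Rightarrow> 'a \<Rightarrow> complex" and C :: real where
    B: "finite B" and C: "C > 0" and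
    phi: "\<forall>b x y. \<phi> b (x + y) = \<phi> b x + \<phi> b y" "\<forall>b a x. \<phi> b (cscale a x) = a * \<phi> b x"
      "\<forall>b x. cmod (\<phi> b x) \<le> C * norm x" "\<forall>x. norm x \<le> C * (\<Sum>b\<in>B. cmod (\<phi> b x))"
    by (rule finite_dim_functionals[OF fd])
  note add = phi(1)[rule_format] and scale = phi(2)[rule_format]
    and bd = phi(3)[rule_format] and nrm = phi(4)[rule_format]
  have phi0: "\<phi> b 0 = 0" for b using add[of b 0 0] by simp
  have phi_sum: "\<phi> b (\<Sum>i\<in>I. f i) = (\<Sum>i\<in>I. \<phi> b (f i))" for b f and I :: "(nat \<Rightarrow> nat) set"
    by (induction I rule: infinite_finite_induct) (auto simp: phi0 add)
  \<comment> \<open>Collects the losses in X: C for reconstruction from coordinates, and for each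
    functional a coordinate polynomial of size C / r0 relative to s.\<close>
  define G where "G = C * (real (card B) * (C / r0))"
  have G: "G \<ge> 0" using C r0 by (simp add: G_def)
  define \<delta> where "\<delta> = 1 / (G + 1)"
  have del: "\<delta> > 0" "G * \<delta> \<le> 1" using G by (auto simp: \<delta>_def field_simps)
  show ?thesis
    using weighted_coeff_sums_small[OF eps del(1)] eventually_ge_at_top[of 1]
  proof eventually_elim
    case (elim n)
    define r where "r = (1 - \<epsilon>) * sqrt (ln n / n)"
    have r: "r \<ge> 0" using eps elim(2) by (simp add: r_def)
    obtain b where b: "summable b" "suminf b \<le> \<delta>" and
      b_bd: "\<And>m c. (\<And>z. z \<in> cpolydisk n \<Longrightarrow> cmod (hom_poly n (Suc m) c z) \<le> 1) \<Longrightarrow>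
       r ^ Suc m * (\<Sum>\<alpha>\<in>hom_idx n (Suc m). cmod (c \<alpha>)) \<le> b m"
      using elim(1) unfolding r_def by blast
    show ?case
      unfolding RX_def
    proof (rule Inf_greatest)
      fix R assume "R \<in> {Rf p q n x |x::(nat \<Rightarrow> nat) \<Rightarrow> 'a. bhol_coeffs n x}"
      then obtain x :: "(nat \<Rightarrow> nat) \<Rightarrow> 'a" where R: "R = Rf p q n x" and x: "bhol_coeffs n x" by auto
      define N where "N = norm (x (\<lambda>_. 0)) powr p"
      have hp: "N + (r0 * norm (hom_part n x z m)) powr q \<le> 1" if "z \<in> polydisk n 1" "m \<ge> 1" for z m
        unfolding N_def by (rule hom_part_bound[OF r0 q x that])
      have "(\<lambda>_. 0) \<in> polydisk n 1" by (simp add: polydisk_def)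
      from hp[OF this order_refl] have N1: "N \<le> 1" by (rule order_trans[rotated]) simp
      define s where "s = (1 - N) powr (1 / q)"
      have s: "s \<ge> 0" by (simp add: s_def)
      have sq: "s powr q = 1 - N" using N1 q by (simp add: s_def powr_powr)
      have hps: "norm (hom_part n x z m) \<le> s / r0" if "z \<in> polydisk n 1" "m \<ge> 1" for z m
      proof -
        have "(r0 * norm (hom_part n x z m)) powr q \<le> 1 - N" using hp[OF that] by simp
        then have "((r0 * norm (hom_part n x z m)) powr q) powr (1 / q) \<le> s"
          unfolding s_def using q by (intro powr_mono2) auto
        then show ?thesis using q r0 by (simp add: powr_powr field_simps)
      qed
      \<comment> \<open>If \<open>x (\<lambda>_. 0)\<close> has norm 1 then s = 0 and normalising by
        s is impossible. An arbitrary s' > s is used instead and lowered to s at the end.\<close>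
      have hn: "hom_norm n x z (Suc m) \<le> s' * G * b m" if z: "z \<in> polydisk n r" and s': "s' > s" for z m s'
      proof -
        have coeff: "r ^ Suc m * (\<Sum>\<alpha>\<in>hom_idx n (Suc m). cmod (\<phi> e (x \<alpha>))) \<le> C / r0 * s' * b m" for e
        proof -
          define D where "D = C / r0 * s'"
          have D: "D > 0" using C r0 s s' by (simp add: D_def)
          define c where "c \<alpha> = \<phi> e (x \<alpha>) / of_real D" for \<alpha>
          have "cmod (hom_poly n (Suc m) c w) \<le> 1" if w: "w \<in> cpolydisk n" for w
          proof (rule hom_poly_bound_closure[OF _ w])
            fix w assume w: "w \<in> polydisk n 1"
            have "hom_poly n (Suc m) c w = \<phi> e (hom_part n x w (Suc m)) / of_real D"
              unfolding hom_poly_def hom_part_def phi_sum c_def scale sum_divide_distrib by (simp add: mult.commute)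
            moreover have "cmod (\<phi> e (hom_part n x w (Suc m))) \<le> D"
            proof -
              have "cmod (\<phi> e (hom_part n x w (Suc m))) \<le> C * norm (hom_part n x w (Suc m))" by (rule bd)
              also have "\<dots> \<le> C * (s / r0)" using C hps[OF w, of "Suc m"] by (intro mult_left_mono) auto
              also have "\<dots> \<le> D" using s' C r0 by (simp add: D_def field_simps)
              finally show ?thesis .
            qed
            ultimately show "cmod (hom_poly n (Suc m) c w) \<le> 1" using D by (simp add: norm_divide)
          qed
          from b_bd[OF this] have "r ^ Suc m * (\<Sum>\<alpha>\<in>hom_idx n (Suc m). cmod (\<phi> e (x \<alpha>)) / D) \<le> b m"
            using D by (simp add: c_def norm_divide)
          then have "r ^ Suc m * (\<Sum>\<alpha>\<in>hom_idx n (Suc m). cmod (\<phi> e (x \<alpha>))) / D \<le> b m"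
            by (simp add: sum_divide_distrib[symmetric])
          then have "r ^ Suc m * (\<Sum>\<alpha>\<in>hom_idx n (Suc m). cmod (\<phi> e (x \<alpha>))) \<le> D * b m"
            using D by (simp add: pos_divide_le_eq mult.commute)
          then show ?thesis by (simp only: D_def)
        qed
        have "hom_norm n x z (Suc m) \<le> (\<Sum>\<alpha>\<in>hom_idx n (Suc m). r ^ Suc m * norm (x \<alpha>))"
          unfolding hom_norm_def hom_idx_def[symmetric] norm_cscale
          by (intro sum_mono mult_right_mono norm_monom_le) (use z in \<open>auto simp: polydisk_def less_imp_le\<close>)
        also have "\<dots> \<le> (\<Sum>\<alpha>\<in>hom_idx n (Suc m). r ^ Suc m * (C * (\<Sum>e\<in>B. cmod (\<phi> e (x \<alpha>)))))"
          using r by (intro sum_mono mult_left_mono nrm) auto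
        also have "\<dots> = C * (\<Sum>e\<in>B. r ^ Suc m * (\<Sum>\<alpha>\<in>hom_idx n (Suc m). cmod (\<phi> e (x \<alpha>))))"
          unfolding sum_distrib_left by (subst sum.swap) (simp add: mult_ac)
        also have "\<dots> \<le> C * (\<Sum>e\<in>B. C / r0 * s' * b m)"
          using C by (intro mult_left_mono sum_mono coeff) auto
        also have "\<dots> = s' * G * b m" by (simp add: G_def mult_ac)
        finally show ?thesis .
      qed
      have "r \<in> {r. r \<ge> 0 \<and> (\<forall>z\<in>polydisk n r. summable (\<lambda>k. hom_norm n x z (Suc k)) \<and>
         norm (x (\<lambda>_. 0)) powr p + (\<Sum>k. hom_norm n x z (Suc k)) powr q \<le> 1)}"
      proof (intro CollectI conjI ballI r)
        fix z assume z: "z \<in> polydisk n r"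
        have nn: "hom_norm n x z k \<ge> 0" for k by (simp add: hom_norm_def sum_nonneg)
        show sm: "summable (\<lambda>k. hom_norm n x z (Suc k))"
          by (rule summable_comparison_test'[OF summable_mult[OF b(1)], of 0 _ "(s + 1) * G"])
            (use hn[OF z, of "s + 1"] nn in auto)
        have "(\<Sum>k. hom_norm n x z (Suc k)) \<le> s'" if s': "s' > s" for s'
        proof -
          have "(\<Sum>k. hom_norm n x z (Suc k)) \<le> (\<Sum>k. s' * G * b k)"
            by (intro suminf_le hn[OF z s'] sm summable_mult b(1))
          also have "\<dots> = s' * G * suminf b" by (rule suminf_mult[OF b(1)])
          also have "\<dots> \<le> s' * G * \<delta>" using s s' G b(2) by (intro mult_left_mono) auto
          also have "\<dots> = s' * (G * \<delta>)" by simp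
          also have "\<dots> \<le> s' * 1" using s s' del(2) by (intro mult_left_mono) auto
          finally show ?thesis by simp
        qed
        then have "(\<Sum>k. hom_norm n x z (Suc k)) \<le> s" by (rule dense_ge)
        then have "(\<Sum>k. hom_norm n x z (Suc k)) powr q \<le> s powr q"
          using q nn by (intro powr_mono2 suminf_nonneg sm) auto
        then show "norm (x (\<lambda>_. 0)) powr p + (\<Sum>k. hom_norm n x z (Suc k)) powr q \<le> 1"
          unfolding sq N_def by simp
      qed
      then show "ereal ((1 - \<epsilon>) * sqrt (ln n / n)) \<le> R"
        unfolding R Rf_def r_def[symmetric] by (intro Sup_upper imageI)
    qed
  qed
qed

section \<open>Polynomials with random signs\<close>

text \<open>A crude form of cosh x \<le> exp(x^2 / 2); the constant lost here disappears under the
  m-th root.\<close>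

lemma exp_add_exp_minus_le: "exp x + exp (- x) \<le> 2 * exp (x ^ 2 :: real)"
proof -
  have *: "exp x + exp (- x) \<le> 2 * exp (x ^ 2)" if x: "x \<ge> 0" for x :: real
  proof (cases "x \<le> 1")
    case True
    have "exp x \<le> 1 + x + x ^ 2" using exp_bound[OF x True] .
    moreover have "exp (- x) \<le> 1 - x + x ^ 2"
    proof -
      have "1 * 1 \<le> (1 - x + x ^ 2) * (1 + x)" using x by (simp add: algebra_simps power2_eq_square)
      also have "\<dots> \<le> (1 - x + x ^ 2) * exp x"
      proof (rule mult_left_mono)
        show "1 + x \<le> exp x" by simp
        show "0 \<le> 1 - x + x ^ 2" using True by simp
      qed
      finally show ?thesis by (simp add: exp_minus field_simps)
    qed
    moreover have "1 + x ^ 2 \<le> exp (x ^ 2)" by simp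
    ultimately show ?thesis by linarith
  next
    case False
    then have "x * 1 \<le> x * x" by (intro mult_left_mono) auto
    then have "exp x \<le> exp (x ^ 2)" by (simp add: power2_eq_square)
    moreover have "exp (- x) \<le> exp (x ^ 2)" using x by (simp add: order_trans[of _ 0])
    ultimately show ?thesis by linarith
  qed
  show ?thesis using *[of x] *[of "- x"] by (cases "x \<ge> 0") auto
qed

definition signs :: "'x set \<Rightarrow> ('x \<Rightarrow> real) set" where
  "signs H = PiE H (\<lambda>_. {1, -1})"

text \<open>Independence of the signs is the factorisation of a sum over a product set; each factor
  is twice a hyperbolic cosine.\<close>

lemma sum_signs_exp_le:
  assumes H: "finite H" and a: "\<And>\<alpha>. \<alpha> \<in> H \<Longrightarrow> \<bar>a \<alpha>\<bar> \<le> 1"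
  shows "(\<Sum>\<epsilon>\<in>signs H. exp (t * (\<Sum>\<alpha>\<in>H. \<epsilon> \<alpha> * a \<alpha>))) \<le> real (card (signs H)) * exp (t ^ 2 * card H)"
proof -
  have "(\<Sum>\<epsilon>\<in>signs H. exp (t * (\<Sum>\<alpha>\<in>H. \<epsilon> \<alpha> * a \<alpha>))) = (\<Sum>\<epsilon>\<in>signs H. \<Prod>\<alpha>\<in>H. exp (\<epsilon> \<alpha> * (t * a \<alpha>)))"
    using H by (simp add: exp_sum[symmetric] sum_distrib_left mult_ac)
  also have "\<dots> = (\<Prod>\<alpha>\<in>H. \<Sum>s\<in>{1, -1}. exp (s * (t * a \<alpha>)))"
    unfolding signs_def by (rule prod_sum_PiE[symmetric]) (use H in auto)
  also have "\<dots> = (\<Prod>\<alpha>\<in>H. exp (t * a \<alpha>) + exp (- (t * a \<alpha>)))" by simp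
  also have "\<dots> \<le> (\<Prod>\<alpha>\<in>H. 2 * exp (t ^ 2))"
  proof (intro prod_mono conjI)
    fix \<alpha> assume "\<alpha> \<in> H"
    have "exp (t * a \<alpha>) + exp (- (t * a \<alpha>)) \<le> 2 * exp ((t * a \<alpha>) ^ 2)" by (rule exp_add_exp_minus_le)
    also have "(t * a \<alpha>) ^ 2 \<le> t ^ 2 * 1"
      unfolding power_mult_distrib using a[OF \<open>\<alpha> \<in> H\<close>] by (intro mult_left_mono) (auto simp: abs_square_le_1)
    finally show "exp (t * a \<alpha>) + exp (- (t * a \<alpha>)) \<le> 2 * exp (t ^ 2)" by simp
  qed (simp add: add_nonneg_nonneg)
  also have "\<dots> = real (card (signs H)) * exp (t ^ 2 * card H)"
    using H by (simp add: signs_def card_PiE power_mult_distrib exp_of_nat2_mult)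
  finally show ?thesis .
qed

section \<open>Discretising the polydisk\<close>

lemma hom_poly_lipschitz:
  assumes B: "\<And>z. z \<in> cpolydisk n \<Longrightarrow> cmod (hom_poly n m c z) \<le> B"
    and z: "z \<in> cpolydisk n" and z': "z' \<in> cpolydisk n"
    and d: "\<delta> > 0" "\<And>i. i < n \<Longrightarrow> cmod (z i - z' i) \<le> \<delta>" and m: "m \<ge> 1"
  shows "cmod (hom_poly n m c z - hom_poly n m c z') \<le> \<delta> * (exp 1 * m * B)"
proof -
  obtain d where md: "m = Suc d" using m by (cases m) auto
  define h where "h t = hom_poly n (Suc d) c (\<lambda>i. z' i + t * (z i - z' i))" for t
  define h' where "h' t = (\<Sum>j<n. (z j - z' j) * hom_poly n d (partial_coeffs j c) (\<lambda>i. z' i + t * (z i - z' i)))" for t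
  have "cmod (h 1 - h 0) \<le> \<delta> * (exp 1 * m * B) * norm (1 - 0 :: complex)"
  proof (rule field_differentiable_bound[where S = "closed_segment 0 1" and f' = h'])
    show "(h has_field_derivative h' t) (at t within closed_segment 0 1)" for t
      unfolding h_def h'_def by (rule has_field_derivative_at_within[OF hom_poly_has_field_derivative])
    fix t :: complex assume "t \<in> closed_segment 0 1"
    then obtain s where s: "0 \<le> s" "s \<le> 1" "t = of_real s"
      by (auto simp: closed_segment_def scaleR_conv_of_real)
    have mem: "(\<lambda>i. z' i + t * (z i - z' i)) \<in> cpolydisk n"
      unfolding cpolydisk_def
    proof safe
      fix i assume i: "i < n"
      have "z' i + t * (z i - z' i) = of_real (1 - s) * z' i + of_real s * z i"
        by (simp add: s algebra_simps)
      also have "cmod \<dots> \<le> (1 - s) * cmod (z' i) + s * cmod (z i)"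
        using s norm_triangle_ineq[of "of_real (1 - s) * z' i" "of_real s * z i"] by (simp add: norm_mult del: of_real_diff)
      also have "\<dots> \<le> (1 - s) * 1 + s * 1"
        using s z z' i by (intro add_mono mult_left_mono) (auto simp: cpolydisk_def)
      finally show "cmod (z' i + t * (z i - z' i)) \<le> 1" by simp
    qed
    \<comment> \<open>The increment, rescaled by \<delta>, is an admissible direction for the
      gradient estimate.\<close>
    define w where "w i = (z i - z' i) / of_real \<delta>" for i
    have w: "w \<in> cpolydisk n" using d by (auto simp: cpolydisk_def w_def norm_divide)
    have "h' t = of_real \<delta> * (\<Sum>j<n. w j * hom_poly n d (partial_coeffs j c) (\<lambda>i. z' i + t * (z i - z' i)))"
      unfolding h'_def sum_distrib_left using d by (intro sum.cong) (auto simp: w_def)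
    moreover have "cmod (\<Sum>j<n. w j * hom_poly n d (partial_coeffs j c) (\<lambda>i. z' i + t * (z i - z' i))) \<le> exp 1 * Suc d * B"
      by (rule hom_poly_gradient_bound[OF _ mem w]) (use B md in auto)
    ultimately show "cmod (h' t) \<le> \<delta> * (exp 1 * m * B)"
      using d by (simp add: norm_mult md)
  qed auto
  then show ?thesis by (simp add: h_def md)
qed

text \<open>The intersection with the closed disk keeps net points in the polydisk, where monomials
  have modulus at most 1.\<close>

definition grid :: "nat \<Rightarrow> complex set" where
  "grid M = (\<lambda>(a, b). Complex (of_int a / M) (of_int b / M)) ` ({- int M..int M} \<times> {- int M..int M}) \<inter> cball 0 1"

lemma finite_grid [simp]: "finite (grid M)"
  by (simp add: grid_def)

lemma card_grid_le: "card (grid M) \<le> (2 * M + 1) ^ 2"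
proof -
  have "card (grid M) \<le> card ((\<lambda>(a, b). Complex (of_int a / M) (of_int b / M)) ` ({- int M..int M} \<times> {- int M..int M}))"
    unfolding grid_def by (rule card_mono) auto
  also have "\<dots> \<le> card ({- int M..int M} \<times> {- int M..int M})"
    by (rule card_image_le) auto
  also have "\<dots> = (2 * M + 1) ^ 2"
  proof -
    have "nat (int M + 1 + int M) = 2 * M + 1" by linarith
    then show ?thesis by (simp add: card_cartesian_product power2_eq_square del: nat_add_distrib)
  qed
  finally show ?thesis .
qed

text \<open>Rounding towards zero does not increase the modulus, so a rounded point of the disk
  remains in the disk.\<close>

lemma truncate_real:
  fixes x :: real
  assumes "M \<ge> (1::nat)" "\<bar>x\<bar> \<le> 1"
  obtains a :: int where "a \<in> {- int M..int M}" "\<bar>of_int a / M\<bar> \<le> \<bar>x\<bar>" "\<bar>x - of_int a / M\<bar> \<le> 1 / M"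
proof -
  have *: "\<exists>a::int. 0 \<le> a \<and> a \<le> int M \<and> of_int a / M \<le> y \<and> y - of_int a / M \<le> 1 / M"
    if y: "0 \<le> y" "y \<le> 1" for y :: real
  proof (intro exI[of _ "\<lfloor>M * y\<rfloor>"] conjI)
    have M: "real M > 0" using assms by simp
    show "0 \<le> \<lfloor>real M * y\<rfloor>" using y by simp
    have "real M * y \<le> real M * 1" using y by (intro mult_left_mono) auto
    then show "\<lfloor>real M * y\<rfloor> \<le> int M" by (simp add: floor_le_iff)
    have "of_int \<lfloor>real M * y\<rfloor> \<le> real M * y" by simp
    then show "of_int \<lfloor>real M * y\<rfloor> / real M \<le> y" using M by (simp add: field_simps)
    have "real M * y \<le> of_int \<lfloor>real M * y\<rfloor> + 1" by linarith
    then have "y \<le> (of_int \<lfloor>real M * y\<rfloor> + 1) / real M" using M by (simp add: pos_le_divide_eq mult.commute)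
    then show "y - of_int \<lfloor>real M * y\<rfloor> / real M \<le> 1 / real M" by (simp add: add_divide_distrib)
  qed
  obtain a :: int where a: "0 \<le> a" "a \<le> int M" "of_int a / M \<le> \<bar>x\<bar>" "\<bar>x\<bar> - of_int a / M \<le> 1 / M"
    using *[of "\<bar>x\<bar>"] assms by auto
  have a0: "of_int a / real M \<ge> 0" using a by simp
  show thesis
  proof (cases "x \<ge> 0")
    case True
    then show ?thesis using that[of a] a a0 by auto
  next
    case False
    then show ?thesis using that[of "- a"] a a0 by auto
  qed
qed

lemma grid_approx:
  assumes M: "M \<ge> 1" and w: "cmod w \<le> 1"
  shows "\<exists>w'\<in>grid M. cmod (w - w') \<le> 2 / M"
proof -
  have "\<bar>Re w\<bar> \<le> 1" "\<bar>Im w\<bar> \<le> 1" using w abs_Re_le_cmod[of w] abs_Im_le_cmod[of w] by linarith+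
  then obtain a b where a: "a \<in> {- int M..int M}" "\<bar>of_int a / M\<bar> \<le> \<bar>Re w\<bar>" "\<bar>Re w - of_int a / M\<bar> \<le> 1 / M"
    and b: "b \<in> {- int M..int M}" "\<bar>of_int b / M\<bar> \<le> \<bar>Im w\<bar>" "\<bar>Im w - of_int b / M\<bar> \<le> 1 / M"
    using truncate_real[OF M] by metis
  define w' where "w' = Complex (of_int a / M) (of_int b / M)"
  have "cmod w' \<le> cmod w"
    unfolding cmod_def w'_def using a(2)[unfolded abs_le_square_iff] b(2)[unfolded abs_le_square_iff]
    by (intro real_sqrt_le_mono add_mono) auto
  then have "w' \<in> grid M" using a(1) b(1) w by (auto simp: grid_def w'_def)
  moreover have "cmod (w - w') \<le> 2 / M"
    using cmod_le[of "w - w'"] a(3) b(3) by (simp add: w'_def)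
  ultimately show ?thesis by blast
qed

text \<open>Exponential moments with a union bound. W is the logarithm of four times the bound on
  the size of the net, so the union over net points and four directions costs a factor e^W, and the
  moment bound another e^W.\<close>

lemma random_signs_on_net:
  assumes m: "m \<ge> 1" and n: "n \<ge> 1" and M: "M \<ge> 1"
    and N: "N = real (card (hom_idx n m))" and W: "W = ln 4 + n * ln (real ((2 * M + 1) ^ 2))"
  obtains \<epsilon> where "\<epsilon> \<in> signs (hom_idx n m)"
    "\<forall>z\<in>PiE {..<n} (\<lambda>_. grid M). cmod (hom_poly n m (\<lambda>\<alpha>. of_real (\<epsilon> \<alpha>)) z) \<le> 4 * sqrt (W * N)"
proof -
  define H where "H = hom_idx n m"
  define Z where "Z = PiE {..<n} (\<lambda>_. grid M)"
  define U where "U = {1, -1, \<i>, -\<i>}"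
  define f where "f \<epsilon> z = hom_poly n m (\<lambda>\<alpha>. of_real (\<epsilon> \<alpha>)) z" for \<epsilon> z
  have H: "finite H" by (simp add: H_def)
  have finS: "finite (signs H)" unfolding signs_def using H by (intro finite_PiE) auto
  have finZ: "finite Z" unfolding Z_def by (intro finite_PiE) auto
  have finU: "finite U" "card U \<le> 4"
    using card_insert_le_m1 by (auto simp: U_def card_insert_if)
  have "N > 0"
  proof -
    have "n ^ m \<le> card (hom_idx n m) * fact m" by (rule card_hom_idx_lower[OF n])
    then have "card (hom_idx n m) \<noteq> 0" using n by (metis mult_0 not_less power_eq_0_iff le_zero_eq not_one_le_zero)
    then show ?thesis unfolding N by linarith
  qed
  have W0: "W > 0"
  proof -
    have "ln (real ((2 * M + 1) ^ 2)) \<ge> 0" by (intro ln_ge_zero) (simp add: one_le_power)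
    then show ?thesis by (simp add: W add_pos_nonneg)
  qed
  \<comment> \<open>Chosen so that t^2 N = W, which balances the variance term against the size of
    the net.\<close>
  define t where "t = sqrt (W / N)"
  have t: "t > 0" "t ^ 2 * N = W" "W / t = sqrt (W * N)"
    using W0 \<open>N > 0\<close> by (auto simp: t_def real_sqrt_mult real_sqrt_divide field_simps)
  have Zdisk: "cmod (z i) \<le> 1" if "z \<in> Z" "i < n" for z i
    using that by (auto simp: Z_def grid_def PiE_def Pi_def)
  have moment: "(\<Sum>\<epsilon>\<in>signs H. exp (t * Re (u * f \<epsilon> z))) \<le> real (card (signs H)) * exp W"
    if "z \<in> Z" "u \<in> U" for z u
  proof -
    have "Re (u * f \<epsilon> z) = (\<Sum>\<alpha>\<in>H. \<epsilon> \<alpha> * Re (u * monom n z \<alpha>))" for \<epsilon>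
      unfolding f_def hom_poly_def H_def sum_distrib_left Re_sum
      by (intro sum.cong refl) (simp add: mult.left_commute[of u])
    moreover have "\<bar>Re (u * monom n z \<alpha>)\<bar> \<le> 1" if "\<alpha> \<in> H" for \<alpha>
    proof -
      have "cmod (monom n z \<alpha>) \<le> 1 ^ m"
        by (rule norm_monom_le) (use Zdisk[OF \<open>z \<in> Z\<close>] that in \<open>auto simp: H_def\<close>)
      moreover have "cmod u = 1" using \<open>u \<in> U\<close> by (auto simp: U_def)
      ultimately show ?thesis using abs_Re_le_cmod[of "u * monom n z \<alpha>"] by (simp add: norm_mult)
    qed
    ultimately have "(\<Sum>\<epsilon>\<in>signs H. exp (t * Re (u * f \<epsilon> z))) \<le> real (card (signs H)) * exp (t ^ 2 * card H)"
      using sum_signs_exp_le[OF H, of "\<lambda>\<alpha>. Re (u * monom n z \<alpha>)" t] by simp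
    then show ?thesis using t(2) by (simp add: N H_def)
  qed
  \<comment> \<open>Some choice of signs has \<open>E\<close> at most the bound on its mean. As
    \<open>E\<close> dominates each of its exponentials, this one choice serves all net points and
    directions.\<close>
  define E where "E \<epsilon> = (\<Sum>(z, u)\<in>Z \<times> U. exp (t * Re (u * f \<epsilon> z)))" for \<epsilon>
  have "(\<Sum>\<epsilon>\<in>signs H. E \<epsilon>) \<le> real (card (signs H)) * (card (Z \<times> U) * exp W)"
  proof -
    have "(\<Sum>\<epsilon>\<in>signs H. E \<epsilon>) = (\<Sum>(z, u)\<in>Z \<times> U. \<Sum>\<epsilon>\<in>signs H. exp (t * Re (u * f \<epsilon> z)))"
      unfolding E_def by (subst sum.swap) (simp add: case_prod_beta)
    also have "\<dots> \<le> (\<Sum>(z, u)\<in>Z \<times> U. real (card (signs H)) * exp W)"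
      by (rule sum_mono) (use moment in auto)
    finally show ?thesis by (simp add: mult_ac)
  qed
  moreover have "card (signs H) > 0" using finS H by (simp add: signs_def card_PiE)
  ultimately obtain \<epsilon> where eps: "\<epsilon> \<in> signs H" "E \<epsilon> \<le> card (Z \<times> U) * exp W"
  proof -
    have "\<exists>\<epsilon>\<in>signs H. E \<epsilon> \<le> card (Z \<times> U) * exp W"
    proof (rule ccontr)
      assume "\<not> ?thesis"
      then have "(\<Sum>\<epsilon>\<in>signs H. card (Z \<times> U) * exp W) < (\<Sum>\<epsilon>\<in>signs H. E \<epsilon>)"
        using finS \<open>card (signs H) > 0\<close> by (intro sum_strict_mono) (auto simp: not_le)
      then show False using \<open>(\<Sum>\<epsilon>\<in>signs H. E \<epsilon>) \<le> _\<close> by simp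
    qed
    then show ?thesis using that by blast
  qed
  have cardZU: "real (card (Z \<times> U)) \<le> exp W"
  proof -
    have "card (Z \<times> U) \<le> ((2 * M + 1) ^ 2) ^ n * 4"
      unfolding card_cartesian_product Z_def using finU card_grid_le[of M]
      by (simp only: card_PiE finite_lessThan prod_constant card_lessThan) (intro mult_mono power_mono, auto)
    then have "real (card (Z \<times> U)) \<le> real ((2 * M + 1) ^ 2) ^ n * 4"
      by (metis of_nat_le_iff of_nat_mult of_nat_numeral of_nat_power)
    also have "\<dots> = exp W"
    proof -
      have "real ((2 * M + 1) ^ 2) > 0" by (simp del: of_nat_power)
      then show ?thesis unfolding W exp_add exp_of_nat_mult by (simp del: of_nat_power)
    qed
    finally show ?thesis .
  qed
  have re: "Re (u * f \<epsilon> z) \<le> 2 * sqrt (W * N)" if zu: "z \<in> Z" "u \<in> U" for z u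
  proof -
    have "exp (t * Re (u * f \<epsilon> z)) \<le> E \<epsilon>"
      unfolding E_def using member_le_sum[of "(z, u)" "Z \<times> U" "\<lambda>(z, u). exp (t * Re (u * f \<epsilon> z))"] zu finZ finU by auto
    also have "\<dots> \<le> exp W * exp W"
      using eps(2) cardZU by (meson exp_ge_zero mult_right_mono order_trans)
    finally have "t * Re (u * f \<epsilon> z) \<le> 2 * W" by (simp flip: exp_add)
    then have "Re (u * f \<epsilon> z) \<le> 2 * (W / t)" using t(1) by (simp add: field_simps)
    then show ?thesis by (simp add: t(3))
  qed
  have "cmod (f \<epsilon> z) \<le> 4 * sqrt (W * N)" if "z \<in> Z" for z
  proof -
    have "\<bar>Re (f \<epsilon> z)\<bar> \<le> 2 * sqrt (W * N)" using re[OF that, of 1] re[OF that, of "-1"] by (simp add: U_def)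
    moreover have "\<bar>Im (f \<epsilon> z)\<bar> \<le> 2 * sqrt (W * N)" using re[OF that, of \<i>] re[OF that, of "-\<i>"] by (simp add: U_def)
    ultimately show ?thesis using cmod_le[of "f \<epsilon> z"] by linarith
  qed
  then show thesis using that[of \<epsilon>] eps(1) by (auto simp: f_def Z_def H_def)
qed

text \<open>The Lipschitz constant on the polydisk contains the unknown supremum B. Moving to the
  net costs at most B / 2, so B is at most twice the bound on the net.\<close>

lemma random_polynomial:
  assumes m: "m \<ge> 1" and n: "n \<ge> 1"
  obtains c where "\<forall>\<alpha>\<in>hom_idx n m. cmod (c \<alpha>) = 1"
    "\<forall>z\<in>cpolydisk n. cmod (hom_poly n m c z) \<le> 8 * sqrt (2 * real n * ln (50 * real m) * card (hom_idx n m))"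
proof -
  \<comment> \<open>The distance 2/M = 1/(6m) to the net turns the Lipschitz constant e m B into an
    error (e/6) B \<le> B/2.\<close>
  define M where "M = 12 * m"
  define N where "N = real (card (hom_idx n m))"
  define W where "W = ln 4 + n * ln (real ((2 * M + 1) ^ 2))"
  have M: "M \<ge> 1" using m by (simp add: M_def)
  obtain \<epsilon> where eps: "\<epsilon> \<in> signs (hom_idx n m)"
    "\<forall>z\<in>PiE {..<n} (\<lambda>_. grid M). cmod (hom_poly n m (\<lambda>\<alpha>. of_real (\<epsilon> \<alpha>)) z) \<le> 4 * sqrt (W * N)"
    using random_signs_on_net[OF m n M N_def W_def] by metis
  define c where "c \<alpha> = complex_of_real (\<epsilon> \<alpha>)" for \<alpha>
  have c1: "cmod (c \<alpha>) = 1" if "\<alpha> \<in> hom_idx n m" for \<alpha>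
    using eps(1) that by (auto simp: signs_def c_def PiE_def Pi_def)
  define B where "B = (SUP z\<in>cpolydisk n. cmod (hom_poly n m c z))"
  have bdd: "bdd_above ((\<lambda>z. cmod (hom_poly n m c z)) ` cpolydisk n)"
  proof (rule bdd_aboveI2)
    fix z assume z: "z \<in> cpolydisk n"
    show "cmod (hom_poly n m c z) \<le> (\<Sum>\<alpha>\<in>hom_idx n m. 1)"
      unfolding hom_poly_def
    proof (rule sum_norm_le)
      fix \<alpha> assume a: "\<alpha> \<in> hom_idx n m"
      have "cmod (monom n z \<alpha>) \<le> 1 ^ m" by (rule norm_monom_le[OF _ a]) (use z in \<open>auto simp: cpolydisk_def\<close>)
      then show "cmod (c \<alpha> * monom n z \<alpha>) \<le> 1" using c1[OF a] by (simp add: norm_mult)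
    qed
  qed
  have le_B: "cmod (hom_poly n m c z) \<le> B" if "z \<in> cpolydisk n" for z
    unfolding B_def by (rule cSUP_upper[OF that bdd])
  have ne: "cpolydisk n \<noteq> {}"
  proof -
    have "(\<lambda>_. 0) \<in> cpolydisk n" by (simp add: cpolydisk_def)
    then show ?thesis by blast
  qed
  have B0: "B \<ge> 0"
  proof -
    obtain z where "z \<in> cpolydisk n" using ne by blast
    then show ?thesis using le_B norm_ge_zero order_trans by blast
  qed
  define X where "X = 4 * sqrt (W * N) + B / 2"
  have "B \<le> X"
    unfolding B_def
  proof (rule cSUP_least[OF ne])
    fix z assume z: "z \<in> cpolydisk n"
    have "\<exists>w'\<in>grid M. cmod (z i - w') \<le> 2 / M" if "i < n" for i
      using z that by (intro grid_approx[OF M]) (auto simp: cpolydisk_def)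
    then obtain w where w: "\<And>i. i < n \<Longrightarrow> w i \<in> grid M" "\<And>i. i < n \<Longrightarrow> cmod (z i - w i) \<le> 2 / M" by metis
    define z' where "z' = restrict w {..<n}"
    have z'Z: "z' \<in> PiE {..<n} (\<lambda>_. grid M)" using w by (auto simp: z'_def)
    have z'D: "z' \<in> cpolydisk n" using w(1) by (auto simp: z'_def cpolydisk_def grid_def)
    have "cmod (hom_poly n m c z - hom_poly n m c z') \<le> 2 / M * (exp 1 * m * B)"
      by (rule hom_poly_lipschitz[OF le_B z z'D]) (use M m w in \<open>auto simp: z'_def\<close>)
    also have "2 / M * (exp 1 * m * B) = exp 1 / 6 * B" using m by (simp add: M_def)
    also have "\<dots> \<le> B / 2" using exp_le B0 mult_right_mono[of "exp 1" 3 B] by (simp add: mult.commute)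
    finally have "cmod (hom_poly n m c z) \<le> cmod (hom_poly n m c z') + B / 2"
      using norm_triangle_sub[of "hom_poly n m c z" "hom_poly n m c z'"] by linarith
    also have "cmod (hom_poly n m c z') \<le> 4 * sqrt (W * N)" using eps(2) z'Z unfolding c_def by blast
    finally show "cmod (hom_poly n m c z) \<le> X" by (simp add: X_def)
  qed
  then have BW: "B \<le> 8 * sqrt (W * N)" by (simp add: X_def)
  \<comment> \<open>Here 2M + 1 = 24m + 1 \<le> 25m, and ln 4 is absorbed by doubling 25 to
    50.\<close>
  have "W \<le> 2 * real n * ln (50 * real m)"
  proof -
    have "ln (real ((2 * M + 1) ^ 2)) = 2 * ln (real (2 * M + 1))" by (simp add: ln_realpow)
    also have "\<dots> \<le> 2 * ln (25 * real m)" using m by (simp add: M_def)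
    finally have "n * ln (real ((2 * M + 1) ^ 2)) \<le> n * (2 * ln (25 * real m))" by (intro mult_left_mono) auto
    moreover have "ln 4 \<le> n * (2 * ln (2::real))"
    proof -
      have "ln (4::real) = ln (2 ^ 2)" by simp
      also have "\<dots> = 1 * (2 * ln 2)" by (subst ln_realpow) auto
      also have "\<dots> \<le> n * (2 * ln (2::real))" using n by (intro mult_right_mono) auto
      finally show ?thesis .
    qed
    moreover have "ln (50 * real m) = ln 2 + ln (25 * real m)" using m ln_mult[of 2 "25 * real m"] by simp
    ultimately show ?thesis by (simp add: W_def algebra_simps)
  qed
  then have WN: "8 * sqrt (W * N) \<le> 8 * sqrt (2 * real n * ln (50 * real m) * N)"
    by (intro mult_left_mono real_sqrt_le_mono mult_right_mono) (auto simp: N_def)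
  have "cmod (hom_poly n m c z) \<le> 8 * sqrt (2 * real n * ln (50 * real m) * N)" if "z \<in> cpolydisk n" for z
    using le_B[OF that] BW WN by linarith
  then show thesis using that[of c] c1 unfolding N_def by blast
qed

section \<open>The upper bound for the Bohr radius\<close>

lemma RX_upper_bound:
  fixes p q :: real
  assumes q: "q \<ge> 1" and m: "m \<ge> 1" and n: "n \<ge> 1" and v: "\<exists>v::'a::complex_normed_vector_space. v \<noteq> 0"
  shows "RX p q n TYPE('a) \<le> ereal ((8 * sqrt (2 * real n * ln (50 * real m) * (fact m / real n ^ m))) powr (1 / m))"
proof -
  define N where "N = real (card (hom_idx n m))"
  define B where "B = 8 * sqrt (2 * real n * ln (50 * real m) * N)"
  obtain c where c: "\<forall>\<alpha>\<in>hom_idx n m. cmod (c \<alpha>) = 1" "\<forall>z\<in>cpolydisk n. cmod (hom_poly n m c z) \<le> B"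
    unfolding B_def N_def by (rule random_polynomial[OF m n])
  have Nlow: "real n ^ m \<le> N * fact m"
    using card_hom_idx_lower[OF n, of m] unfolding N_def by (metis of_nat_fact of_nat_le_iff of_nat_mult of_nat_power)
  have N: "N > 0" proof -
    have "0 < real n ^ m" using n by simp
    with Nlow have "0 < N * fact m" by linarith
    then show ?thesis by (simp add: zero_less_mult_iff)
  qed
  have ln0: "ln (50 * real m) > 0" using m by simp
  have B: "B > 0" using N ln0 n by (simp add: B_def)
  obtain v0 :: 'a where "v0 \<noteq> 0" using v by blast
  define v where "v = scaleR (1 / norm v0) v0"
  have v1: "norm v = 1" using \<open>v0 \<noteq> 0\<close> by (simp add: v_def)
  \<comment> \<open>The test function is the random polynomial divided by B, times a unit vector; it
    consists of its degree-m part only.\<close>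
  define x where "x \<alpha> = (if \<alpha> \<in> hom_idx n m then cscale (c \<alpha> / of_real B) v else 0)" for \<alpha>
  have x: "bhol_coeffs n x"
    unfolding bhol_coeffs_def
  proof
    fix z assume "z \<in> polydisk n 1"
    then have z: "z \<in> cpolydisk n" by (auto simp: polydisk_def cpolydisk_def intro: less_imp_le)
    define s where "s = (\<Sum>\<alpha>\<in>hom_idx n m. cscale (monom n z \<alpha>) (x \<alpha>))"
    have "((\<lambda>\<alpha>. cscale (monom n z \<alpha>) (x \<alpha>)) has_sum s) (hom_idx n m)"
      unfolding s_def by (rule has_sum_finite) simp
    then have hs: "((\<lambda>\<alpha>. cscale (monom n z \<alpha>) (x \<alpha>)) has_sum s) (multi_idx n)"
      by (subst has_sum_cong_neutral[where T = "hom_idx n m" and g = "\<lambda>\<alpha>. cscale (monom n z \<alpha>) (x \<alpha>)"])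
        (auto simp: x_def hom_idx_def)
    have "s = cscale (hom_poly n m c z / of_real B) v"
    proof -
      have "s = (\<Sum>\<alpha>\<in>hom_idx n m. cscale (c \<alpha> * monom n z \<alpha> / of_real B) v)"
        unfolding s_def by (intro sum.cong refl) (simp add: x_def cscale_cscale mult.commute)
      then show ?thesis unfolding hom_poly_def sum_divide_distrib by (simp add: cscale_sum_left)
    qed
    then have "norm s \<le> 1" using c(2) z B v1 by (simp add: norm_cscale norm_divide)
    then show "(\<lambda>\<alpha>. cscale (monom n z \<alpha>) (x \<alpha>)) summable_on multi_idx n \<and>
        norm (\<Sum>\<^sub>\<infinity>\<alpha>\<in>multi_idx n. cscale (monom n z \<alpha>) (x \<alpha>)) \<le> 1"
      using hs has_sum_imp_summable infsumI by fastforce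
  qed
  have "RX p q n TYPE('a) \<le> Rf p q n x" unfolding RX_def using x by (intro Inf_lower) auto
  also have "\<dots> \<le> ereal ((B / N) powr (1 / m))"
    unfolding Rf_def
  proof (rule Sup_least, safe)
    fix r :: real
    assume r: "r \<ge> 0" and bd: "\<forall>z\<in>polydisk n r. summable (\<lambda>k. hom_norm n x z (Suc k)) \<and>
         norm (x (\<lambda>_. 0)) powr p + (\<Sum>k. hom_norm n x z (Suc k)) powr q \<le> 1"
    have "t \<le> (B / N) powr (1 / m)" if t: "0 < t" "t < r" for t
    proof -
      \<comment> \<open>On the diagonal every monomial of degree m equals t^m, so the moduli add up
        without cancellation to N t^m / B. Taking t < r keeps the point in the open polydisk; r is
        recovered from all such t.\<close>
      define z where "z = (\<lambda>_::nat. complex_of_real t)"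
      have "z \<in> polydisk n r" using t by (simp add: z_def polydisk_def)
      with bd have sm: "summable (\<lambda>k. hom_norm n x z (Suc k))"
        and le: "norm (x (\<lambda>_. 0)) powr p + (\<Sum>k. hom_norm n x z (Suc k)) powr q \<le> 1" by auto
      define S where "S = (\<Sum>k. hom_norm n x z (Suc k))"
      have nn: "hom_norm n x z k \<ge> 0" for k by (simp add: hom_norm_def sum_nonneg)
      have "(\<Sum>k\<in>{m - 1}. hom_norm n x z (Suc k)) \<le> S"
        unfolding S_def by (rule sum_le_suminf[OF sm]) (use nn in auto)
      then have "hom_norm n x z m \<le> S" using m by simp
      moreover have "S \<le> 1"
      proof (rule ccontr)
        assume "\<not> S \<le> 1"
        then have "1 powr q < S powr q" using q by (intro powr_less_mono2) auto
        moreover have "S powr q \<le> 1" using le by (simp add: S_def add_increasing) (smt (verit) powr_ge_zero)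
        ultimately show False by simp
      qed
      moreover have "hom_norm n x z m = N * t ^ m / B"
      proof -
        have "norm (cscale (monom n z \<alpha>) (x \<alpha>)) = t ^ m / B" if a: "\<alpha> \<in> hom_idx n m" for \<alpha>
        proof -
          have "monom n z \<alpha> = of_real t ^ m"
            using monom_scale[OF a, of "of_real t" "\<lambda>_. 1"] by (simp add: z_def monom_def)
          then show ?thesis using a c(1) t B v1 by (simp add: x_def norm_cscale norm_divide norm_power)
        qed
        then show ?thesis unfolding hom_norm_def hom_idx_def[symmetric] by (simp add: N_def)
      qed
      ultimately have "N * t ^ m / B \<le> 1" by linarith
      then have "t ^ m \<le> B / N" using B N by (simp add: field_simps)
      then have "(t ^ m) powr (1 / m) \<le> (B / N) powr (1 / m)" using t by (intro powr_mono2) auto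
      moreover have "(t ^ m) powr (1 / m) = t" using t m by (simp add: powr_powr flip: powr_realpow)
      ultimately show ?thesis by simp
    qed
    then have "r \<le> (B / N) powr (1 / m)" if "r > 0" using that by (intro dense_le_bounded[of 0 r])
    then show "ereal r \<le> ereal ((B / N) powr (1 / m))" using r by (cases "r = 0") auto
  qed
  also have "\<dots> \<le> ereal ((8 * sqrt (2 * real n * ln (50 * real m) * (fact m / real n ^ m))) powr (1 / m))"
    unfolding ereal_less_eq
  proof (rule powr_mono2)
    \<comment> \<open>The supremum bound grows only like the square root of N, so the quotient
      behaves like N^(-1/2) and the lower bound on N applies.\<close>
    have "B / N = 8 * sqrt (2 * real n * ln (50 * real m) * (1 / N))"
    proof -
      have "sqrt N * sqrt N = N" using N by simp
      then have *: "sqrt N / N = 1 / sqrt N" using N by (simp add: field_simps)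
      have "B / N = 8 * sqrt (2 * real n * ln (50 * real m)) * (sqrt N / N)"
        unfolding B_def real_sqrt_mult[of _ N] by simp
      then show ?thesis unfolding * real_sqrt_mult[of _ "1 / N"] by (simp add: real_sqrt_divide)
    qed
    also have "\<dots> \<le> 8 * sqrt (2 * real n * ln (50 * real m) * (fact m / real n ^ m))"
    proof (intro mult_left_mono real_sqrt_le_mono)
      show "1 / N \<le> fact m / real n ^ m" using Nlow N n by (simp add: field_simps)
    qed (use ln0 in auto)
    finally show "B / N \<le> 8 * sqrt (2 * real n * ln (50 * real m) * (fact m / real n ^ m))" .
  qed (use B N in auto)
  finally show ?thesis .
qed

text \<open>Induction with e \<le> (1 + 1/m)^(m+1). The extra factor e m is immaterial, since it
  enters the radius under a 2m-th root.\<close>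

lemma fact_le_stirling: "m \<ge> 1 \<Longrightarrow> fact m \<le> exp 1 * real m * (real m / exp 1) ^ m"
proof (induction m rule: dec_induct)
  case base
  then show ?case by simp
next
  case (step m)
  then have m: "real m > 0" by simp
  have key: "exp 1 * real m ^ Suc m \<le> real (Suc m) ^ Suc m"
  proof -
    have "1 / real (Suc m) \<le> ln (1 + 1 / real m)"
    proof -
      have "ln (real m / real (Suc m)) \<le> real m / real (Suc m) - 1"
        using m by (intro ln_le_minus_one) auto
      moreover have "real m / real (Suc m) - 1 = - (1 / real (Suc m))" by (simp add: field_simps)
      moreover have "ln (1 + 1 / real m) = - ln (real m / real (Suc m))"
        using m by (simp add: ln_div add_divide_distrib[symmetric] field_simps flip: ln_inverse)
      ultimately show ?thesis by linarith
    qed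
    then have "exp (1 / real (Suc m)) \<le> 1 + 1 / real m"
      using m by (subst (asm) ln_ge_iff) (auto intro: add_pos_pos)
    then have "exp (1 / real (Suc m)) ^ Suc m \<le> (1 + 1 / real m) ^ Suc m" by (intro power_mono) auto
    moreover have "exp (1 / real (Suc m)) ^ Suc m = exp 1"
      by (subst exp_of_nat_mult[symmetric]) simp
    moreover have "(1 + 1 / real m) ^ Suc m * real m ^ Suc m = real (Suc m) ^ Suc m"
    proof -
      have "(1 + 1 / real m) * real m = real (Suc m)" using m by (simp add: field_simps)
      then show ?thesis by (simp only: power_mult_distrib[symmetric])
    qed
    moreover have "real m ^ Suc m \<ge> 0" by simp
    ultimately show ?thesis using mult_right_mono by metis
  qed
  have "fact (Suc m) = real (Suc m) * fact m" by simp
  also have "\<dots> \<le> real (Suc m) * (exp 1 * real m * (real m / exp 1) ^ m)"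
    using step.IH by (intro mult_left_mono) auto
  also have "\<dots> = real (Suc m) * (exp 1 * real m ^ Suc m) / exp 1 ^ m"
    by (simp add: power_divide mult_ac)
  also have "\<dots> \<le> real (Suc m) * real (Suc m) ^ Suc m / exp 1 ^ m"
    using key by (intro divide_right_mono mult_left_mono) auto
  also have "\<dots> = exp 1 * real (Suc m) * (real (Suc m) / exp 1) ^ Suc m"
    by (simp add: power_divide field_simps)
  finally show ?case .
qed

text \<open>For m at or just above log n, n^(1/(2m)) \<le> e^(1/2) cancels the e^(-1/2) coming from
  the factorial, and sqrt(n / log n) turns sqrt(m / n) into sqrt(m / log n). What remains depends on
  m alone.\<close>

lemma upper_bound_numeric:
  assumes n: "n \<ge> 3" and m: "m = nat \<lceil>ln (real n)\<rceil>"
  shows "(8 * sqrt (2 * real n * ln (50 * real m) * (fact m / real n ^ m))) powr (1 / m) * sqrt (n / ln n)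
    \<le> (128 * exp 1 * real m * ln (50 * real m)) powr (1 / (2 * m)) * sqrt (m / (real m - 1))"
proof -
  define L where "L = ln (real n)"
  have L: "L > 1"
  proof -
    have "exp 1 < (3::real)" using e_less_272 by simp
    also have "3 \<le> real n" using n by simp
    also have "real n = exp L" using n by (simp add: L_def)
    finally show ?thesis by simp
  qed
  have mL: "L \<le> m" "real m - 1 < L"
    unfolding m L_def[symmetric] using L by linarith+
  \<comment> \<open>This makes m - 1 positive, so it may replace L in a denominator.\<close>
  have m2: "real m > 1" using mL L by linarith
  \<comment> \<open>128 = 64 * 2: the factor 8 is moved under the square root and meets the 2
    already there.\<close>
  define G where "G = 128 * exp 1 * real m * ln (50 * real m)"
  have ln0: "ln (50 * real m) > 0" using m2 by simp
  have G: "G > 0" using ln0 m2 by (simp add: G_def)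
  have n0: "real n > 0" using n by simp
  define Y where "Y = G * (real n * (real m / (exp 1 * real n)) ^ m)"
  have Y0: "Y > 0" using G n0 m2 by (simp add: Y_def)
  have "8 * sqrt (2 * real n * ln (50 * real m) * (fact m / real n ^ m))
     \<le> 8 * sqrt (2 * real n * ln (50 * real m) * ((exp 1 * real m * (real m / exp 1) ^ m) / real n ^ m))"
    using fact_le_stirling[of m] m2 ln0
    by (intro mult_left_mono real_sqrt_le_mono divide_right_mono) auto
  also have "\<dots> = sqrt Y"
  proof -
    have "8 = sqrt (64::real)" by simp
    then have "8 * sqrt (2 * real n * ln (50 * real m) * ((exp 1 * real m * (real m / exp 1) ^ m) / real n ^ m))
      = sqrt (64 * (2 * real n * ln (50 * real m) * ((exp 1 * real m * (real m / exp 1) ^ m) / real n ^ m)))"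
      by (simp only: real_sqrt_mult)
    also have "64 * (2 * real n * ln (50 * real m) * ((exp 1 * real m * (real m / exp 1) ^ m) / real n ^ m)) = Y"
      by (simp add: Y_def G_def power_divide power_mult_distrib)
    finally show ?thesis .
  qed
  finally have "(8 * sqrt (2 * real n * ln (50 * real m) * (fact m / real n ^ m))) powr (1 / m) \<le> sqrt Y powr (1 / m)"
    using ln0 by (intro powr_mono2) auto
  also have "\<dots> = Y powr (1 / (2 * m))"
    using Y0 by (simp add: powr_half_sqrt[symmetric] powr_powr mult.commute)
  also have "\<dots> = G powr (1 / (2 * m)) * (real n powr (1 / (2 * m)) * sqrt (real m / (exp 1 * real n)))"
  proof -
    have "((real m / (exp 1 * real n)) ^ m) powr (1 / (2 * m)) = sqrt (real m / (exp 1 * real n))"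
    proof -
      have pos: "real m / (exp 1 * real n) > 0" using m2 n0 by simp
      have "((real m / (exp 1 * real n)) ^ m) powr (1 / (2 * m)) = (real m / (exp 1 * real n)) powr (m * (1 / (2 * m)))"
        using pos by (simp only: powr_realpow[symmetric] powr_powr)
      also have "m * (1 / (2 * m)) = 1 / (2::real)" using m2 by simp
      finally show ?thesis using pos by (simp add: powr_half_sqrt)
    qed
    then show ?thesis using G n0 m2 by (simp add: Y_def powr_mult)
  qed
  also have "\<dots> \<le> G powr (1 / (2 * m)) * (sqrt (exp 1) * sqrt (real m / (exp 1 * real n)))"
  proof (intro mult_left_mono mult_right_mono)
    have "real n powr (1 / (2 * m)) = exp (L / (2 * m))" using n0 by (simp add: powr_def L_def)
    also have "\<dots> \<le> exp (1 / 2)" using mL m2 by (simp add: field_simps)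
    also have "\<dots> = sqrt (exp 1)"
    proof -
      have "exp 1 = exp (1 / 2 :: real) ^ 2" by (simp flip: exp_of_nat_mult)
      then show ?thesis by simp
    qed
    finally show "real n powr (1 / (2 * m)) \<le> sqrt (exp 1)" .
  qed auto
  also have "sqrt (exp 1) * sqrt (real m / (exp 1 * real n)) = sqrt (real m / real n)"
    by (simp flip: real_sqrt_mult)
  finally have "(8 * sqrt (2 * real n * ln (50 * real m) * (fact m / real n ^ m))) powr (1 / m) * sqrt (n / L)
      \<le> G powr (1 / (2 * m)) * sqrt (real m / real n) * sqrt (n / L)"
    using L by (intro mult_right_mono) auto
  also have "\<dots> = G powr (1 / (2 * m)) * sqrt (real m / L)"
    using n0 by (simp add: mult.assoc flip: real_sqrt_mult)
  also have "\<dots> \<le> G powr (1 / (2 * m)) * sqrt (m / (real m - 1))"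
    using mL m2 by (intro mult_left_mono real_sqrt_le_mono divide_left_mono mult_pos_pos) auto
  finally show ?thesis by (simp add: L_def G_def)
qed

theorem theorem1p3:
  fixes p q :: real
  assumes "p \<ge> 1" and "q \<ge> 1"
    and "complex_fin_dim TYPE('a::{complex_normed_vector_space, banach})"
    and "\<exists>v::'a. v \<noteq> 0"
    and "RX p q 1 TYPE('a) > 0"
  shows "(\<lambda>n. RX p q n TYPE('a) * ereal (sqrt (real n / ln (real n)))) \<longlonglongrightarrow> 1"
proof (rule order_tendstoI)
  fix a :: ereal assume a: "a < 1"
  \<comment> \<open>The given a may be negative or minus infinity; the number a' plays the role of 1
    - \<epsilon> in the lower bound.\<close>
  obtain a' where a': "a < ereal a'" "0 < a'" "a' < 1"
  proof -
    have "max a 0 < 1" using a by simp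
    then obtain e where e: "max a 0 < ereal e" "ereal e < 1" using ereal_dense2 by blast
    then show ?thesis using that[of e] by (auto simp: zero_ereal_def one_ereal_def)
  qed
  have "\<forall>\<^sub>F n in sequentially. ereal ((1 - (1 - a')) * sqrt (ln n / n)) \<le> RX p q n TYPE('a)"
    by (rule RX_lower_bound) (use assms a' in auto)
  then show "\<forall>\<^sub>F n in sequentially. a < RX p q n TYPE('a) * ereal (sqrt (real n / ln (real n)))"
    using eventually_ge_at_top[of 3]
  proof eventually_elim
    case (elim n)
    then have ln0: "ln (real n) > 0" by simp
    have "sqrt (ln n / n) * sqrt (n / ln n) = 1"
      using ln0 elim(2) by (simp flip: real_sqrt_mult)
    then have "ereal a' = ereal (a' * sqrt (ln n / n)) * ereal (sqrt (n / ln n))"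
      by (simp add: mult.assoc)
    also have "\<dots> \<le> RX p q n TYPE('a) * ereal (sqrt (n / ln n))"
      using elim(1) ln0 by (intro ereal_mult_right_mono) auto
    finally show ?case using a'(1) by (rule less_le_trans[rotated])
  qed
next
  fix b :: ereal assume b: "1 < b"
  \<comment> \<open>The upper bound depends on n only through m = \<lceil>log n\<rceil>, which tends
    to infinity, so the limit of g along the integers decides.\<close>
  define g where "g m = (128 * exp 1 * real m * ln (50 * real m)) powr (1 / (2 * real m)) * sqrt (real m / (real m - 1))" for m
  have "g \<longlonglongrightarrow> 1" unfolding g_def by real_asymp
  moreover have "filterlim (\<lambda>n. nat \<lceil>ln (real n)\<rceil>) sequentially sequentially" by real_asymp
  ultimately have "(\<lambda>n. g (nat \<lceil>ln (real n)\<rceil>)) \<longlonglongrightarrow> 1" by (rule filterlim_compose)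
  then have "(\<lambda>n. ereal (g (nat \<lceil>ln (real n)\<rceil>))) \<longlonglongrightarrow> 1" by (simp add: one_ereal_def)
  then have "\<forall>\<^sub>F n in sequentially. ereal (g (nat \<lceil>ln (real n)\<rceil>)) < b" using b by (rule order_tendstoD(2))
  then show "\<forall>\<^sub>F n in sequentially. RX p q n TYPE('a) * ereal (sqrt (real n / ln (real n))) < b"
    using eventually_ge_at_top[of 3]
  proof eventually_elim
    case (elim n)
    define m where "m = nat \<lceil>ln (real n)\<rceil>"
    have ln0: "ln (real n) > 0" using elim by simp
    then have m: "m \<ge> 1" unfolding m_def by linarith
    have "RX p q n TYPE('a) * ereal (sqrt (n / ln n))
       \<le> ereal ((8 * sqrt (2 * real n * ln (50 * real m) * (fact m / real n ^ m))) powr (1 / m)) * ereal (sqrt (n / ln n))"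
      using elim(2) ln0 by (intro ereal_mult_right_mono RX_upper_bound assms m) auto
    also have "\<dots> \<le> ereal (g m)"
      using upper_bound_numeric[OF elim(2) m_def] by (simp add: g_def)
    also have "\<dots> < b" using elim(1) by (simp add: m_def)
    finally show ?case .
  qed
qed

end
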